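(* Let $X$ be a space with an involution $\tau$ and $X_0\subset X$ a $\tau$-invariant subspace with $H^{odd}(X,X_0)=0$. Let $(\kappa,\sigma)$ and $(\kappa',\sigma')$ be two $H^*$-frames for the involution $\tau$ on $(X,X_0)$. Then $(\kappa,\sigma)=(\kappa',\sigma')$.
   Context: $H^*$ denotes singular cohomology with $\mathbb{Z}_2$-coefficients. An involution $\tau$ on a space $X$ is a continuous action of the group $C=\{1,\tau\}$ of order $2$; $X^\tau$ is its fixed point set. A subspace $Y\subset X$ is $\tau$-invariant if $\tau(Y)=Y$; $Y^\tau=Y\cap X^\tau$. Equivariant cohomology is defined by the Borel construction: $H^*_C(X,Y)=H^*(EC\times_C X,EC\times_C Y)$. Write $H^*(BC)=\mathbb{Z}_2[u]$ with $\deg u=1$; since $C$ acts trivially on $X^\tau$, the Künneth formula identifies $H^*_C(X^\tau,Y^\tau)$ with the polynomial ring $H^*(X^\tau,Y^\tau)[u]$. Let $\rho\colon H^{2*}_C(X,Y)\to H^{2*}(X,Y)$ and $r\colon H^*_C(X,Y)\to H^*_C(X^\tau,Y^\tau)$ be the restriction homomorphisms. An $H^*$-frame for $(X,Y)$ is a pair $(\kappa,\sigma)$ where $\kappa\colon H^{2*}(X,Y)\to H^*(X^\tau,Y^\tau)$ is an additive isomorphism dividing degrees in half, $\sigma\colon H^{2*}(X,Y)\to H^{2*}_C(X,Y)$ is an additive (degree-preserving) section of $\rho$, and for all $m\in\mathbb{N}$ and all $a\in H^{2m}(X,Y)$ the conjugation equation $r\circ\sigma(a)=\kappa(a)u^m+\ell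 t_m$ holds, where $\ell t_m$ denotes some polynomial in the variable $u$ (with coefficients in $H^*(X^\tau,Y^\tau)$) of degree less than $m$. *)

theory Defs
  imports "HOL-Homology.Homology" "HOL-Library.Z2"
begin

section \<open>Singular cohomology of pairs with coefficients in \<open>\<int>\<^sub>2\<close>\<close>

type_synonym 'a cochain = "((nat \<Rightarrow> real) \<Rightarrow> 'a) \<Rightarrow> bit"

text \<open>
  As in HOL-Homology, a pair consists of a topology \<open>X\<close> and a set \<open>S\<close> which carries the
  subspace topology.  Cochains are functions on singular simplices. A relative cochain vanishes on
  the simplices of \<open>S\<close>.  It is normalised to 0 on all functions that are not
  simplices, so that equal cochains are equal as HOL functions.
\<close>

definition singular_cochain :: "nat \<Rightarrow> 'a topology \<Rightarrow> 'a set \<Rightarrow> 'a cochain \<Rightarrow> bool" where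
  "singular_cochain p X S \<phi> \<longleftrightarrow>
     (\<forall>f. \<not> singular_simplex p X f \<longrightarrow> \<phi> f = 0) \<and>
     (\<forall>f. singular_simplex p (subtopology X S) f \<longrightarrow> \<phi> f = 0)"

text \<open>The alternating signs of the boundary disappear modulo 2.\<close>

definition coboundary :: "nat \<Rightarrow> 'a topology \<Rightarrow> 'a cochain \<Rightarrow> 'a cochain" where
  "coboundary p X \<phi> =
     (\<lambda>f. if singular_simplex (Suc p) X f
          then \<Sum>k\<le>Suc p. \<phi> (singular_face (Suc p) k f) else 0)"

definition singular_cocycle :: "nat \<Rightarrow> 'a topology \<Rightarrow> 'a set \<Rightarrow> 'a cochain \<Rightarrow> bool" where
  "singular_cocycle p X S \<phi> \<longleftrightarrow> singular_cochain p X S \<phi> \<and> coboundary p X \<phi> = (\<lambda>f. 0)"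

definition singular_coboundary :: "nat \<Rightarrow> 'a topology \<Rightarrow> 'a set \<Rightarrow> 'a cochain \<Rightarrow> bool" where
  "singular_coboundary p X S \<phi> \<longleftrightarrow>
     (case p of 0 \<Rightarrow> \<phi> = (\<lambda>f. 0)
              | Suc q \<Rightarrow> \<exists>\<psi>. singular_cochain q X S \<psi> \<and> \<phi> = coboundary q X \<psi>)"

definition cocycle_group :: "nat \<Rightarrow> 'a topology \<Rightarrow> 'a set \<Rightarrow> 'a cochain monoid" where
  "cocycle_group p X S =
     \<lparr>carrier = Collect (singular_cocycle p X S),
      mult = (\<lambda>\<phi> \<psi> f. \<phi> f + \<psi> f), one = (\<lambda>f. 0)\<rparr>"

definition cohomology_group :: "nat \<Rightarrow> 'a topology \<Rightarrow> 'a set \<Rightarrow> 'a cochain set monoid" where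
  "cohomology_group p X S = cocycle_group p X S Mod Collect (singular_coboundary p X S)"

definition cohomology_class ::
  "nat \<Rightarrow> 'a topology \<Rightarrow> 'a set \<Rightarrow> 'a cochain \<Rightarrow> 'a cochain set" where
  "cohomology_class p X S \<phi> =
     Collect (singular_coboundary p X S) #>\<^bsub>cocycle_group p X S\<^esub> \<phi>"

subsection \<open>Induced homomorphisms\<close>

definition cochain_map :: "nat \<Rightarrow> 'a topology \<Rightarrow> ('a \<Rightarrow> 'b) \<Rightarrow> 'b cochain \<Rightarrow> 'a cochain" where
  "cochain_map p X g \<phi> = (\<lambda>f. if singular_simplex p X f then \<phi> (simplex_map p g f) else 0)"

text \<open>
  The homomorphism \<open>H\<^sup>p(X',S') \<rightarrow> H\<^sup>p(X,S)\<close> induced by a map of pairs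
  \<open>g : (X,S) \<rightarrow> (X',S')\<close>.  A class is the set of its representing cocycles; the classes of the
  pulled-back representatives all coincide, and their union is that common class.
\<close>

definition cohomology_map ::
  "nat \<Rightarrow> 'a topology \<Rightarrow> 'a set \<Rightarrow> ('a \<Rightarrow> 'b) \<Rightarrow> 'b cochain set \<Rightarrow> 'a cochain set" where
  "cohomology_map p X S g A = (\<Union>\<phi>\<in>A. cohomology_class p X S (cochain_map p X g \<phi>))"

subsection \<open>Cup product\<close>

definition front_face :: "nat \<Rightarrow> ((nat \<Rightarrow> real) \<Rightarrow> 'a) \<Rightarrow> (nat \<Rightarrow> real) \<Rightarrow> 'a" where
  "front_face p f = restrict f (standard_simplex p)"

definition back_face :: "nat \<Rightarrow> nat \<Rightarrow> ((nat \<Rightarrow> real) \<Rightarrow> 'a) \<Rightarrow> (nat \<Rightarrow> real) \<Rightarrow> 'a" where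
  "back_face p q f = restrict (\<lambda>x. f (\<lambda>i. if i < p then 0 else x (i - p))) (standard_simplex q)"

definition cup_cochain ::
  "nat \<Rightarrow> nat \<Rightarrow> 'a topology \<Rightarrow> 'a cochain \<Rightarrow> 'a cochain \<Rightarrow> 'a cochain" where
  "cup_cochain p q X \<phi> \<psi> =
     (\<lambda>f. if singular_simplex (p + q) X f
          then \<phi> (front_face p f) * \<psi> (back_face p q f) else 0)"

text \<open>The cup product \<open>H\<^sup>p(X,S) \<times> H\<^sup>q(X) \<rightarrow> H\<^sup>p\<^sup>+\<^sup>q(X,S)\<close>.\<close>

definition cup ::
  "nat \<Rightarrow> nat \<Rightarrow> 'a topology \<Rightarrow> 'a set \<Rightarrow> 'a cochain set \<Rightarrow> 'a cochain set \<Rightarrow> 'a cochain set" where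
  "cup p q X S A B =
     (\<Union>\<phi>\<in>A. \<Union>\<psi>\<in>B. cohomology_class (p + q) X S (cup_cochain p q X \<phi> \<psi>))"

fun cup_power :: "'a topology \<Rightarrow> 'a cochain set \<Rightarrow> nat \<Rightarrow> 'a cochain set" where
  "cup_power X u 0 =
     cohomology_class 0 X {} (\<lambda>f. if singular_simplex 0 X f then 1 else 0)"
| "cup_power X u (Suc i) = cup i 1 X {} (cup_power X u i) u"

section \<open>Involutions and the Borel construction\<close>

definition involution :: "'a topology \<Rightarrow> ('a \<Rightarrow> 'a) \<Rightarrow> bool" where
  "involution X \<tau> \<longleftrightarrow> continuous_map X X \<tau> \<and> (\<forall>x\<in>topspace X. \<tau> (\<tau> x) = x)"

definition invariant_subspace :: "'a topology \<Rightarrow> ('a \<Rightarrow> 'a) \<Rightarrow> 'a set \<Rightarrow> bool" where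
  "invariant_subspace X \<tau> Y \<longleftrightarrow> Y \<subseteq> topspace X \<and> \<tau> ` Y = Y"

definition fixed_points :: "'a topology \<Rightarrow> ('a \<Rightarrow> 'a) \<Rightarrow> 'a set" where
  "fixed_points X \<tau> = {x \<in> topspace X. \<tau> x = x}"

definition orbit :: "('a \<Rightarrow> 'a) \<Rightarrow> 'a \<Rightarrow> 'a set" where
  "orbit g z = {z, g z}"

definition orbit_space :: "'a topology \<Rightarrow> ('a \<Rightarrow> 'a) \<Rightarrow> 'a set topology" where
  "orbit_space Z g =
     topology (\<lambda>U. U \<subseteq> orbit g ` topspace Z \<and> openin Z {z \<in> topspace Z. orbit g z \<in> U})"

lemma openin_orbit_space:
  "openin (orbit_space Z g) U \<longleftrightarrow>
     U \<subseteq> orbit g ` topspace Z \<and> openin Z {z \<in> topspace Z. orbit g z \<in> U}"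
proof -
  have "istopology (\<lambda>U. U \<subseteq> orbit g ` topspace Z \<and> openin Z {z \<in> topspace Z. orbit g z \<in> U})"
    unfolding istopology_def
  proof (rule conjI; intro allI impI; (elim conjE)?)
    fix S T
    assume "S \<subseteq> orbit g ` topspace Z" "openin Z {z \<in> topspace Z. orbit g z \<in> S}"
      and "openin Z {z \<in> topspace Z. orbit g z \<in> T}"
    moreover have "{z \<in> topspace Z. orbit g z \<in> S \<inter> T} =
        {z \<in> topspace Z. orbit g z \<in> S} \<inter> {z \<in> topspace Z. orbit g z \<in> T}" by auto
    ultimately show "S \<inter> T \<subseteq> orbit g ` topspace Z \<and>
        openin Z {z \<in> topspace Z. orbit g z \<in> S \<inter> T}" by auto
  next
    fix K
    assume "\<forall>S\<in>K. S \<subseteq> orbit g ` topspace Z \<and> openin Z {z \<in> topspace Z. orbit g z \<in> S}"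
    moreover have "{z \<in> topspace Z. orbit g z \<in> \<Union>K} =
        (\<Union>S\<in>K. {z \<in> topspace Z. orbit g z \<in> S})" by auto
    ultimately show "\<Union>K \<subseteq> orbit g ` topspace Z \<and>
        openin Z {z \<in> topspace Z. orbit g z \<in> \<Union>K}" by auto
  qed
  then show ?thesis by (simp add: orbit_space_def)
qed

lemma topspace_orbit_space: "topspace (orbit_space Z g) = orbit g ` topspace Z"
proof -
  have "{z \<in> topspace Z. orbit g z \<in> orbit g ` topspace Z} = topspace Z" by auto
  then have "openin (orbit_space Z g) (orbit g ` topspace Z)" by (simp add: openin_orbit_space)
  then show ?thesis by (metis openin_orbit_space openin_subset openin_topspace subset_antisym)
qed

lemma quotient_map_orbit_space: "quotient_map Z (orbit_space Z g) (orbit g)"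
  unfolding quotient_map_def by (auto simp: topspace_orbit_space openin_orbit_space)

text \<open>
  \<open>universal_space E \<epsilon>\<close> says that \<open>E\<close> with the involution \<open>\<epsilon>\<close> is a model of \<open>EC\<close>: a
  contractible space on which the group \<open>C\<close> of order 2 acts freely, such that
  \<open>E \<rightarrow> E/C\<close> is a principal bundle, that is (\<open>C\<close> being discrete) a covering.  All
  notions below take such a model as a parameter.
\<close>

definition universal_space :: "'e topology \<Rightarrow> ('e \<Rightarrow> 'e) \<Rightarrow> bool" where
  "universal_space E \<epsilon> \<longleftrightarrow>
     involution E \<epsilon> \<and> topspace E \<noteq> {} \<and> contractible_space E \<and>
     (\<forall>e\<in>topspace E. \<exists>U. openin E U \<and> e \<in> U \<and> U \<inter> \<epsilon> ` U = {})"

text \<open>Models exist: the nonzero real sequences with the antipodal involution.\<close>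

lemma universal_space_nonzero_sequences:
  "universal_space (top_of_set {x :: nat \<Rightarrow> real. x \<noteq> (\<lambda>i. 0)}) (\<lambda>x i. - x i)"
proof -
  let ?E = "{x :: nat \<Rightarrow> real. x \<noteq> (\<lambda>i. 0)}"
  define s :: "(nat \<Rightarrow> real) \<Rightarrow> nat \<Rightarrow> real" where "s = (\<lambda>x. case_nat 0 x)"
  define e :: "nat \<Rightarrow> real" where "e = case_nat 1 (\<lambda>i. 0)"
  have ct: "continuous_on T (\<lambda>z. fst z)" for T :: "(real \<times> (nat \<Rightarrow> real)) set"
    by (rule continuous_on_fst[OF continuous_on_id])
  have cx: "continuous_on T (\<lambda>z. snd z i)" for T :: "(real \<times> (nat \<Rightarrow> real)) set" and i
    by (rule continuous_on_product_then_coordinatewise[OF continuous_on_snd[OF continuous_on_id]])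
  have cs: "continuous_on T (\<lambda>z. s (snd z) i)" for T :: "(real \<times> (nat \<Rightarrow> real)) set" and i
    unfolding s_def by (cases i) (simp_all add: cx)
  have c1: "continuous_on ({0..1} \<times> ?E) (\<lambda>z i. (1 - fst z) * snd z i + fst z * s (snd z) i)"
    by (intro continuous_on_coordinatewise_then_product continuous_on_add continuous_on_mult
        continuous_on_diff continuous_on_const ct cx cs)
  have c2: "continuous_on ({0..1} \<times> ?E) (\<lambda>z i. (1 - fst z) * s (snd z) i + fst z * e i)"
    by (intro continuous_on_coordinatewise_then_product continuous_on_add continuous_on_mult
        continuous_on_diff continuous_on_const ct cs)
  have n1: "(\<lambda>i. (1 - t) * x i + t * s x i) \<noteq> (\<lambda>i. 0)"
    if "x \<noteq> (\<lambda>i. 0)" for x :: "nat \<Rightarrow> real" and t :: real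
  proof
    assume "(\<lambda>i. (1 - t) * x i + t * s x i) = (\<lambda>i. 0)"
    then have eq: "(1 - t) * x i + t * s x i = 0" for i by (rule fun_cong)
    have "x i = 0" for i
    proof (cases "t = 1")
      case True
      then show ?thesis using eq[of "Suc i"] by (simp add: s_def)
    next
      case False
      show ?thesis
      proof (induction i)
        case 0
        then show ?case using eq[of 0] False by (simp add: s_def)
      next
        case (Suc i)
        then show ?case using eq[of "Suc i"] False by (simp add: s_def)
      qed
    qed
    then show False using that by auto
  qed
  have n2: "(\<lambda>i. (1 - t) * s x i + t * e i) \<noteq> (\<lambda>i. 0)"
    if "x \<noteq> (\<lambda>i. 0)" for x :: "nat \<Rightarrow> real" and t :: real
  proof
    assume "(\<lambda>i. (1 - t) * s x i + t * e i) = (\<lambda>i. 0)"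
    then have eq: "(1 - t) * s x i + t * e i = 0" for i by (rule fun_cong)
    have "t = 0" using eq[of 0] by (simp add: s_def e_def)
    then have "x i = 0" for i using eq[of "Suc i"] by (simp add: s_def e_def)
    then show False using that by auto
  qed
  have h1: "homotopic_with_canon (\<lambda>x. True) ?E ?E id s"
    unfolding homotopic_with_def
    by (rule exI[of _ "\<lambda>z i. (1 - fst z) * snd z i + fst z * s (snd z) i"])
       (use c1 n1 in \<open>simp add: image_subset_iff Pi_iff id_def del: split_paired_All\<close>)
  have h2: "homotopic_with_canon (\<lambda>x. True) ?E ?E s (\<lambda>x. e)"
    unfolding homotopic_with_def
    by (rule exI[of _ "\<lambda>z i. (1 - fst z) * s (snd z) i + fst z * e i"])
       (use c2 n2 in \<open>simp add: image_subset_iff Pi_iff del: split_paired_All\<close>)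
  have contr: "contractible_space (top_of_set ?E)"
    unfolding contractible_space_def using homotopic_with_trans[OF h1 h2] by blast
  have cn: "continuous_on T (\<lambda>x. x i)" for T :: "(nat \<Rightarrow> real) set" and i
    by (rule continuous_on_product_then_coordinatewise[OF continuous_on_id])
  have "continuous_on ?E (\<lambda>x i. - x i)"
    by (intro continuous_on_coordinatewise_then_product continuous_on_minus cn)
  then have inv: "involution (top_of_set ?E) (\<lambda>x i. - x i)"
    unfolding involution_def by (simp add: fun_eq_iff Pi_iff)
  have "e 0 \<noteq> 0" by (simp add: e_def)
  then have "e \<in> ?E" by auto
  then have ne: "topspace (top_of_set ?E) \<noteq> {}" by auto
  have cov: "\<exists>U. openin (top_of_set ?E) U \<and> x \<in> U \<and> U \<inter> (\<lambda>x i. - x i) ` U = {}"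
    if x: "x \<in> ?E" for x
  proof -
    obtain i where i: "x i \<noteq> 0" using x by (auto simp: fun_eq_iff)
    define U where "U = {y :: nat \<Rightarrow> real. 0 < x i * y i}"
    have "open U" unfolding U_def
      by (intro open_Collect_less continuous_on_mult continuous_on_const cn)
    moreover have "U \<subseteq> ?E" by (auto simp: U_def)
    ultimately have "openin (top_of_set ?E) U" by (rule open_subset[rotated])
    moreover have "x \<in> U" using i by (simp add: U_def flip: power2_eq_square)
    moreover have "U \<inter> (\<lambda>x i. - x i) ` U = {}" by (auto simp: U_def)
    ultimately show ?thesis by blast
  qed
  show ?thesis unfolding universal_space_def using contr inv ne cov by simp
qed

definition borel_construction :: "'e topology \<Rightarrow> ('e \<Rightarrow> 'e) \<Rightarrow> 'a topology \<Rightarrow> ('a \<Rightarrow> 'a) \<Rightarrow> ('e \<times> 'a) set topology"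
  where "borel_construction E \<epsilon> X \<tau> = orbit_space (prod_topology E X) (map_prod \<epsilon> \<tau>)"

definition borel_subspace ::
  "'e topology \<Rightarrow> ('e \<Rightarrow> 'e) \<Rightarrow> ('a \<Rightarrow> 'a) \<Rightarrow> 'a set \<Rightarrow> ('e \<times> 'a) set set" where
  "borel_subspace E \<epsilon> \<tau> Y = orbit (map_prod \<epsilon> \<tau>) ` (topspace E \<times> Y)"

definition equivariant_cohomology ::
  "'e topology \<Rightarrow> ('e \<Rightarrow> 'e) \<Rightarrow> nat \<Rightarrow> 'a topology \<Rightarrow> ('a \<Rightarrow> 'a) \<Rightarrow> 'a set
     \<Rightarrow> ('e \<times> 'a) set cochain set monoid" where
  "equivariant_cohomology E \<epsilon> p X \<tau> Y =
     cohomology_group p (borel_construction E \<epsilon> X \<tau>) (borel_subspace E \<epsilon> \<tau> Y)"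

text \<open>
  \<open>\<rho>\<close> is restriction to a fibre of \<open>EC \<times>\<^sub>C X \<rightarrow> BC\<close>; the choice of the point of the
  (path connected) space \<open>E\<close> is immaterial.
\<close>

definition fibre_inclusion ::
  "'e topology \<Rightarrow> ('e \<Rightarrow> 'e) \<Rightarrow> ('a \<Rightarrow> 'a) \<Rightarrow> 'a \<Rightarrow> ('e \<times> 'a) set" where
  "fibre_inclusion E \<epsilon> \<tau> x = orbit (map_prod \<epsilon> \<tau>) (SOME e. e \<in> topspace E, x)"

definition restrict_fibre ::
  "'e topology \<Rightarrow> ('e \<Rightarrow> 'e) \<Rightarrow> nat \<Rightarrow> 'a topology \<Rightarrow> ('a \<Rightarrow> 'a) \<Rightarrow> 'a set
     \<Rightarrow> ('e \<times> 'a) set cochain set \<Rightarrow> 'a cochain set" where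
  "restrict_fibre E \<epsilon> p X \<tau> Y = cohomology_map p X Y (fibre_inclusion E \<epsilon> \<tau>)"

abbreviation fixed_space :: "'a topology \<Rightarrow> ('a \<Rightarrow> 'a) \<Rightarrow> 'a topology" where
  "fixed_space X \<tau> \<equiv> subtopology X (fixed_points X \<tau>)"

abbreviation fixed_subspace :: "'a topology \<Rightarrow> ('a \<Rightarrow> 'a) \<Rightarrow> 'a set \<Rightarrow> 'a set" where
  "fixed_subspace X \<tau> Y \<equiv> Y \<inter> fixed_points X \<tau>"

text \<open>
  \<open>r\<close> is induced by the inclusion \<open>EC \<times>\<^sub>C X\<^sup>\<tau> \<rightarrow> EC \<times>\<^sub>C X\<close>.  Points of both spaces
  are orbits in \<open>E \<times> X\<close>, so that this inclusion is the identity on elements.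
\<close>

definition restrict_fixed ::
  "'e topology \<Rightarrow> ('e \<Rightarrow> 'e) \<Rightarrow> nat \<Rightarrow> 'a topology \<Rightarrow> ('a \<Rightarrow> 'a) \<Rightarrow> 'a set
     \<Rightarrow> ('e \<times> 'a) set cochain set \<Rightarrow> ('e \<times> 'a) set cochain set" where
  "restrict_fixed E \<epsilon> p X \<tau> Y =
     cohomology_map p (borel_construction E \<epsilon> (fixed_space X \<tau>) \<tau>)
       (borel_subspace E \<epsilon> \<tau> (fixed_subspace X \<tau> Y)) (\<lambda>w. w)"

section \<open>The identification \<open>H\<^sup>*\<^sub>C(X\<^sup>\<tau>,Y\<^sup>\<tau>) = H\<^sup>*(X\<^sup>\<tau>,Y\<^sup>\<tau>)[u]\<close>\<close>

text \<open>\<open>H\<^sup>1(BC)\<close> has exactly one nonzero element.\<close>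

definition universal_class :: "'e topology \<Rightarrow> ('e \<Rightarrow> 'e) \<Rightarrow> 'e set cochain set" where
  "universal_class E \<epsilon> =
     (THE u. u \<in> carrier (cohomology_group 1 (orbit_space E \<epsilon>) {}) \<and>
             u \<noteq> \<one>\<^bsub>cohomology_group 1 (orbit_space E \<epsilon>) {}\<^esub>)"

text \<open>
  The part of total degree \<open>n\<close> of \<open>H\<^sup>*(F,S)[u]\<close>: the polynomial \<open>\<Sum>i\<le>n. c i u\<^sup>i\<close> with
  coefficients \<open>c i\<close> of degree \<open>n - i\<close> is represented by the family \<open>c\<close>.
\<close>

definition poly_group :: "nat \<Rightarrow> 'a topology \<Rightarrow> 'a set \<Rightarrow> (nat \<Rightarrow> 'a cochain set) monoid" where
  "poly_group n F S = product_group {..n} (\<lambda>i. cohomology_group (n - i) F S)"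

definition poly_monom ::
  "nat \<Rightarrow> 'a topology \<Rightarrow> 'a set \<Rightarrow> 'a cochain set \<Rightarrow> nat \<Rightarrow> nat \<Rightarrow> 'a cochain set" where
  "poly_monom n F S c k =
     (\<lambda>i\<in>{..n}. if i = k then c else \<one>\<^bsub>cohomology_group (n - i) F S\<^esub>)"

definition poly_degree_less :: "nat \<Rightarrow> 'a topology \<Rightarrow> 'a set \<Rightarrow> nat \<Rightarrow> (nat \<Rightarrow> 'a cochain set) \<Rightarrow> bool"
  where "poly_degree_less n F S m q \<longleftrightarrow>
     (\<forall>i\<le>n. m \<le> i \<longrightarrow> q i = \<one>\<^bsub>cohomology_group (n - i) F S\<^esub>)"

text \<open>
  For a trivial action of \<open>C\<close> on \<open>F\<close>, the orbits in \<open>E \<times> F\<close> are \<open>{(e,x), (\<epsilon> e,x)}\<close>, and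
  \<open>EC \<times>\<^sub>C F = BC \<times> F\<close> by means of the following two projections.
\<close>

definition borel_to_base :: "('e \<times> 'a) set \<Rightarrow> 'e set" where
  "borel_to_base w = fst ` w"

definition borel_to_fixed :: "('e \<times> 'a) set \<Rightarrow> 'a" where
  "borel_to_fixed w = the_elem (snd ` w)"

text \<open>
  The Kuenneth isomorphism from \<open>H\<^sup>*(F,S)[u]\<close> to \<open>H\<^sup>*\<^sub>C(F,S)\<close> in degree \<open>n\<close>; it sends
  \<open>\<Sum>i\<le>n. c i u\<^sup>i\<close> to the sum of the cross products of \<open>c i\<close> and \<open>u\<^sup>i\<close>.
\<close>

definition kuenneth ::
  "'e topology \<Rightarrow> ('e \<Rightarrow> 'e) \<Rightarrow> nat \<Rightarrow> 'a topology \<Rightarrow> ('a \<Rightarrow> 'a) \<Rightarrow> 'a set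
     \<Rightarrow> (nat \<Rightarrow> 'a cochain set) \<Rightarrow> ('e \<times> 'a) set cochain set" where
  "kuenneth E \<epsilon> n F \<tau> S c =
     (let Z = borel_construction E \<epsilon> F \<tau>; T = borel_subspace E \<epsilon> \<tau> S; B = orbit_space E \<epsilon> in
      finprod (equivariant_cohomology E \<epsilon> n F \<tau> S)
        (\<lambda>i. cup (n - i) i Z T
               (cohomology_map (n - i) Z T borel_to_fixed (c i))
               (cohomology_map i Z {} borel_to_base (cup_power B (universal_class E \<epsilon>) i)))
        {..n})"

section \<open>Frames\<close>

text \<open>
  The graded maps \<open>\<kappa>\<close> and \<open>\<sigma>\<close> are given by their components: \<open>\<kappa> m\<close> is defined on
  \<open>H\<^sup>2\<^sup>m(X,Y)\<close> with values in \<open>H\<^sup>m(X\<^sup>\<tau>,Y\<^sup>\<tau>)\<close>, and \<open>\<sigma> m\<close> is defined on \<open>H\<^sup>2\<^sup>m(X,Y)\<close> with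
  values in \<open>H\<^sup>2\<^sup>m\<^sub>C(X,Y)\<close>.  Since both sides of the conjugation equation lie in degree \<open>2m\<close>, the
  polynomial of lower order is taken in that degree as well.
\<close>

definition conjugation_equation ::
  "'e topology \<Rightarrow> ('e \<Rightarrow> 'e) \<Rightarrow> 'a topology \<Rightarrow> ('a \<Rightarrow> 'a) \<Rightarrow> 'a set
     \<Rightarrow> (nat \<Rightarrow> 'a cochain set \<Rightarrow> 'a cochain set)
     \<Rightarrow> (nat \<Rightarrow> 'a cochain set \<Rightarrow> ('e \<times> 'a) set cochain set)
     \<Rightarrow> nat \<Rightarrow> 'a cochain set \<Rightarrow> bool" where
  "conjugation_equation E \<epsilon> X \<tau> Y \<kappa> \<sigma> m a \<longleftrightarrow>
     (let F = fixed_space X \<tau>; S = fixed_subspace X \<tau> Y; P = poly_group (2 * m) F S in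
      \<exists>lt \<in> carrier P. poly_degree_less (2 * m) F S m lt \<and>
        restrict_fixed E \<epsilon> (2 * m) X \<tau> Y (\<sigma> m a) =
          kuenneth E \<epsilon> (2 * m) F \<tau> S (poly_monom (2 * m) F S (\<kappa> m a) m \<otimes>\<^bsub>P\<^esub> lt))"

definition cohomology_frame ::
  "'e topology \<Rightarrow> ('e \<Rightarrow> 'e) \<Rightarrow> 'a topology \<Rightarrow> ('a \<Rightarrow> 'a) \<Rightarrow> 'a set
     \<Rightarrow> (nat \<Rightarrow> 'a cochain set \<Rightarrow> 'a cochain set)
     \<Rightarrow> (nat \<Rightarrow> 'a cochain set \<Rightarrow> ('e \<times> 'a) set cochain set) \<Rightarrow> bool" where
  "cohomology_frame E \<epsilon> X \<tau> Y \<kappa> \<sigma> \<longleftrightarrow>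
     (\<forall>m. \<kappa> m \<in> iso (cohomology_group (2 * m) X Y)
                   (cohomology_group m (fixed_space X \<tau>) (fixed_subspace X \<tau> Y))) \<and>
     (\<forall>m. \<sigma> m \<in> hom (cohomology_group (2 * m) X Y)
                   (equivariant_cohomology E \<epsilon> (2 * m) X \<tau> Y)) \<and>
     (\<forall>m. \<forall>a \<in> carrier (cohomology_group (2 * m) X Y).
        restrict_fibre E \<epsilon> (2 * m) X \<tau> Y (\<sigma> m a) = a) \<and>
     (\<forall>m. \<forall>a \<in> carrier (cohomology_group (2 * m) X Y). conjugation_equation E \<epsilon> X \<tau> Y \<kappa> \<sigma> m a)"

end

theory Submission
  imports Defs "HOL-Library.Function_Algebras"
begin

text \<open>
  Idea.  Put \<open>Z = EC \<times>\<^sub>C X\<close>.  The Gysin sequence of the double covering \<open>E \<times> X \<rightarrow> Z\<close>, whose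
  total space is homotopy equivalent to \<open>X\<close>, says that the kernel of \<open>\<rho>\<close> consists of the
  multiples of \<open>u\<close>; for a trivial action it also shows that multiplication by \<open>u\<close> is injective,
  and hence that the Kuenneth map is injective.  No Leray-Hirsch theorem is needed.

  Call \<open>y \<in> H\<^sup>n\<^sub>C(X,Y)\<close> small if \<open>r y\<close> has only coefficients of \<open>u\<^sup>i\<close> with \<open>2 i < n\<close>.  Small
  elements vanish, by induction on \<open>n\<close>: subtracting \<open>y' = \<sigma> (\<rho> y)\<close> (which is 0 for odd \<open>n\<close>) gives an
  element \<open>z u\<close>, and \<open>r (z u)\<close> has degree at most \<open>n/2\<close> in \<open>u\<close>, so that \<open>z\<close> is small again and
  therefore 0.  Thus \<open>y = y'\<close>, and \<open>\<kappa> (\<rho> y)\<close>, being the coefficient of \<open>u\<^sup>n\<^sup>/\<^sup>2\<close> in \<open>r y\<close>, is 0.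
  For two frames, \<open>\<sigma> a + \<sigma>' a\<close> lies in the kernel of \<open>\<rho>\<close>, so it equals \<open>z u\<close>, and the
  conjugation equations make \<open>z\<close> small.  Hence \<open>\<sigma> = \<sigma>'\<close>, and comparing leading coefficients
  \<open>\<kappa> = \<kappa>'\<close>.
\<close>

text \<open>Up to the last sections the argument runs on cocycles and the relation
  \<open>cohomologous\<close>. The Gysin sequence is made explicit by a discontinuous function
  \<open>s\<close> with \<open>s (g x) = s x + 1\<close>: read as a 0-cochain upstairs, its
  coboundary is invariant and descends, so every exactness statement becomes an identity of
  cochains. The price is that singular simplices must lift through the covering, for an arbitrary
  space X. For a trivial action the projection to F shows that pull-backs reach every class of E x
  F; as the transfer kills pull-backs modulo 2, multiplication by u is injective. Dividing by u
  preserves smallness with room to spare: z has degree n - 1, and its coefficient at u^i is the one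
  of z u at u^(i+1), so 2(i+1) \<le> n gives 2i \<le> n - 2 < n - 1. Hence a coefficient at exactly
  n/2 does no harm, which is why leading terms need not be known to agree beforehand. Odd cohomology
  enters for odd n, where no \<sigma> is at hand and \<rho> y has to vanish by itself. Injectivity
  of \<kappa> turns a vanishing leading coefficient into \<rho> y = 0.\<close>

section \<open>Cochains modulo 2\<close>

(* These rules turn sums and products of bits into xor and and, which blocks ring normalisation. *)
declare add_bit_eq_xor [simp del] mult_bit_eq_and [simp del]

lemma bit_add_self [simp]: "b + b = (0 :: bit)"
  by (cases b) (simp_all add: add_bit_eq_xor)

lemma bit_add_self_left [simp]: "b + (b + c) = (c :: bit)"
  by (simp flip: add.assoc)

lemma cochain_add_self [simp]: "\<phi> + \<phi> = (0 :: 'a cochain)"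
  by (simp add: fun_eq_iff bit_add_self)

lemma cochain_add_self_left [simp]: "\<phi> + (\<phi> + \<psi>) = (\<psi> :: 'a cochain)"
  by (simp flip: add.assoc)

lemma cochain_add_eq_0_iff: "\<phi> + \<psi> = 0 \<longleftrightarrow> \<phi> = (\<psi> :: 'a cochain)"
  by (metis add.right_neutral cochain_add_self cochain_add_self_left)

lemma singular_cochain_0 [simp]: "singular_cochain p X S 0"
  by (simp add: singular_cochain_def)

lemma singular_cochain_add:
  "\<lbrakk>singular_cochain p X S \<phi>; singular_cochain p X S \<psi>\<rbrakk> \<Longrightarrow> singular_cochain p X S (\<phi> + \<psi>)"
  by (simp add: singular_cochain_def)

lemma singular_cochain_eqI:
  assumes "singular_cochain p X S \<phi>" "singular_cochain p X S' \<psi>"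
    and "\<And>f. singular_simplex p X f \<Longrightarrow> \<phi> f = \<psi> f"
  shows "\<phi> = \<psi>"
  using assms by (metis ext singular_cochain_def)

lemma coboundary_add: "coboundary p X (\<phi> + \<psi>) = coboundary p X \<phi> + coboundary p X \<psi>"
  by (simp add: coboundary_def fun_eq_iff sum.distrib del: sum.atMost_Suc)

lemma coboundary_0 [simp]: "coboundary p X 0 = 0"
  by (simp add: coboundary_def fun_eq_iff del: sum.atMost_Suc)

lemma singular_simplex_face:
  "\<lbrakk>singular_simplex (Suc p) X f; k \<le> Suc p\<rbrakk> \<Longrightarrow> singular_simplex p X (singular_face (Suc p) k f)"
  using singular_simplex_singular_face[of "Suc p" X f k] by simp

lemma singular_cochain_coboundary:
  assumes "singular_cochain p X S \<phi>"
  shows "singular_cochain (Suc p) X S (coboundary p X \<phi>)"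
  using assms unfolding singular_cochain_def coboundary_def
  by (auto intro!: sum.neutral dest: singular_simplex_face simp del: sum.atMost_Suc)

lemma singular_face_face:
  fixes f :: "(nat \<Rightarrow> real) \<Rightarrow> 'a"
  assumes "i \<le> j" "j \<le> Suc p"
  shows "singular_face (Suc p) i (singular_face (Suc (Suc p)) (Suc j) f) =
    singular_face (Suc p) j (singular_face (Suc (Suc p)) i f)"
proof (rule ext)
  fix t :: "nat \<Rightarrow> real"
  have eq: "simplical_face (Suc j) (simplical_face i t) = simplical_face i (simplical_face j t)"
    using assms(1) by (auto simp: simplical_face_def fun_eq_iff)
  show "singular_face (Suc p) i (singular_face (Suc (Suc p)) (Suc j) f) t =
    singular_face (Suc p) j (singular_face (Suc (Suc p)) i f) t"
    using assms eq simplical_face_in_standard_simplex[of "Suc p" i t]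
      simplical_face_in_standard_simplex[of "Suc p" j t]
    by (simp add: singular_face_def)
qed

text \<open>The index rectangle splits along the diagonal into two triangles, which
  \<open>(k, l) \<mapsto> (l, k - 1)\<close> matches. Matched terms are equal, so they cancel modulo
  2.\<close>

lemma sum_face_cancel:
  fixes F :: "nat \<Rightarrow> nat \<Rightarrow> bit"
  assumes "\<And>i j. \<lbrakk>i \<le> j; j \<le> n\<rbrakk> \<Longrightarrow> F (Suc j) i = F i j"
  shows "(\<Sum>k\<le>Suc n. \<Sum>l\<le>n. F k l) = 0"
proof -
  have "(\<Sum>k\<le>Suc n. \<Sum>l\<le>n. F k l) = (\<Sum>(k,l)\<in>{..Suc n} \<times> {..n}. F k l)"
    by (rule sum.cartesian_product)
  also have "{..Suc n} \<times> {..n} = {(k,l). l < k \<and> k \<le> Suc n} \<union> {(k,l). k \<le> l \<and> l \<le> n}"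
    by auto
  also have "(\<Sum>(k,l)\<in>\<dots>. F k l) =
    (\<Sum>(k,l)\<in>{(k,l). l < k \<and> k \<le> Suc n}. F k l) + (\<Sum>(k,l)\<in>{(k,l). k \<le> l \<and> l \<le> n}. F k l)"
  proof (rule sum.union_disjoint)
    show "finite {(k,l). l < k \<and> k \<le> Suc n}"
      by (rule finite_subset[of _ "{..Suc n} \<times> {..Suc n}"]) auto
    show "finite {(k,l). k \<le> l \<and> l \<le> n}"
      by (rule finite_subset[of _ "{..n} \<times> {..n}"]) auto
  qed auto
  also have "(\<Sum>(k,l)\<in>{(k,l). l < k \<and> k \<le> Suc n}. F k l) =
      (\<Sum>(k,l)\<in>{(k,l). k \<le> l \<and> l \<le> n}. F k l)"
  proof (rule sum.reindex_bij_witness[of _ "\<lambda>(i,j). (Suc j, i)" "\<lambda>(k,l). (l, k - 1)"])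
    fix z assume "z \<in> {(k,l). l < k \<and> k \<le> Suc n}"
    then obtain k l where z: "z = (Suc k, l)" "l \<le> k" "k \<le> n"
      by (cases z; cases "fst z") auto
    then show "(case case z of (k,l) \<Rightarrow> (l, k - 1) of (i,j) \<Rightarrow> (Suc j, i)) = z"
      and "(case z of (k,l) \<Rightarrow> (l, k - 1)) \<in> {(k,l). k \<le> l \<and> l \<le> n}"
      and "(case case z of (k,l) \<Rightarrow> (l, k - 1) of (k,l) \<Rightarrow> F k l) = (case z of (k,l) \<Rightarrow> F k l)"
      by (simp_all add: assms)
  qed auto
  finally show ?thesis by (simp add: bit_add_self)
qed

lemma coboundary_coboundary [simp]: "coboundary (Suc p) X (coboundary p X \<phi>) = 0"
proof (rule ext)
  fix f
  show "coboundary (Suc p) X (coboundary p X \<phi>) f = 0 f"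
  proof (cases "singular_simplex (Suc (Suc p)) X f")
    case True
    have "coboundary (Suc p) X (coboundary p X \<phi>) f =
      (\<Sum>k\<le>Suc (Suc p). \<Sum>l\<le>Suc p. \<phi> (singular_face (Suc p) l (singular_face (Suc (Suc p)) k f)))"
      using True by (auto simp: coboundary_def singular_simplex_face simp del: sum.atMost_Suc intro!: sum.cong)
    also have "\<dots> = 0"
      by (rule sum_face_cancel) (simp add: singular_face_face)
    finally show ?thesis by simp
  qed (simp add: coboundary_def)
qed

lemma singular_cocycle_iff:
  "singular_cocycle p X S \<phi> \<longleftrightarrow> singular_cochain p X S \<phi> \<and> coboundary p X \<phi> = 0"
  by (simp add: singular_cocycle_def zero_fun_def)

lemma singular_cocycle_0 [simp]: "singular_cocycle p X S 0"
  by (simp add: singular_cocycle_iff)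

lemma singular_cocycle_add:
  "\<lbrakk>singular_cocycle p X S \<phi>; singular_cocycle p X S \<psi>\<rbrakk> \<Longrightarrow> singular_cocycle p X S (\<phi> + \<psi>)"
  by (simp add: singular_cocycle_iff singular_cochain_add coboundary_add)

lemma singular_cocycle_sum:
  "(\<And>i. i \<in> I \<Longrightarrow> singular_cocycle p X S (\<phi> i)) \<Longrightarrow> singular_cocycle p X S (\<Sum>i\<in>I. \<phi> i)"
  by (induction I rule: infinite_finite_induct) (auto intro: singular_cocycle_add)

lemma singular_coboundary_Suc:
  "singular_coboundary (Suc p) X S \<phi> \<longleftrightarrow>
    (\<exists>\<psi>. singular_cochain p X S \<psi> \<and> \<phi> = coboundary p X \<psi>)"
  by (simp add: singular_coboundary_def)

lemma singular_coboundary_at_0: "singular_coboundary 0 X S \<phi> \<longleftrightarrow> \<phi> = 0"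
  by (simp add: singular_coboundary_def zero_fun_def)

lemma singular_coboundary_0 [simp]: "singular_coboundary p X S 0"
proof (cases p)
  case (Suc q)
  then show ?thesis
    using coboundary_0 singular_cochain_0 by (metis singular_coboundary_Suc)
qed (simp add: singular_coboundary_at_0)

lemma singular_coboundary_add:
  "\<lbrakk>singular_coboundary p X S \<phi>; singular_coboundary p X S \<psi>\<rbrakk>
    \<Longrightarrow> singular_coboundary p X S (\<phi> + \<psi>)"
  by (cases p) (simp_all add: singular_coboundary_at_0 singular_coboundary_Suc,
      metis coboundary_add singular_cochain_add)

lemma singular_coboundary_cocycle:
  "singular_coboundary p X S \<phi> \<Longrightarrow> singular_cocycle p X S \<phi>"
  by (cases p) (auto simp: singular_coboundary_at_0 singular_coboundary_Suc singular_cocycle_iff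
      singular_cochain_coboundary)

text \<open>Modulo 2 the sum is the difference. Neither cochain has to be a cocycle, so this is an
  equivalence relation on all cochains.\<close>

definition cohomologous :: "nat \<Rightarrow> 'a topology \<Rightarrow> 'a set \<Rightarrow> 'a cochain \<Rightarrow> 'a cochain \<Rightarrow> bool" where
  "cohomologous p X S \<phi> \<psi> \<longleftrightarrow> singular_coboundary p X S (\<phi> + \<psi>)"

lemma cohomologous_refl [simp]: "cohomologous p X S \<phi> \<phi>"
  by (simp add: cohomologous_def)

lemma cohomologous_sym: "cohomologous p X S \<phi> \<psi> \<Longrightarrow> cohomologous p X S \<psi> \<phi>"
  by (simp add: cohomologous_def add.commute)

lemma cohomologous_trans:
  assumes "cohomologous p X S \<phi> \<psi>" "cohomologous p X S \<psi> \<xi>"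
  shows "cohomologous p X S \<phi> \<xi>"
proof -
  have "\<phi> + \<xi> = (\<phi> + \<psi>) + (\<psi> + \<xi>)"
    by (simp add: add.assoc)
  then show ?thesis
    using singular_coboundary_add[of p X S "\<phi> + \<psi>" "\<psi> + \<xi>"] assms
    by (metis cohomologous_def)
qed

lemma cohomologous_add:
  assumes "cohomologous p X S \<phi> \<phi>'" "cohomologous p X S \<psi> \<psi>'"
  shows "cohomologous p X S (\<phi> + \<psi>) (\<phi>' + \<psi>')"
  using singular_coboundary_add[of p X S "\<phi> + \<phi>'" "\<psi> + \<psi>'"] assms
  by (simp add: cohomologous_def add_ac)

lemma cohomologous_0_iff [simp]: "cohomologous p X S \<phi> 0 \<longleftrightarrow> singular_coboundary p X S \<phi>"
  by (simp add: cohomologous_def)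

lemma cohomologous_coboundary_iff:
  "cohomologous p X S \<phi> \<psi> \<Longrightarrow> singular_coboundary p X S \<phi> \<longleftrightarrow> singular_coboundary p X S \<psi>"
  using cohomologous_sym cohomologous_trans cohomologous_0_iff by metis

lemma cohomologous_cocycle:
  "\<lbrakk>cohomologous p X S \<phi> \<psi>; singular_cocycle p X S \<psi>\<rbrakk> \<Longrightarrow> singular_cocycle p X S \<phi>"
  using singular_cocycle_add[of p X S "\<phi> + \<psi>" \<psi>]
  by (auto simp: cohomologous_def add.assoc dest: singular_coboundary_cocycle)

section \<open>Cochain maps induced by continuous maps\<close>

lemma cochain_map_add: "cochain_map p X g (\<phi> + \<psi>) = cochain_map p X g \<phi> + cochain_map p X g \<psi>"
  by (simp add: cochain_map_def fun_eq_iff)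

lemma cochain_map_0 [simp]: "cochain_map p X g 0 = 0"
  by (simp add: cochain_map_def fun_eq_iff)

lemma singular_face_simplex_map':
  assumes "k \<le> Suc p"
  shows "singular_face (Suc p) k (simplex_map (Suc p) g f) = simplex_map p g (singular_face (Suc p) k f)"
  using assms simplical_face_in_standard_simplex[of "Suc p" k]
  by (auto simp: singular_face_def simplex_map_def fun_eq_iff)

lemma coboundary_cochain_map:
  assumes "continuous_map X X' g"
  shows "coboundary p X (cochain_map p X g \<phi>) = cochain_map (Suc p) X g (coboundary p X' \<phi>)"
  using assms
  by (auto simp: coboundary_def cochain_map_def fun_eq_iff singular_simplex_face
      singular_simplex_simplex_map singular_face_simplex_map' intro!: sum.cong simp del: sum.atMost_Suc)

lemma singular_cochain_cochain_map:
  assumes "continuous_map X X' g" "g \<in> S \<rightarrow> S'" "singular_cochain p X' S' \<phi>"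
  shows "singular_cochain p X S (cochain_map p X g \<phi>)"
proof -
  have "continuous_map (subtopology X S) (subtopology X' S') g"
    using assms(1,2) by (auto simp: continuous_map_in_subtopology continuous_map_from_subtopology)
  then show ?thesis
    using assms(3) by (auto simp: singular_cochain_def cochain_map_def intro: singular_simplex_simplex_map)
qed

lemma singular_cocycle_cochain_map:
  "\<lbrakk>continuous_map X X' g; g \<in> S \<rightarrow> S'; singular_cocycle p X' S' \<phi>\<rbrakk>
    \<Longrightarrow> singular_cocycle p X S (cochain_map p X g \<phi>)"
  by (simp add: singular_cocycle_iff singular_cochain_cochain_map coboundary_cochain_map)

lemma singular_coboundary_cochain_map:
  assumes "continuous_map X X' g" "g \<in> S \<rightarrow> S'" "singular_coboundary p X' S' \<phi>"
  shows "singular_coboundary p X S (cochain_map p X g \<phi>)"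
proof (cases p)
  case (Suc q)
  then show ?thesis
    using assms coboundary_cochain_map[OF assms(1)] singular_cochain_cochain_map[OF assms(1,2)]
    by (metis singular_coboundary_Suc)
qed (use assms in \<open>simp add: singular_coboundary_at_0\<close>)

lemma cohomologous_cochain_map:
  "\<lbrakk>continuous_map X X' g; g \<in> S \<rightarrow> S'; cohomologous p X' S' \<phi> \<psi>\<rbrakk>
    \<Longrightarrow> cohomologous p X S (cochain_map p X g \<phi>) (cochain_map p X g \<psi>)"
  by (metis cochain_map_add cohomologous_def singular_coboundary_cochain_map)

lemma cochain_map_compose:
  assumes "continuous_map X X' g"
  shows "cochain_map p X g (cochain_map p X' h \<phi>) = cochain_map p X (h \<circ> g) \<phi>"
  using assms by (auto simp: cochain_map_def fun_eq_iff singular_simplex_simplex_map simplex_map_compose)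

lemma cochain_map_cong:
  assumes "\<And>x. x \<in> topspace X \<Longrightarrow> g x = h x"
  shows "cochain_map p X g \<phi> = cochain_map p X h \<phi>"
  by (rule ext) (simp add: cochain_map_def simplex_map_eq[of p X _ g h] assms)

lemma cochain_map_id:
  assumes "\<And>x. x \<in> topspace X \<Longrightarrow> g x = x" "singular_cochain p X S \<phi>"
  shows "cochain_map p X g \<phi> = \<phi>"
  using assms(2)
  by (intro ext) (auto simp: cochain_map_def singular_cochain_def simplex_map_id_gen[of p X _ g] assms(1))

section \<open>Homotopy invariance\<close>

text \<open>The codegeneracy of the standard simplices: the affine map that collapses the edge
  between the vertices \<open>i\<close> and \<open>Suc i\<close>.\<close>

definition degeneracy :: "nat \<Rightarrow> (nat \<Rightarrow> real) \<Rightarrow> nat \<Rightarrow> real" where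
  "degeneracy i y = (\<lambda>j. if j < i then y j else if j = i then y i + y (Suc i) else y (Suc j))"

definition prism_height :: "nat \<Rightarrow> nat \<Rightarrow> (nat \<Rightarrow> real) \<Rightarrow> real" where
  "prism_height p i y = (\<Sum>j=i..p. y j)"

text \<open>
  The pair of \<open>prism_height\<close> and \<open>degeneracy i\<close> is the \<open>i\<close>-th simplex of the standard triangulation
  of \<open>[0,1] \<times> \<Delta>\<^sup>p\<close>: the vertices \<open>0, \<dots>, i\<close> lie in the bottom, the others in the top.
\<close>

definition prism_simplex ::
    "nat \<Rightarrow> (real \<times> 'a \<Rightarrow> 'b) \<Rightarrow> nat \<Rightarrow> ((nat \<Rightarrow> real) \<Rightarrow> 'a) \<Rightarrow> (nat \<Rightarrow> real) \<Rightarrow> 'b" where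
  "prism_simplex p h i f =
    restrict (\<lambda>y. h (prism_height (Suc p) (Suc i) y, f (degeneracy i y))) (standard_simplex (Suc p))"

lemma degeneracy_in_standard_simplex:
  assumes "y \<in> standard_simplex (Suc p)" "i \<le> p"
  shows "degeneracy i y \<in> standard_simplex p"
proof -
  have y0: "\<And>j. 0 \<le> y j" and y1: "\<And>j. Suc p < j \<Longrightarrow> y j = 0" and ys: "(\<Sum>j\<le>Suc p. y j) = 1"
    using assms by (auto simp: standard_simplex_def)
  have eq1: "{..p} = {..<i} \<union> ({i} \<union> {Suc i..p})"
    using assms(2) by auto
  have eq2: "{..Suc p} = {..<i} \<union> ({i} \<union> ({Suc i} \<union> {Suc (Suc i)..Suc p}))"
    using assms(2) by auto
  have "(\<Sum>j\<le>p. degeneracy i y j) = (\<Sum>j<i. y j) + (y i + y (Suc i) + (\<Sum>j=Suc i..p. y (Suc j)))"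
    unfolding eq1
    by (subst sum.union_disjoint, simp, simp, force, subst sum.union_disjoint)
       (auto simp: degeneracy_def)
  also have "(\<Sum>j=Suc i..p. y (Suc j)) = (\<Sum>j=Suc (Suc i)..Suc p. y j)"
    by (simp only: sum.shift_bounds_cl_Suc_ivl)
  also have "(\<Sum>j<i. y j) + (y i + y (Suc i) + (\<Sum>j=Suc (Suc i)..Suc p. y j)) = (\<Sum>j\<le>Suc p. y j)"
    unfolding eq2
    by (subst sum.union_disjoint, simp, simp, force, subst sum.union_disjoint, simp, simp, force,
        subst sum.union_disjoint) auto
  finally have s: "(\<Sum>j\<le>p. degeneracy i y j) = 1"
    using ys by simp
  have d0: "0 \<le> degeneracy i y j" for j
    using y0 by (simp add: degeneracy_def)
  have dz: "degeneracy i y j = 0" if "p < j" for j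
    using y1 that assms(2) by (simp add: degeneracy_def)
  have "degeneracy i y j \<le> 1" for j
  proof (cases "j \<le> p")
    case True
    then show ?thesis
      using member_le_sum[of j "{..p}" "degeneracy i y"] d0 s by simp
  qed (simp add: dz)
  then show ?thesis
    using s d0 dz by (simp add: standard_simplex_def)
qed

lemma prism_height_in_01:
  assumes "y \<in> standard_simplex p"
  shows "prism_height p i y \<in> {0..1}"
proof -
  have "prism_height p i y \<le> (\<Sum>j\<le>p. y j)"
    unfolding prism_height_def by (rule sum_mono2) (use assms in \<open>auto simp: standard_simplex_def\<close>)
  then show ?thesis
    using assms by (auto simp: standard_simplex_def prism_height_def intro: sum_nonneg)
qed

lemma continuous_map_simplex_coordinates:
  "continuous_map (subtopology (powertop_real UNIV) S) euclideanreal (\<lambda>y. y i)"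
  by (intro continuous_map_from_subtopology continuous_map_product_projection) simp

lemma singular_simplex_prism:
  assumes h: "continuous_map (prod_topology (top_of_set {0..1::real}) X) X' h"
    and f: "singular_simplex p X f" and i: "i \<le> p"
  shows "singular_simplex (Suc p) X' (prism_simplex p h i f)"
proof -
  let ?D = "\<lambda>p. subtopology (powertop_real UNIV) (standard_simplex p)"
  have "continuous_map (?D (Suc p)) euclideanreal (\<lambda>y. degeneracy i y j)" for j
    unfolding degeneracy_def
    by (cases "j < i"; cases "j = i")
       (auto intro: continuous_map_simplex_coordinates continuous_map_add)
  then have "continuous_map (?D (Suc p)) (?D p) (degeneracy i)"
    using degeneracy_in_standard_simplex[OF _ i]
    by (auto simp: continuous_map_in_subtopology continuous_map_componentwise_UNIV)
  moreover have "continuous_map (?D p) X f"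
    using f by (simp add: singular_simplex_def)
  ultimately have c1: "continuous_map (?D (Suc p)) X (\<lambda>y. f (degeneracy i y))"
    using continuous_map_compose[unfolded o_def] by blast
  have "continuous_map (?D (Suc p)) euclideanreal (\<lambda>y. prism_height (Suc p) (Suc i) y)"
    unfolding prism_height_def by (intro continuous_map_sum continuous_map_simplex_coordinates) auto
  then have c2: "continuous_map (?D (Suc p)) (top_of_set {0..1::real}) (\<lambda>y. prism_height (Suc p) (Suc i) y)"
    using prism_height_in_01[of _ "Suc p" "Suc i"] by (auto simp: continuous_map_in_subtopology)
  have "continuous_map (?D (Suc p)) X' (h \<circ> (\<lambda>y. (prism_height (Suc p) (Suc i) y, f (degeneracy i y))))"
    using c1 c2 h by (intro continuous_map_compose[OF _ h]) (simp add: continuous_map_pairwise o_def)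
  then show ?thesis
    by (simp add: singular_simplex_def prism_simplex_def o_def)
qed

text \<open>The cosimplicial identities. The two middle cases, where the inserted zero is absorbed
  again, are the ones that yield the walls of the prism.\<close>

lemma degeneracy_face:
  "k < i \<Longrightarrow> degeneracy i (simplical_face k y) = simplical_face k (degeneracy (i - 1) y)"
  "degeneracy i (simplical_face i y) = y"
  "degeneracy i (simplical_face (Suc i) y) = y"
  "Suc i < k \<Longrightarrow> degeneracy i (simplical_face k y) = simplical_face (k - 1) (degeneracy i y)"
proof -
  show "degeneracy i (simplical_face k y) = simplical_face k (degeneracy (i - 1) y)" if "k < i"
  proof
    fix j
    show "degeneracy i (simplical_face k y) j = simplical_face k (degeneracy (i - 1) y) j"
      using that by (cases i; cases j) (auto simp: degeneracy_def simplical_face_def)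
  qed
  show "degeneracy i (simplical_face i y) = y" "degeneracy i (simplical_face (Suc i) y) = y"
    by (auto simp: degeneracy_def simplical_face_def)
  show "degeneracy i (simplical_face k y) = simplical_face (k - 1) (degeneracy i y)" if "Suc i < k"
  proof
    fix j
    show "degeneracy i (simplical_face k y) j = simplical_face (k - 1) (degeneracy i y) j"
      using that by (cases k; cases j) (auto simp: degeneracy_def simplical_face_def)
  qed
qed

lemma prism_height_face:
  assumes "i \<le> p"
  shows "k \<le> i \<Longrightarrow> prism_height (Suc p) (Suc i) (simplical_face k y) = prism_height p i y"
    and "i < k \<Longrightarrow> k \<le> Suc p \<Longrightarrow> prism_height (Suc p) (Suc i) (simplical_face k y) = prism_height p (Suc i) y"
proof -
  assume k: "k \<le> i"
  have "(\<Sum>j=Suc i..Suc p. simplical_face k y j) = (\<Sum>j=i..p. simplical_face k y (Suc j))"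
    by (simp only: sum.shift_bounds_cl_Suc_ivl)
  also have "\<dots> = (\<Sum>j=i..p. y j)"
    using k by (intro sum.cong) (auto simp: simplical_face_def)
  finally show "prism_height (Suc p) (Suc i) (simplical_face k y) = prism_height p i y"
    by (simp add: prism_height_def)
next
  assume k: "i < k" "k \<le> Suc p"
  have "{Suc i..Suc p} = {Suc i..<k} \<union> ({k} \<union> {Suc k..Suc p})"
    using k by auto
  then have "(\<Sum>j=Suc i..Suc p. simplical_face k y j) =
      (\<Sum>j=Suc i..<k. simplical_face k y j) + (\<Sum>j=Suc k..Suc p. simplical_face k y j)"
    by (simp only:) (subst sum.union_disjoint, simp, simp, force, subst sum.union_disjoint,
        auto simp: simplical_face_def)
  also have "(\<Sum>j=Suc k..Suc p. simplical_face k y j) = (\<Sum>j=k..p. simplical_face k y (Suc j))"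
    by (simp only: sum.shift_bounds_cl_Suc_ivl)
  also have "\<dots> = (\<Sum>j=k..p. y j)"
    by (intro sum.cong) (auto simp: simplical_face_def)
  also have "(\<Sum>j=Suc i..<k. simplical_face k y j) = (\<Sum>j=Suc i..<k. y j)"
    by (intro sum.cong) (auto simp: simplical_face_def)
  also have "(\<Sum>j=Suc i..<k. y j) + (\<Sum>j=k..p. y j) = (\<Sum>j=Suc i..p. y j)"
    using k by (subst sum.union_disjoint[symmetric]) (auto intro!: sum.cong)
  finally show "prism_height (Suc p) (Suc i) (simplical_face k y) = prism_height p (Suc i) y"
    by (simp add: prism_height_def)
qed

text \<open>
  The walls between consecutive simplices of the prism, including the top (\<open>i = 0\<close>) and the
  bottom (\<open>i = p + 1\<close>); in the boundary all others occur twice.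
\<close>

definition prism_wall ::
    "nat \<Rightarrow> (real \<times> 'a \<Rightarrow> 'b) \<Rightarrow> nat \<Rightarrow> ((nat \<Rightarrow> real) \<Rightarrow> 'a) \<Rightarrow> (nat \<Rightarrow> real) \<Rightarrow> 'b" where
  "prism_wall p h i f = restrict (\<lambda>y. h (prism_height p i y, f y)) (standard_simplex p)"

text \<open>The outer cases belong to the prism over a face of \<open>f\<close>, the two middle ones
  are walls. The subtraction in \<open>p - 1\<close> is harmless: \<open>k < i\<close> and
  \<open>Suc i < k\<close> both force \<open>p > 0\<close>.\<close>

lemma singular_face_prism:
  assumes "i \<le> p" "k \<le> Suc p"
  shows "singular_face (Suc p) k (prism_simplex p h i f) =
    (if k < i then prism_simplex (p - 1) h (i - 1) (singular_face p k f)
     else if k = i then prism_wall p h i f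
     else if k = Suc i then prism_wall p h (Suc i) f
     else prism_simplex (p - 1) h i (singular_face p (k - 1) f))"
proof (rule ext)
  fix y
  show "singular_face (Suc p) k (prism_simplex p h i f) y =
    (if k < i then prism_simplex (p - 1) h (i - 1) (singular_face p k f)
     else if k = i then prism_wall p h i f
     else if k = Suc i then prism_wall p h (Suc i) f
     else prism_simplex (p - 1) h i (singular_face p (k - 1) f)) y"
  proof (cases "y \<in> standard_simplex p")
    case True
    have fy: "simplical_face k y \<in> standard_simplex (Suc p)"
      using True assms simplical_face_in_standard_simplex[of "Suc p" k y] by simp
    consider "k < i" | "k = i" | "k = Suc i" | "Suc i < k" by linarith
    then show ?thesis
    proof cases
      case 1
      then have p: "Suc (p - Suc 0) = p" and "Suc (i - Suc 0) = i"
        using assms by auto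
      moreover have "degeneracy (i - Suc 0) y \<in> standard_simplex (p - Suc 0)"
        using degeneracy_in_standard_simplex[of y "p - Suc 0" "i - Suc 0"] p True 1 assms by simp
      ultimately show ?thesis
        using 1 True fy assms
        by (simp add: singular_face_def prism_simplex_def degeneracy_face prism_height_face)
    next
      case 4
      then have p: "Suc (p - Suc 0) = p"
        using assms by auto
      moreover have "degeneracy i y \<in> standard_simplex (p - Suc 0)"
        using degeneracy_in_standard_simplex[of y "p - Suc 0" i] p True 4 assms by simp
      ultimately show ?thesis
        using 4 True fy assms
        by (simp add: singular_face_def prism_simplex_def degeneracy_face prism_height_face)
    qed (use True fy assms in \<open>simp_all add: singular_face_def prism_simplex_def prism_wall_def
        degeneracy_face prism_height_face\<close>)
  next
    case False
    moreover have "Suc (p - Suc 0) = p" if "k < i \<or> Suc i < k"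
      using that assms by auto
    ultimately show ?thesis
      using assms by (auto simp: singular_face_def prism_simplex_def prism_wall_def)
  qed
qed

text \<open>The bookkeeping of the boundary of a prism. The walls \<open>T\<close> telescope to top
  and bottom, and for each \<open>i\<close> the terms of \<open>R\<close> with
  \<open>k \<le> i\<close> and with \<open>k > i\<close>, coming from two neighbouring simplices,
  fill up a full row.\<close>

lemma sum_prism:
  fixes G R :: "nat \<Rightarrow> nat \<Rightarrow> bit" and T :: "nat \<Rightarrow> bit"
  assumes G: "\<And>i k. \<lbrakk>i \<le> p; k \<le> Suc p\<rbrakk> \<Longrightarrow> G i k =
      (if k < i then R (i - 1) k else if k = i then T i else if k = Suc i then T (Suc i) else R i (k - 1))"
  shows "(\<Sum>i\<le>p. \<Sum>k\<le>Suc p. G i k) = T 0 + T (Suc p) + (\<Sum>i<p. \<Sum>k\<le>p. R i k)"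
proof -
  have "(\<Sum>k\<le>Suc p. G i k) = (\<Sum>k<i. R (i - 1) k) + (T i + T (Suc i)) + (\<Sum>k=Suc i..p. R i k)"
    if i: "i \<le> p" for i
  proof -
    have "{..Suc p} = {..<i} \<union> ({i} \<union> ({Suc i} \<union> {Suc (Suc i)..Suc p}))"
      using i by auto
    then have "(\<Sum>k\<le>Suc p. G i k) =
        (\<Sum>k<i. G i k) + (G i i + (G i (Suc i) + (\<Sum>k=Suc (Suc i)..Suc p. G i k)))"
      by (simp only:) (subst sum.union_disjoint, simp, simp, force, subst sum.union_disjoint, simp,
          simp, force, subst sum.union_disjoint, auto)
    also have "(\<Sum>k=Suc (Suc i)..Suc p. G i k) = (\<Sum>k=Suc i..p. G i (Suc k))"
      by (simp only: sum.shift_bounds_cl_Suc_ivl)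
    also have "\<dots> = (\<Sum>k=Suc i..p. R i k)"
      using i by (intro sum.cong) (auto simp: G)
    also have "(\<Sum>k<i. G i k) = (\<Sum>k<i. R (i - 1) k)"
      using i by (intro sum.cong) (auto simp: G)
    finally show ?thesis
      using i by (simp add: G add.assoc)
  qed
  then have "(\<Sum>i\<le>p. \<Sum>k\<le>Suc p. G i k) =
      (\<Sum>i\<le>p. (\<Sum>k<i. R (i - 1) k)) + (\<Sum>i\<le>p. T i + T (Suc i)) + (\<Sum>i\<le>p. \<Sum>k=Suc i..p. R i k)"
    by (simp add: sum.distrib del: sum.atMost_Suc)
  also have "(\<Sum>i\<le>p. T i + T (Suc i)) = T 0 + T (Suc p)"
    by (induction p) (simp_all add: add.assoc)
  also have "(\<Sum>i\<le>p. (\<Sum>k<i. R (i - 1) k)) = (\<Sum>i<p. \<Sum>k\<le>i. R i k)"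
    by (simp add: sum.atMost_shift lessThan_Suc_atMost)
  also have "(\<Sum>i\<le>p. \<Sum>k=Suc i..p. R i k) = (\<Sum>i<p. \<Sum>k=Suc i..p. R i k)"
    by (simp flip: lessThan_Suc_atMost)
  finally have "(\<Sum>i\<le>p. \<Sum>k\<le>Suc p. G i k) =
      T 0 + T (Suc p) + (\<Sum>i<p. (\<Sum>k\<le>i. R i k) + (\<Sum>k=Suc i..p. R i k))"
    by (simp add: sum.distrib add_ac)
  also have "(\<Sum>i<p. (\<Sum>k\<le>i. R i k) + (\<Sum>k=Suc i..p. R i k)) = (\<Sum>i<p. \<Sum>k\<le>p. R i k)"
  proof (intro sum.cong refl)
    fix i assume "i \<in> {..<p}"
    then have "{..p} = {..i} \<union> {Suc i..p}" by auto
    then show "(\<Sum>k\<le>i. R i k) + (\<Sum>k=Suc i..p. R i k) = (\<Sum>k\<le>p. R i k)"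
      by (simp only:) (subst sum.union_disjoint, auto)
  qed
  finally show ?thesis .
qed

text \<open>The transpose of the prism operator on singular chains.\<close>

definition prism_cochain ::
    "nat \<Rightarrow> 'a topology \<Rightarrow> (real \<times> 'a \<Rightarrow> 'b) \<Rightarrow> 'b cochain \<Rightarrow> 'a cochain" where
  "prism_cochain p X h \<psi> =
    (\<lambda>f. if singular_simplex p X f then \<Sum>i\<le>p. \<psi> (prism_simplex p h i f) else 0)"

text \<open>The height of this wall is the sum of all barycentric coordinates, which is 1; for the
  index \<open>Suc p\<close> the sum is empty and the height is 0.\<close>

lemma prism_wall_0:
  assumes "\<And>x. h (1, x) = g x"
  shows "prism_wall p h 0 f = simplex_map p g f"
  using assms
  by (auto simp: prism_wall_def simplex_map_def prism_height_def standard_simplex_def fun_eq_iff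
      atLeast0AtMost)

lemma prism_wall_Suc:
  assumes "\<And>x. h (0, x) = g x"
  shows "prism_wall p h (Suc p) f = simplex_map p g f"
  using assms by (auto simp: prism_wall_def simplex_map_def prism_height_def fun_eq_iff)

text \<open>The prism operator is a cochain homotopy between the two pull-backs, and its term
  containing the coboundary of \<open>\<psi>\<close> vanishes.\<close>

theorem cohomologous_homotopic:
  assumes hom: "homotopic_with (\<lambda>k. k \<in> S \<rightarrow> S') X X' g0 g1" and \<psi>: "singular_cocycle p X' S' \<psi>"
  shows "cohomologous p X S (cochain_map p X g0 \<psi>) (cochain_map p X g1 \<psi>)"
proof -
  obtain h where h: "continuous_map (prod_topology (top_of_set {0..1::real}) X) X' h"
    and h0: "\<And>x. h (0, x) = g0 x" and h1: "\<And>x. h (1, x) = g1 x"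
    and hS: "\<And>t. t \<in> {0..1} \<Longrightarrow> (\<lambda>x. h (t, x)) \<in> S \<rightarrow> S'"
    using hom by (auto simp: homotopic_with_def)
  have \<psi>c: "singular_cochain p X' S' \<psi>" and \<psi>z: "coboundary p X' \<psi> = 0"
    using \<psi> by (auto simp: singular_cocycle_iff)
  \<comment> \<open>A cocycle vanishes on the boundary of each simplex of the prism. For
    \<open>p = 0\<close> the right-hand sum is empty, which gives the equality on the nose that
    degree 0 demands.\<close>
  have prism0: "\<psi> (simplex_map p g0 f) + \<psi> (simplex_map p g1 f) =
      (\<Sum>i<p. \<Sum>k\<le>p. \<psi> (prism_simplex (p - 1) h i (singular_face p k f)))"
    if f: "singular_simplex p X f" for f
  proof -
    have "(\<Sum>i\<le>p. \<Sum>k\<le>Suc p. \<psi> (singular_face (Suc p) k (prism_simplex p h i f))) =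
        \<psi> (prism_wall p h 0 f) + \<psi> (prism_wall p h (Suc p) f) +
        (\<Sum>i<p. \<Sum>k\<le>p. \<psi> (prism_simplex (p - 1) h i (singular_face p k f)))"
      by (rule sum_prism) (simp add: singular_face_prism)
    moreover have "(\<Sum>k\<le>Suc p. \<psi> (singular_face (Suc p) k (prism_simplex p h i f))) = 0"
      if "i \<le> p" for i
      using fun_cong[OF \<psi>z, of "prism_simplex p h i f"] singular_simplex_prism[OF h f that]
      by (simp add: coboundary_def del: sum.atMost_Suc)
    ultimately have "\<psi> (simplex_map p g1 f) + \<psi> (simplex_map p g0 f) +
        (\<Sum>i<p. \<Sum>k\<le>p. \<psi> (prism_simplex (p - 1) h i (singular_face p k f))) = 0"
      by (simp add: prism_wall_0[where h = h and g = g1] prism_wall_Suc[where h = h and g = g0] h0 h1 del: sum.atMost_Suc)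
    then show ?thesis
      by (metis (no_types, lifting) add.commute add_eq_0_iff uminus_bit_def id_apply)
  qed
  show ?thesis
  proof (cases p)
    case 0
    then show ?thesis
      using prism0 by (simp add: cohomologous_def singular_coboundary_at_0 fun_eq_iff cochain_map_def)
  next
    case (Suc q)
    let ?P = "prism_cochain q X h \<psi>"
    \<comment> \<open>The prism over a simplex of \<open>S\<close> stays in \<open>S'\<close>; this
      makes the prism cochain a relative one.\<close>
    have hSS: "continuous_map (prod_topology (top_of_set {0..1::real}) (subtopology X S)) (subtopology X' S') h"
    proof -
      have "continuous_map (subtopology (prod_topology (top_of_set {0..1::real}) X) ({0..1} \<times> S)) (subtopology X' S') h"
        using hS h by (auto simp: continuous_map_in_subtopology continuous_map_from_subtopology Pi_iff)
      then show ?thesis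
        by (simp add: prod_topology_subtopology(2))
    qed
    have "singular_cochain q X S ?P"
    proof -
      have "\<psi> (prism_simplex q h i f) = 0" if "singular_simplex q (subtopology X S) f" "i \<le> q" for f i
        using singular_simplex_prism[OF hSS that] \<psi>c Suc by (simp add: singular_cochain_def)
      then show ?thesis
        by (auto simp: singular_cochain_def prism_cochain_def intro!: sum.neutral simp del: sum.atMost_Suc)
    qed
    moreover have "cochain_map p X g0 \<psi> + cochain_map p X g1 \<psi> = coboundary q X ?P"
    proof (rule ext)
      fix f
      show "(cochain_map p X g0 \<psi> + cochain_map p X g1 \<psi>) f = coboundary q X ?P f"
      proof (cases "singular_simplex p X f")
        case True
        have "coboundary q X ?P f =
            (\<Sum>k\<le>p. \<Sum>i\<le>q. \<psi> (prism_simplex q h i (singular_face p k f)))"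
          using True Suc
          by (auto simp: coboundary_def prism_cochain_def singular_simplex_face intro!: sum.cong simp del: sum.atMost_Suc)
        also have "\<dots> = (\<Sum>i\<le>q. \<Sum>k\<le>p. \<psi> (prism_simplex q h i (singular_face p k f)))"
          by (rule sum.swap)
        finally show ?thesis
          using prism0[OF True] True Suc
          by (simp add: cochain_map_def lessThan_Suc_atMost del: sum.atMost_Suc)
      qed (use Suc in \<open>simp add: cochain_map_def coboundary_def\<close>)
    qed
    ultimately show ?thesis
      using Suc by (auto simp: cohomologous_def singular_coboundary_Suc)
  qed
qed

section \<open>Cup products of cochains\<close>

definition simplex_shift :: "nat \<Rightarrow> (nat \<Rightarrow> real) \<Rightarrow> nat \<Rightarrow> real" where
  "simplex_shift p x = (\<lambda>i. if i < p then 0 else x (i - p))"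

lemma back_face_eq: "back_face p q f = restrict (f \<circ> simplex_shift p) (standard_simplex q)"
  by (simp add: back_face_def simplex_shift_def o_def)

lemma simplex_shift_in_standard_simplex:
  assumes "x \<in> standard_simplex q"
  shows "simplex_shift p x \<in> standard_simplex (p + q)"
proof -
  have "(\<Sum>i\<le>p+q. simplex_shift p x i) = (\<Sum>i=0+p..q+p. simplex_shift p x i)"
    by (rule sum.mono_neutral_right) (auto simp: simplex_shift_def)
  also have "\<dots> = (\<Sum>i\<le>q. x i)"
    by (simp only: sum.shift_bounds_cl_nat_ivl) (simp add: simplex_shift_def atLeast0AtMost)
  finally show ?thesis
    using assms by (auto simp: standard_simplex_def simplex_shift_def)
qed

lemma standard_simplex_add: "x \<in> standard_simplex p \<Longrightarrow> x \<in> standard_simplex (p + q)"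
  using standard_simplex_mono[of p "p + q"] by auto

lemma singular_simplex_front_face:
  assumes "singular_simplex (p + q) X f"
  shows "singular_simplex p X (front_face p f)"
  using assms standard_simplex_mono[of p "p + q"]
  by (auto simp: singular_simplex_def front_face_def intro: continuous_map_from_subtopology_mono)

lemma singular_simplex_back_face:
  assumes "singular_simplex (p + q) X f"
  shows "singular_simplex q X (back_face p q f)"
proof -
  let ?D = "\<lambda>p. subtopology (powertop_real UNIV) (standard_simplex p)"
  have "continuous_map (?D q) euclideanreal (\<lambda>y. simplex_shift p y j)" for j
    unfolding simplex_shift_def by (cases "j < p") (auto intro: continuous_map_simplex_coordinates)
  then have "continuous_map (?D q) (?D (p + q)) (simplex_shift p)"
    using simplex_shift_in_standard_simplex
    by (auto simp: continuous_map_in_subtopology continuous_map_componentwise_UNIV)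
  moreover have "continuous_map (?D (p + q)) X f"
    using assms by (simp add: singular_simplex_def)
  ultimately have "continuous_map (?D q) X (f \<circ> simplex_shift p)"
    by (rule continuous_map_compose)
  then show ?thesis
    by (simp add: singular_simplex_def back_face_eq)
qed

lemma front_face_singular_face:
  assumes "k \<le> Suc p"
  shows "front_face p (singular_face (Suc (p + q)) k f) = singular_face (Suc p) k (front_face (Suc p) f)"
  using assms simplical_face_in_standard_simplex[of "Suc p" k]
  by (intro ext) (auto simp: front_face_def singular_face_def standard_simplex_add)

lemma simplical_face_beyond:
  assumes "x \<in> standard_simplex p" "p < k"
  shows "simplical_face k x = x"
  using assms by (intro ext) (auto simp: simplical_face_def standard_simplex_def)

lemma front_face_singular_face_beyond:
  assumes "p < k"
  shows "front_face p (singular_face (Suc (p + q)) k f) = front_face p f"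
  using assms
  by (intro ext) (auto simp: front_face_def singular_face_def standard_simplex_add simplical_face_beyond)

text \<open>This face of the front part, like face 0 of the back part, is not a face of the whole
  simplex; the two produce the surplus terms of the Leibniz rule.\<close>

lemma singular_face_front_face_last: "singular_face (Suc p) (Suc p) (front_face (Suc p) f) = front_face p f"
  using standard_simplex_mono[of p "Suc p"]
  by (intro ext) (auto simp: front_face_def singular_face_def simplical_face_beyond)

lemma back_face_singular_face_before:
  assumes "k \<le> p"
  shows "back_face p q (singular_face (Suc (p + q)) k f) = back_face (Suc p) q f"
proof
  fix x
  have "simplical_face k (simplex_shift p x) = simplex_shift (Suc p) x"
    using assms by (auto simp: simplical_face_def simplex_shift_def fun_eq_iff)
  then show "back_face p q (singular_face (Suc (p + q)) k f) x = back_face (Suc p) q f x"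
    by (simp add: back_face_eq singular_face_def simplex_shift_in_standard_simplex)
qed

lemma back_face_singular_face:
  assumes "l \<le> Suc q"
  shows "back_face p q (singular_face (Suc (p + q)) (p + l) f) = singular_face (Suc q) l (back_face p (Suc q) f)"
proof
  fix x :: "nat \<Rightarrow> real"
  have "simplical_face (p + l) (simplex_shift p x) = simplex_shift p (simplical_face l x)"
    by (auto simp: simplical_face_def simplex_shift_def fun_eq_iff)
  then show "back_face p q (singular_face (Suc (p + q)) (p + l) f) x =
      singular_face (Suc q) l (back_face p (Suc q) f) x"
    using assms simplical_face_in_standard_simplex[of "Suc q" l x]
    by (simp add: back_face_eq singular_face_def simplex_shift_in_standard_simplex)
qed

lemma cup_cochain_add_left:
  "cup_cochain p q X (\<phi> + \<phi>') \<psi> = cup_cochain p q X \<phi> \<psi> + cup_cochain p q X \<phi>' \<psi>"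
  by (simp add: cup_cochain_def fun_eq_iff distrib_right)

lemma cup_cochain_add_right:
  "cup_cochain p q X \<phi> (\<psi> + \<psi>') = cup_cochain p q X \<phi> \<psi> + cup_cochain p q X \<phi> \<psi>'"
  by (simp add: cup_cochain_def fun_eq_iff distrib_left)

lemma cup_cochain_0_left [simp]: "cup_cochain p q X 0 \<psi> = 0"
  by (simp add: cup_cochain_def fun_eq_iff)

lemma cup_cochain_0_right [simp]: "cup_cochain p q X \<phi> 0 = 0"
  by (simp add: cup_cochain_def fun_eq_iff)

lemma cup_cochain_sum_left:
  "cup_cochain p q X (\<Sum>i\<in>I. \<phi> i) \<psi> = (\<Sum>i\<in>I. cup_cochain p q X (\<phi> i) \<psi>)"
  using sum_comp_morphism[of "\<lambda>\<phi>. cup_cochain p q X \<phi> \<psi>" \<phi> I]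
  by (simp only: o_def cup_cochain_add_left cup_cochain_0_left)

theorem coboundary_cup_cochain:
  "coboundary (p + q) X (cup_cochain p q X \<phi> \<psi>) =
    cup_cochain (Suc p) q X (coboundary p X \<phi>) \<psi> + cup_cochain p (Suc q) X \<phi> (coboundary q X \<psi>)"
proof
  fix f
  let ?n = "Suc (p + q)"
  show "coboundary (p + q) X (cup_cochain p q X \<phi> \<psi>) f =
    (cup_cochain (Suc p) q X (coboundary p X \<phi>) \<psi> + cup_cochain p (Suc q) X \<phi> (coboundary q X \<psi>)) f"
  proof (cases "singular_simplex ?n X f")
    case True
    define a where "a = (\<Sum>k\<le>p. \<phi> (singular_face (Suc p) k (front_face (Suc p) f)))"
    define b where "b = (\<Sum>l=1..Suc q. \<psi> (singular_face (Suc q) l (back_face p (Suc q) f)))"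
    define c where "c = \<phi> (front_face p f)"
    define d where "d = \<psi> (back_face (Suc p) q f)"
    have s1: "singular_simplex (Suc p) X (front_face (Suc p) f)"
      using True singular_simplex_front_face[of "Suc p" q] by simp
    have s2: "singular_simplex (Suc q) X (back_face p (Suc q) f)"
      using True singular_simplex_back_face[of p "Suc q"] by simp
    let ?g = "\<lambda>k. \<phi> (front_face p (singular_face ?n k f)) * \<psi> (back_face p q (singular_face ?n k f))"
    have "coboundary (p + q) X (cup_cochain p q X \<phi> \<psi>) f = (\<Sum>k\<le>?n. ?g k)"
      using True
      by (auto simp: coboundary_def cup_cochain_def singular_simplex_face intro!: sum.cong simp del: sum.atMost_Suc)
    also have "{..?n} = {..p} \<union> {1 + p..Suc q + p}" by auto
    also have "(\<Sum>k\<in>\<dots>. ?g k) = (\<Sum>k\<le>p. ?g k) + (\<Sum>k=1 + p..Suc q + p. ?g k)"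
      by (rule sum.union_disjoint) auto
    also have "(\<Sum>k=1 + p..Suc q + p. ?g k) = (\<Sum>l=1..Suc q. ?g (l + p))"
      by (rule sum.shift_bounds_cl_nat_ivl)
    also have "\<dots> = c * b"
      unfolding b_def c_def sum_distrib_left
    proof (rule sum.cong[OF refl])
      fix l assume "l \<in> {1..Suc q}"
      then show "?g (l + p) = \<phi> (front_face p f) * \<psi> (singular_face (Suc q) l (back_face p (Suc q) f))"
        using back_face_singular_face[of l q p f] front_face_singular_face_beyond[of p "p + l" q f]
        by (simp add: add.commute[of l p])
    qed
    also have "(\<Sum>k\<le>p. ?g k) = a * d"
      by (simp add: a_def d_def sum_distrib_right front_face_singular_face back_face_singular_face_before)
    finally have "coboundary (p + q) X (cup_cochain p q X \<phi> \<psi>) f = a * d + c * b" .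
    moreover have "coboundary p X \<phi> (front_face (Suc p) f) = a + c"
      using s1 by (simp add: coboundary_def a_def c_def singular_face_front_face_last)
    moreover have "coboundary q X \<psi> (back_face p (Suc q) f) = d + b"
    proof -
      have "coboundary q X \<psi> (back_face p (Suc q) f) =
          (\<Sum>l\<le>Suc q. \<psi> (singular_face (Suc q) l (back_face p (Suc q) f)))"
        using s2 by (simp add: coboundary_def del: sum.atMost_Suc)
      also have "\<dots> = \<psi> (singular_face (Suc q) 0 (back_face p (Suc q) f)) + b"
        unfolding b_def by (simp add: sum.atMost_Suc_shift sum.atLeast_Suc_atMost_Suc_shift atLeast0AtMost
            del: sum.atMost_Suc sum.cl_ivl_Suc)
      also have "singular_face (Suc q) 0 (back_face p (Suc q) f) = back_face (Suc p) q f"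
        using back_face_singular_face[of 0 q p f] back_face_singular_face_before[of p p q f] by simp
      finally show ?thesis by (simp add: d_def)
    qed
    \<comment> \<open>The product \<open>c * d\<close> occurs in both summands of the right-hand
      side and cancels modulo 2.\<close>
    ultimately show ?thesis
      using True by (simp add: cup_cochain_def c_def[symmetric] d_def[symmetric] algebra_simps)
  qed (simp add: cup_cochain_def coboundary_def)
qed

lemma cup_cochain_assoc:
  fixes X :: "'a topology"
  shows
  "cup_cochain (p + q) r X (cup_cochain p q X \<phi> \<psi>) \<xi> =
    cup_cochain p (q + r) X \<phi> (cup_cochain q r X \<psi> \<xi>)"
proof
  fix f :: "(nat \<Rightarrow> real) \<Rightarrow> 'a"
  have 1: "front_face p (front_face (p + q) f) = front_face p f"
    by (intro ext) (simp add: front_face_def standard_simplex_add)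
  have 2: "back_face p q (front_face (p + q) f) = front_face q (back_face p (q + r) f)"
    by (intro ext) (simp add: front_face_def back_face_eq simplex_shift_in_standard_simplex standard_simplex_add)
  have s: "simplex_shift p (simplex_shift q x) = simplex_shift (p + q) x" for x
    by (auto simp: simplex_shift_def fun_eq_iff)
  have 3: "back_face (p + q) r f = back_face q r (back_face p (q + r) f)"
    by (intro ext) (simp add: back_face_eq s simplex_shift_in_standard_simplex)
  show "cup_cochain (p + q) r X (cup_cochain p q X \<phi> \<psi>) \<xi> f =
      cup_cochain p (q + r) X \<phi> (cup_cochain q r X \<psi> \<xi>) f"
    using singular_simplex_front_face[of "p + q" r X f] singular_simplex_back_face[of p "q + r" X f]
    by (simp add: cup_cochain_def 1 2 3 add.assoc mult.assoc)
qed

definition unit_cochain :: "'a topology \<Rightarrow> 'a cochain" where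
  "unit_cochain X = (\<lambda>f. if singular_simplex 0 X f then 1 else 0)"

lemma cup_cochain_unit_right:
  assumes "singular_cochain p X S \<phi>"
  shows "cup_cochain p 0 X \<phi> (unit_cochain X) = \<phi>"
proof
  fix f
  show "cup_cochain p 0 X \<phi> (unit_cochain X) f = \<phi> f"
  proof (cases "singular_simplex p X f")
    case True
    then have "front_face p f = f"
      by (simp add: front_face_def singular_simplex_def extensional_restrict)
    then show ?thesis
      using True singular_simplex_back_face[of p 0 X f] by (simp add: cup_cochain_def unit_cochain_def)
  qed (use assms in \<open>simp add: cup_cochain_def singular_cochain_def\<close>)
qed

lemma cup_cochain_unit_left:
  assumes "singular_cochain q X S \<psi>"
  shows "cup_cochain 0 q X (unit_cochain X) \<psi> = \<psi>"
proof
  fix f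
  show "cup_cochain 0 q X (unit_cochain X) \<psi> f = \<psi> f"
  proof (cases "singular_simplex q X f")
    case True
    then have "back_face 0 q f = f"
      by (simp add: back_face_def singular_simplex_def extensional_restrict)
    then show ?thesis
      using True singular_simplex_front_face[of 0 q X f] by (simp add: cup_cochain_def unit_cochain_def)
  qed (use assms in \<open>simp add: cup_cochain_def singular_cochain_def\<close>)
qed

lemma singular_cocycle_unit: "singular_cocycle 0 X {} (unit_cochain X)"
  by (auto simp: singular_cocycle_iff singular_cochain_def unit_cochain_def coboundary_def fun_eq_iff
      singular_simplex_empty singular_simplex_face)

lemma cochain_map_unit:
  "continuous_map X X' g \<Longrightarrow> cochain_map 0 X g (unit_cochain X') = unit_cochain X"
  by (auto simp: cochain_map_def unit_cochain_def fun_eq_iff singular_simplex_simplex_map)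

lemma cochain_map_cup_cochain:
  assumes "continuous_map X X' g"
  shows "cochain_map (p + q) X g (cup_cochain p q X' \<phi> \<psi>) =
    cup_cochain p q X (cochain_map p X g \<phi>) (cochain_map q X g \<psi>)"
proof
  fix f
  have "front_face p (simplex_map (p + q) g f) = simplex_map p g (front_face p f)"
    by (intro ext) (simp add: front_face_def simplex_map_def standard_simplex_add)
  moreover have "back_face p q (simplex_map (p + q) g f) = simplex_map q g (back_face p q f)"
    by (intro ext) (simp add: back_face_eq simplex_map_def simplex_shift_in_standard_simplex)
  ultimately show "cochain_map (p + q) X g (cup_cochain p q X' \<phi> \<psi>) f =
      cup_cochain p q X (cochain_map p X g \<phi>) (cochain_map q X g \<psi>) f"
    using assms singular_simplex_front_face[of p q X f] singular_simplex_back_face[of p q X f]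
    by (simp add: cochain_map_def cup_cochain_def singular_simplex_simplex_map)
qed

lemma singular_cochain_cup:
  assumes "singular_cochain p X S \<phi>"
  shows "singular_cochain (p + q) X S (cup_cochain p q X \<phi> \<psi>)"
  using assms singular_simplex_front_face[of p q "subtopology X S"]
  by (auto simp: singular_cochain_def cup_cochain_def)

lemma singular_cocycle_cup:
  assumes "singular_cocycle p X S \<phi>" "singular_cocycle q X T \<psi>"
  shows "singular_cocycle (p + q) X S (cup_cochain p q X \<phi> \<psi>)"
  using assms by (simp add: singular_cocycle_iff singular_cochain_cup coboundary_cup_cochain)

lemma singular_coboundary_cup_left:
  assumes "singular_coboundary p X S \<phi>" "singular_cocycle q X T \<psi>"
  shows "singular_coboundary (p + q) X S (cup_cochain p q X \<phi> \<psi>)"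
proof (cases p)
  case (Suc r)
  then obtain \<alpha> where \<alpha>: "singular_cochain r X S \<alpha>" "\<phi> = coboundary r X \<alpha>"
    using assms(1) by (auto simp: singular_coboundary_Suc)
  then have "cup_cochain p q X \<phi> \<psi> = coboundary (r + q) X (cup_cochain r q X \<alpha> \<psi>)"
    using assms(2) Suc by (simp add: coboundary_cup_cochain singular_cocycle_iff)
  moreover have "singular_cochain (r + q) X S (cup_cochain r q X \<alpha> \<psi>)"
    using \<alpha>(1) by (rule singular_cochain_cup)
  ultimately show ?thesis
    using Suc unfolding Suc add_Suc singular_coboundary_Suc by blast
qed (use assms(1) in \<open>simp add: singular_coboundary_at_0\<close>)

lemma singular_coboundary_cup_right:
  assumes "singular_cocycle p X S \<phi>" "singular_coboundary q X T \<psi>"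
  shows "singular_coboundary (p + q) X S (cup_cochain p q X \<phi> \<psi>)"
proof (cases q)
  case (Suc r)
  then obtain \<beta> where \<beta>: "singular_cochain r X T \<beta>" "\<psi> = coboundary r X \<beta>"
    using assms(2) by (auto simp: singular_coboundary_Suc)
  then have "cup_cochain p q X \<phi> \<psi> = coboundary (p + r) X (cup_cochain p r X \<phi> \<beta>)"
    using assms(1) Suc by (simp add: coboundary_cup_cochain singular_cocycle_iff)
  moreover have "singular_cochain (p + r) X S (cup_cochain p r X \<phi> \<beta>)"
    using assms(1) by (simp add: singular_cocycle_iff singular_cochain_cup)
  ultimately show ?thesis
    using Suc unfolding Suc add_Suc_right singular_coboundary_Suc by blast
qed (use assms(2) in \<open>simp add: singular_coboundary_at_0\<close>)

text \<open>The left factor is replaced first, against \<open>\<psi>\<close>, and then the right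
  one, against \<open>\<phi>'\<close>; hence the cocycle hypotheses on just these two.\<close>

lemma cohomologous_cup:
  assumes "cohomologous p X S \<phi> \<phi>'" "cohomologous q X T \<psi> \<psi>'"
    and "singular_cocycle p X S \<phi>'" "singular_cocycle q X T \<psi>"
  shows "cohomologous (p + q) X S (cup_cochain p q X \<phi> \<psi>) (cup_cochain p q X \<phi>' \<psi>')"
  using singular_coboundary_cup_left[of p X S "\<phi> + \<phi>'" q T \<psi>]
    singular_coboundary_cup_right[of p X S \<phi>' q T "\<psi> + \<psi>'"] assms cohomologous_trans
  by (metis cohomologous_def cup_cochain_add_left cup_cochain_add_right)

section \<open>Lifting through a double covering\<close>

text \<open>Without separation axioms the neighbourhoods say more than the absence of fixed points;
  they make \<open>orbit g\<close> a covering map.\<close>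

locale double_cover =
  fixes W :: "'w topology" and g :: "'w \<Rightarrow> 'w"
  assumes inv: "involution W g"
    and free: "\<And>w. w \<in> topspace W \<Longrightarrow> \<exists>U. openin W U \<and> w \<in> U \<and> U \<inter> g ` U = {}"
begin

abbreviation Z :: "'w set topology" where "Z \<equiv> orbit_space W g"

lemma cont_g: "continuous_map W W g"
  using inv by (simp add: involution_def)

lemma g_in: "w \<in> topspace W \<Longrightarrow> g w \<in> topspace W"
  using cont_g by (auto simp: continuous_map_def)

lemma gg: "w \<in> topspace W \<Longrightarrow> g (g w) = w"
  using inv by (simp add: involution_def)

lemma g_neq: "w \<in> topspace W \<Longrightarrow> g w \<noteq> w"
  using free[of w] by (metis IntI empty_iff imageI)

lemma orbit_g: "w \<in> topspace W \<Longrightarrow> orbit g (g w) = orbit g w"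
  by (auto simp: orbit_def gg)

lemma orbit_eqD: "orbit g w = orbit g w' \<Longrightarrow> w = w' \<or> w = g w'"
  by (auto simp: orbit_def)

lemma cont_q: "continuous_map W Z (orbit g)"
  by (rule quotient_imp_continuous_map[OF quotient_map_orbit_space])

lemma open_q:
  assumes "openin W U"
  shows "openin Z (orbit g ` U)"
proof -
  have U: "U \<subseteq> topspace W"
    using assms openin_subset by blast
  have "{z \<in> topspace W. orbit g z \<in> orbit g ` U} = U \<union> {z \<in> topspace W. g z \<in> U}"
  proof (intro equalityI subsetI)
    fix z assume "z \<in> {z \<in> topspace W. orbit g z \<in> orbit g ` U}"
    then obtain u where u: "z \<in> topspace W" "u \<in> U" "orbit g z = orbit g u" by blast
    then show "z \<in> U \<union> {z \<in> topspace W. g z \<in> U}"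
      using orbit_eqD[OF u(3)] gg[of u] U by auto
  next
    fix z assume "z \<in> U \<union> {z \<in> topspace W. g z \<in> U}"
    then show "z \<in> {z \<in> topspace W. orbit g z \<in> orbit g ` U}"
      using U orbit_g[of z] by (auto simp: image_iff intro: bexI[of _ "g z"])
  qed
  moreover have "openin W (U \<union> {z \<in> topspace W. g z \<in> U})"
    using assms openin_continuous_map_preimage[OF cont_g assms] by blast
  ultimately show ?thesis
    using U by (auto simp: openin_orbit_space)
qed

definition is_lift :: "'y topology \<Rightarrow> ('y \<Rightarrow> 'w set) \<Rightarrow> ('y \<Rightarrow> 'w) \<Rightarrow> bool" where
  "is_lift Q h k \<longleftrightarrow> continuous_map Q W k \<and> (\<forall>x\<in>topspace Q. orbit g (k x) = h x)"

lemma is_lift_in: "\<lbrakk>is_lift Q h k; x \<in> topspace Q\<rbrakk> \<Longrightarrow> k x \<in> topspace W"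
  by (auto simp: is_lift_def continuous_map_def)

lemma is_lift_g: "is_lift Q h k \<Longrightarrow> is_lift Q h (g \<circ> k)"
  using is_lift_in[of Q h k] continuous_map_compose[OF _ cont_g, of Q k] by (simp add: is_lift_def orbit_g)

lemma is_lift_subtopology: "is_lift Q h k \<Longrightarrow> is_lift (subtopology Q N) h k"
  by (auto simp: is_lift_def continuous_map_from_subtopology)

lemma is_lift_compose:
  assumes "is_lift Q h k" "continuous_map P Q f"
  shows "is_lift P (\<lambda>x. h (f x)) (\<lambda>x. k (f x))"
proof -
  have "f x \<in> topspace Q" if "x \<in> topspace P" for x
    using assms(2) that by (auto simp: continuous_map_def)
  then show ?thesis
    using assms(1) continuous_map_compose[OF assms(2), of W k] by (simp add: is_lift_def o_def)
qed

text \<open>On an open \<open>U\<close> disjoint from its translate, \<open>orbit g\<close> is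
  injective as well as open, so its inverse on the image is continuous.\<close>

lemma local_lift:
  assumes h: "continuous_map Q Z h" and x0: "x0 \<in> topspace Q"
  obtains N k where "openin Q N" "x0 \<in> N" "is_lift (subtopology Q N) h k"
proof -
  have "h x0 \<in> topspace Z"
    using h x0 by (auto simp: continuous_map_def)
  then obtain w where w: "w \<in> topspace W" "h x0 = orbit g w"
    by (auto simp: topspace_orbit_space)
  obtain U where U: "openin W U" "w \<in> U" "U \<inter> g ` U = {}"
    using free[OF w(1)] by blast
  have UW: "U \<subseteq> topspace W"
    using U(1) openin_subset by blast
  define N where "N = {x \<in> topspace Q. h x \<in> orbit g ` U}"
  define k where "k x = (SOME u. u \<in> U \<and> orbit g u = h x)" for x
  have k: "k x \<in> U \<and> orbit g (k x) = h x" if "x \<in> N" for x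
  proof -
    have "\<exists>u. u \<in> U \<and> orbit g u = h x"
      using that unfolding N_def by fastforce
    then show ?thesis
      unfolding k_def by (rule someI_ex)
  qed
  have uniq: "k x = u" if "x \<in> N" "u \<in> U" "orbit g u = h x" for x u
  proof -
    have "k x = u \<or> k x = g u"
      using k[OF that(1)] that(3) by (intro orbit_eqD) simp
    then show ?thesis
      using U(3) k[OF that(1)] that(2) by (metis IntI empty_iff imageI)
  qed
  have oN: "openin Q N"
    unfolding N_def by (rule openin_continuous_map_preimage[OF h open_q[OF U(1)]])
  have "continuous_map (subtopology Q N) W k"
    unfolding continuous_map
  proof (intro conjI allI impI)
    show "k ` topspace (subtopology Q N) \<subseteq> topspace W"
      using k UW by auto
    fix V assume V: "openin W V"
    have "{x \<in> topspace (subtopology Q N). k x \<in> V} = {x \<in> topspace Q. h x \<in> orbit g ` (U \<inter> V)} \<inter> N"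
    proof (intro equalityI subsetI)
      fix x assume "x \<in> {x \<in> topspace (subtopology Q N). k x \<in> V}"
      then show "x \<in> {x \<in> topspace Q. h x \<in> orbit g ` (U \<inter> V)} \<inter> N"
        using k[of x] by (auto simp: image_iff intro!: bexI[of _ "k x"])
    next
      fix x assume "x \<in> {x \<in> topspace Q. h x \<in> orbit g ` (U \<inter> V)} \<inter> N"
      then show "x \<in> {x \<in> topspace (subtopology Q N). k x \<in> V}"
        using uniq[of x] by auto
    qed
    moreover have "openin Q {x \<in> topspace Q. h x \<in> orbit g ` (U \<inter> V)}"
      by (rule openin_continuous_map_preimage[OF h open_q[OF openin_Int[OF U(1) V]]])
    ultimately show "openin (subtopology Q N) {x \<in> topspace (subtopology Q N). k x \<in> V}"
      by (simp only: openin_subtopology_Int)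
  qed
  then have "is_lift (subtopology Q N) h k"
    using k by (auto simp: is_lift_def)
  moreover have "x0 \<in> N"
    using x0 w U(2) by (auto simp: N_def)
  ultimately show thesis
    using oN that by blast
qed

lemma is_lift_cases:
  assumes "is_lift Q h k1" "is_lift Q h k2" "x \<in> topspace Q"
  shows "k1 x = k2 x \<or> k1 x = g (k2 x)"
  using assms by (intro orbit_eqD) (simp add: is_lift_def)

text \<open>Two lifts with values in the same \<open>U\<close> cannot differ by \<open>g\<close>,
  since \<open>U\<close> misses its translate.\<close>

lemma openin_is_lift_agree:
  assumes k1: "is_lift Q h k1" and k2: "is_lift Q h k2"
  shows "openin Q {x \<in> topspace Q. k1 x = k2 x}"
proof (subst openin_subopen, intro ballI)
  fix x assume x: "x \<in> {x \<in> topspace Q. k1 x = k2 x}"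
  then have "k1 x \<in> topspace W"
    using is_lift_in[OF k1] by blast
  from free[OF this] obtain U where U: "openin W U" "k1 x \<in> U" "U \<inter> g ` U = {}"
    by blast
  let ?T = "{y \<in> topspace Q. k1 y \<in> U} \<inter> {y \<in> topspace Q. k2 y \<in> U}"
  have "openin Q ?T"
    using k1 k2 U(1) by (auto simp: is_lift_def intro!: openin_Int openin_continuous_map_preimage)
  moreover have "?T \<subseteq> {x \<in> topspace Q. k1 x = k2 x}"
    using is_lift_cases[OF k1 k2] U(3) by auto
  moreover have "x \<in> ?T"
    using x U(2) by auto
  ultimately show "\<exists>T. openin Q T \<and> x \<in> T \<and> T \<subseteq> {x \<in> topspace Q. k1 x = k2 x}"
    by blast
qed

text \<open>Where \<open>k1\<close> differs from \<open>k2\<close> it agrees with the lift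
  \<open>g \<circ> k2\<close>. So both the set of agreement and its complement are open.\<close>

lemma is_lift_unique:
  assumes k1: "is_lift Q h k1" and k2: "is_lift Q h k2" and Q: "connected_space Q"
    and "x0 \<in> topspace Q" "k1 x0 = k2 x0" and x: "x \<in> topspace Q"
  shows "k1 x = k2 x"
proof (rule ccontr)
  assume ne: "k1 x \<noteq> k2 x"
  let ?A = "{x \<in> topspace Q. k1 x = k2 x}" and ?B = "{x \<in> topspace Q. k1 x = (g \<circ> k2) x}"
  have "openin Q ?A" "openin Q ?B"
    by (rule openin_is_lift_agree[OF k1 k2], rule openin_is_lift_agree[OF k1 is_lift_g[OF k2]])
  moreover have "topspace Q \<subseteq> ?A \<union> ?B"
    using is_lift_cases[OF k1 k2] by auto
  moreover have "?A \<inter> ?B = {}"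
    using g_neq is_lift_in[OF k2] by fastforce
  moreover have "?A \<noteq> {}" "?B \<noteq> {}"
    using assms ne is_lift_cases[OF k1 k2 x] by auto
  ultimately show False
    using Q unfolding connected_space_def by blast
qed

lemma is_lift_unique':
  assumes "is_lift Q h k1" "is_lift Q h k2" "connected_space Q"
  shows "(\<forall>x\<in>topspace Q. k1 x = k2 x) \<or> (\<forall>x\<in>topspace Q. k1 x = g (k2 x))"
proof (cases "topspace Q = {}")
  case False
  then obtain x0 where "x0 \<in> topspace Q" by blast
  then show ?thesis
    using is_lift_cases[OF assms(1,2)] is_lift_unique[OF assms]
      is_lift_unique[OF assms(1) is_lift_g[OF assms(2)] assms(3)] by (metis comp_apply)
qed auto

text \<open>One of \<open>k\<close> and \<open>g \<circ> k\<close> has the prescribed value at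
  \<open>f y0\<close>, and agreement is an open condition. This glues lifts over adjacent intervals
  and normalises lifts at time 0.\<close>

lemma adjust_lift:
  assumes "is_lift Q h k" "is_lift P (\<lambda>y. h (f y)) k0" "continuous_map P Q f" "y0 \<in> topspace P"
  obtains k' M where "is_lift Q h k'" "openin P M" "y0 \<in> M" "\<And>y. y \<in> M \<Longrightarrow> k' (f y) = k0 y"
proof -
  have "f y0 \<in> topspace Q"
    using assms(3,4) by (auto simp: continuous_map_def)
  have l: "is_lift P (\<lambda>y. h (f y)) (\<lambda>y. k (f y))" "is_lift P (\<lambda>y. h (f y)) (\<lambda>y. (g \<circ> k) (f y))"
    using is_lift_compose[OF assms(1,3)] is_lift_compose[OF is_lift_g[OF assms(1)] assms(3)] by simp_all
  show thesis
  proof (cases "k0 y0 = k (f y0)")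
    case True
    show thesis
      by (rule that[OF assms(1) openin_is_lift_agree[OF l(1) assms(2)]]) (use True assms(4) in auto)
  next
    case False
    then have "k0 y0 = g (k (f y0))"
      using is_lift_cases[OF assms(2) l(1) assms(4)] by blast
    then show thesis
      by (intro that[OF is_lift_g[OF assms(1)] openin_is_lift_agree[OF l(2) assms(2)]])
        (use assms(4) in auto)
  qed
qed

(* Bisection of the interval; the neighbourhood of y0 shrinks so that the two halves of a lift agree. *)
lemma tube_lift:
  fixes Y :: "'y topology"
  defines "P \<equiv> prod_topology (top_of_set {0..1::real}) Y"
  assumes h: "continuous_map P Z h" and y0: "y0 \<in> topspace Y"
  obtains N k where "openin Y N" "y0 \<in> N" "is_lift (subtopology P ({0..1} \<times> N)) h k"
proof -
  \<comment> \<open>\<open>Bolzano\<close> ranges over all short intervals around a point, also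
    those that leave the unit interval; the guard makes \<open>R\<close> vacuous for them.\<close>
  define R where "R a b \<longleftrightarrow> (0 \<le> a \<and> b \<le> 1 \<longrightarrow>
      (\<exists>N k. openin Y N \<and> y0 \<in> N \<and> is_lift (subtopology P ({a..b} \<times> N)) h k))" for a b :: real
  have "R 0 1"
  proof (rule Bolzano[of 0 1 R])
    fix a b c assume trans: "R a b" "R b c" "a \<le> b" "b \<le> c"
    show "R a c"
      unfolding R_def
    proof
      assume ac: "0 \<le> a \<and> c \<le> 1"
      then obtain N1 k1 N2 k2 where
        1: "openin Y N1" "y0 \<in> N1" "is_lift (subtopology P ({a..b} \<times> N1)) h k1" and
        2: "openin Y N2" "y0 \<in> N2" "is_lift (subtopology P ({b..c} \<times> N2)) h k2"
        using trans by (force simp: R_def)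
      let ?S = "subtopology Y (N1 \<inter> N2)"
      have "continuous_map ?S P (\<lambda>y. (b, y))"
        using trans ac by (auto simp: P_def continuous_map_pairwise o_def)
      then have f1: "continuous_map ?S (subtopology P ({a..b} \<times> N1)) (\<lambda>y. (b, y))"
        and f2: "continuous_map ?S (subtopology P ({b..c} \<times> N2)) (\<lambda>y. (b, y))"
        using trans by (auto simp: continuous_map_in_subtopology)
      have y0S: "y0 \<in> topspace ?S"
        using 1 2 y0 by simp
      obtain k2' M where 3: "is_lift (subtopology P ({b..c} \<times> N2)) h k2'"
        and M: "openin ?S M" "y0 \<in> M" "\<And>y. y \<in> M \<Longrightarrow> k2' (b, y) = k1 (b, y)"
        using adjust_lift[OF 2(3) is_lift_compose[OF 1(3) f1] f2 y0S] by blast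
      have M12: "M \<subseteq> N1 \<inter> N2" and oM: "openin Y M"
        using M(1) by (auto simp: openin_open_subtopology[OF openin_Int[OF 1(1) 2(1)]])
      let ?Q = "subtopology P ({a..c} \<times> M)"
      let ?k = "\<lambda>x. if fst x \<le> b then k1 x else k2' x"
      have "continuous_map ?Q W ?k"
      proof (rule continuous_map_cases_le)
        show "continuous_map ?Q euclideanreal fst"
          using continuous_map_fst[of "top_of_set {0..1::real}" Y] unfolding P_def
          by (metis continuous_map_from_subtopology continuous_map_in_subtopology)
        show "continuous_map (subtopology ?Q {x \<in> topspace ?Q. fst x \<le> b}) W k1"
          using 1(3) M12 unfolding is_lift_def
          by (auto simp: subtopology_subtopology elim!: continuous_map_from_subtopology_mono)
        show "continuous_map (subtopology ?Q {x \<in> topspace ?Q. b \<le> fst x}) W k2'"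
          using 3 M12 unfolding is_lift_def
          by (auto simp: subtopology_subtopology elim!: continuous_map_from_subtopology_mono)
        show "k1 x = k2' x" if "x \<in> topspace ?Q" "fst x = b" for x
          using that M(3) by (cases x) auto
      qed auto
      moreover have "orbit g (?k x) = h x" if "x \<in> topspace ?Q" for x
        using that 1(3) 3 M12 by (auto simp: is_lift_def)
      ultimately show "\<exists>N k. openin Y N \<and> y0 \<in> N \<and> is_lift (subtopology P ({a..c} \<times> N)) h k"
        using oM M(2) unfolding is_lift_def by blast
    qed
  next
    fix t :: real assume local: "0 \<le> t" "t \<le> 1"
    have "(t, y0) \<in> topspace P"
      using local y0 by (simp add: P_def)
    then obtain N k where N: "openin P N" "(t, y0) \<in> N" "is_lift (subtopology P N) h k"
      using local_lift[OF h] by blast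
    have "\<exists>U V. openin (top_of_set {0..1::real}) U \<and> openin Y V \<and> t \<in> U \<and> y0 \<in> V \<and> U \<times> V \<subseteq> N"
      using N(1)[unfolded P_def openin_prod_topology_alt, rule_format, OF N(2)] .
    then obtain U V where UV: "openin (top_of_set {0..1::real}) U" "openin Y V" "t \<in> U" "y0 \<in> V"
        "U \<times> V \<subseteq> N"
      by blast
    then obtain T where T: "open T" "U = {0..1} \<inter> T"
      by (auto simp: openin_open)
    then obtain d where d: "d > 0" "ball t d \<subseteq> T"
      using UV(3) openE by blast
    have "R a b" if "a \<le> t" "t \<le> b" "b - a < d" for a b
      unfolding R_def
    proof
      assume "0 \<le> a \<and> b \<le> 1"
      then have "{a..b} \<subseteq> U"
        using that d T by (auto simp: subset_iff dist_real_def)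
      then have "{a..b} \<times> V \<subseteq> N"
        using UV by blast
      then have "is_lift (subtopology P ({a..b} \<times> V)) h k"
        using is_lift_subtopology[OF N(3), of "{a..b} \<times> V"] by (simp add: subtopology_subtopology Int_absorb1)
      then show "\<exists>N k. openin Y N \<and> y0 \<in> N \<and> is_lift (subtopology P ({a..b} \<times> N)) h k"
        using UV by blast
    qed
    then show "\<exists>d>0. \<forall>a b. a \<le> t \<and> t \<le> b \<and> b - a < d \<longrightarrow> R a b"
      using d(1) by blast
  qed simp
  then show thesis
    using that by (auto simp: R_def)
qed

text \<open>Lifts over tubes are normalised by \<open>k0\<close> at time 0. Unique lifting along the
  segment over each point then makes them agree on overlaps, so that they paste.\<close>

lemma homotopy_lift:
  fixes Y :: "'y topology"
  defines "P \<equiv> prod_topology (top_of_set {0..1::real}) Y"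
  assumes h: "continuous_map P Z h" and k0: "is_lift Y (\<lambda>y. h (0, y)) k0"
  obtains k where "is_lift P h k"
proof -
  have "\<exists>N k. openin Y N \<and> y0 \<in> N \<and> is_lift (subtopology P ({0..1} \<times> N)) h k \<and> (\<forall>y\<in>N. k (0, y) = k0 y)"
    if y0: "y0 \<in> topspace Y" for y0
  proof -
    obtain N k where N: "openin Y N" "y0 \<in> N" "is_lift (subtopology P ({0..1} \<times> N)) h k"
      using tube_lift[of Y h y0] h y0 unfolding P_def by blast
    have "continuous_map (subtopology Y N) P (\<lambda>y. (0, y))"
      by (auto simp: P_def continuous_map_pairwise o_def)
    then have c0: "continuous_map (subtopology Y N) (subtopology P ({0..1} \<times> N)) (\<lambda>y. (0, y))"
      by (auto simp: continuous_map_in_subtopology)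
    then obtain k' M where k': "is_lift (subtopology P ({0..1} \<times> N)) h k'"
      and M: "openin (subtopology Y N) M" "y0 \<in> M" "\<And>y. y \<in> M \<Longrightarrow> k' (0, y) = k0 y"
      using adjust_lift[OF N(3) is_lift_subtopology[OF k0] c0, of y0] N(2) y0
      by (metis IntI topspace_subtopology)
    have "M \<subseteq> N" "openin Y M"
      using M(1) N(1) by (auto simp: openin_open_subtopology)
    moreover have "is_lift (subtopology P ({0..1} \<times> M)) h k'"
      using is_lift_subtopology[OF k', of "{0..1} \<times> M"] \<open>M \<subseteq> N\<close>
      by (simp add: subtopology_subtopology Times_Int_Times Int_absorb1)
    ultimately show ?thesis
      using M by blast
  qed
  then obtain N K where N: "\<And>y. y \<in> topspace Y \<Longrightarrow> openin Y (N y) \<and> y \<in> N y"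
    and K: "\<And>y. y \<in> topspace Y \<Longrightarrow> is_lift (subtopology P ({0..1} \<times> N y)) h (K y)"
    and K0: "\<And>y z. \<lbrakk>y \<in> topspace Y; z \<in> N y\<rbrakk> \<Longrightarrow> K y (0, z) = k0 z"
    by metis
  have agree: "K y1 (t, z) = K y2 (t, z)"
    if y: "y1 \<in> topspace Y" "y2 \<in> topspace Y" and z: "z \<in> N y1" "z \<in> N y2" "z \<in> topspace Y"
      and t: "t \<in> {0..1}" for y1 y2 z t
  proof -
    have "continuous_map (top_of_set {0..1::real}) P (\<lambda>t. (t, z))"
      using z by (auto simp: P_def continuous_map_pairwise o_def)
    then have "continuous_map (top_of_set {0..1::real}) (subtopology P ({0..1} \<times> N y)) (\<lambda>t. (t, z))"
      if "z \<in> N y" for y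
      using that by (auto simp: continuous_map_in_subtopology)
    then have l: "is_lift (top_of_set {0..1::real}) (\<lambda>t. h (t, z)) (\<lambda>t. K y1 (t, z))"
      "is_lift (top_of_set {0..1::real}) (\<lambda>t. h (t, z)) (\<lambda>t. K y2 (t, z))"
      using is_lift_compose[OF K[OF y(1)]] is_lift_compose[OF K[OF y(2)]] z by blast+
    have "connected_space (top_of_set {0..1::real})"
      using connectedin_iff_connected[of "{0..1::real}"] connected_Icc by (simp add: connectedin_def)
    from is_lift_unique[OF l this, of 0 t] show ?thesis
      using K0[OF y(1) z(1)] K0[OF y(2) z(2)] t by simp
  qed
  have top: "topspace P = {0..1} \<times> topspace Y"
    by (simp add: P_def)
  have "continuous_map P W (\<lambda>x. K (snd x) x)"
  proof (rule pasting_lemma[where I = "topspace Y" and T = "\<lambda>y. {0..1} \<times> N y" and f = K])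
    show "openin P ({0..1} \<times> N y)" if "y \<in> topspace Y" for y
      using N[OF that] unfolding P_def by (simp add: openin_prod_Times_iff)
    show "continuous_map (subtopology P ({0..1} \<times> N y)) W (K y)" if "y \<in> topspace Y" for y
      using K[OF that] by (simp add: is_lift_def)
    show "K y1 x = K y2 x"
      if "y1 \<in> topspace Y" "y2 \<in> topspace Y" "x \<in> topspace P \<inter> {0..1} \<times> N y1 \<inter> {0..1} \<times> N y2" for y1 y2 x
    proof -
      obtain t z where "x = (t, z)" by (cases x)
      then show ?thesis
        using agree[OF that(1,2), of z t] that(3) by (simp add: top)
    qed
    show "\<exists>j. j \<in> topspace Y \<and> x \<in> {0..1} \<times> N j \<and> K (snd x) x = K j x" if "x \<in> topspace P" for x
      using that N[of "snd x"] by (intro exI[of _ "snd x"]) (simp add: top mem_Times_iff)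
  qed
  moreover have "orbit g (K (snd x) x) = h x" if "x \<in> topspace P" for x
    using that N[of "snd x"] K[of "snd x"] by (simp add: top is_lift_def mem_Times_iff)
  ultimately show thesis
    by (intro that[of "\<lambda>x. K (snd x) x"]) (simp add: is_lift_def)
qed

section \<open>Simplices and cochains upstairs and downstairs\<close>

abbreviation q_pull :: "nat \<Rightarrow> 'w set cochain \<Rightarrow> 'w cochain" where
  "q_pull n \<equiv> cochain_map n W (orbit g)"

abbreviation g_pull :: "nat \<Rightarrow> 'w cochain \<Rightarrow> 'w cochain" where
  "g_pull n \<equiv> cochain_map n W g"

lemma simplex_lift:
  assumes f: "singular_simplex n Z f"
  obtains f' where "singular_simplex n W f'" "simplex_map n (orbit g) f' = f"
proof -
  let ?D = "subtopology (powertop_real UNIV) (standard_simplex n)"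
  define v :: "nat \<Rightarrow> real" where "v = (\<lambda>j. if j = 0 then 1 else 0)"
  (* f is lifted along the contraction of the simplex to its vertex v *)
  define c where "c z = (\<lambda>i. (1 - fst z) * v i + fst z * snd z i)" for z :: "real \<times> (nat \<Rightarrow> real)"
  let ?P = "prod_topology (top_of_set {0..1::real}) ?D"
  have v: "v \<in> standard_simplex n"
    by (simp add: v_def)
  have cf: "continuous_map ?D Z f"
    using f by (simp add: singular_simplex_def)
  have "continuous_map ?P euclideanreal fst"
    by (metis continuous_map_fst continuous_map_in_subtopology)
  moreover have "continuous_map ?P euclideanreal (\<lambda>z. snd z i)" for i
    using continuous_map_compose[OF continuous_map_snd continuous_map_simplex_coordinates]
    by (simp add: o_def)
  ultimately have "continuous_map ?P euclideanreal (\<lambda>z. c z i)" for i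
    unfolding c_def by (intro continuous_intros) auto
  then have "continuous_map ?P ?D c"
    using convex_standard_simplex[OF v]
    by (auto simp: continuous_map_in_subtopology continuous_map_componentwise_UNIV c_def)
  then have h: "continuous_map ?P Z (\<lambda>z. f (c z))"
    using continuous_map_compose[OF _ cf] by (simp add: o_def)
  have "f v \<in> topspace Z"
    using cf v by (auto simp: continuous_map_def)
  then obtain w where w: "w \<in> topspace W" "f v = orbit g w"
    by (auto simp: topspace_orbit_space)
  \<comment> \<open>At time 0 the contraction is constant with value \<open>v\<close>, so a constant
    map lifts it; at time 1 it is the identity, and the lift there is a lift of
    \<open>f\<close>.\<close>
  have "is_lift ?D (\<lambda>y. f (c (0, y))) (\<lambda>_. w)"
    using w by (simp add: is_lift_def c_def)
  then obtain k where k: "is_lift ?P (\<lambda>z. f (c z)) k"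
    using homotopy_lift[OF h] by blast
  have "continuous_map ?D ?P (\<lambda>x. (1, x))"
    by (auto simp: continuous_map_pairwise o_def)
  from is_lift_compose[OF k this] have "is_lift ?D f (\<lambda>x. k (1, x))"
    by (simp add: c_def)
  then have "singular_simplex n W (restrict (\<lambda>x. k (1, x)) (standard_simplex n))"
    and "simplex_map n (orbit g) (restrict (\<lambda>x. k (1, x)) (standard_simplex n)) = f"
    using f by (auto simp: is_lift_def singular_simplex_def simplex_map_def fun_eq_iff extensional_def)
  then show thesis
    using that by blast
qed

lemma simplex_lift_unique:
  assumes f1: "singular_simplex n W f1" and f2: "singular_simplex n W f2"
    and eq: "simplex_map n (orbit g) f1 = simplex_map n (orbit g) f2"
  shows "f1 = f2 \<or> f1 = simplex_map n g f2"
proof -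
  let ?D = "subtopology (powertop_real UNIV) (standard_simplex n)"
  have "orbit g (f1 x) = orbit g (f2 x)" if "x \<in> standard_simplex n" for x
    using fun_cong[OF eq, of x] that by (simp add: simplex_map_def)
  then have l: "is_lift ?D (\<lambda>x. orbit g (f2 x)) f1" "is_lift ?D (\<lambda>x. orbit g (f2 x)) f2"
    using f1 f2 by (simp_all add: is_lift_def singular_simplex_def)
  have "connected_space ?D"
    using connectedin_standard_simplex by (simp add: connectedin_def)
  from is_lift_unique'[OF l this]
  have "(\<forall>x\<in>standard_simplex n. f1 x = f2 x) \<or> (\<forall>x\<in>standard_simplex n. f1 x = g (f2 x))"
    by simp
  then show ?thesis
    using f1 f2 by (auto simp: singular_simplex_def simplex_map_def extensional_def fun_eq_iff)
qed

text \<open>Every simplex downstairs lifts. Identities between cochains of the orbit space may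
  therefore be checked upstairs.\<close>

lemma q_pull_inject:
  assumes "singular_cochain n Z S \<phi>" "singular_cochain n Z S' \<psi>" "q_pull n \<phi> = q_pull n \<psi>"
  shows "\<phi> = \<psi>"
  using assms(1,2)
proof (rule singular_cochain_eqI)
  fix f assume "singular_simplex n Z f"
  then obtain f' where "singular_simplex n W f'" "simplex_map n (orbit g) f' = f"
    by (rule simplex_lift)
  then show "\<phi> f = \<psi> f"
    using fun_cong[OF assms(3), of f'] by (simp add: cochain_map_def)
qed

lemma g_pull_q_pull: "g_pull n (q_pull n \<phi>) = q_pull n \<phi>"
proof -
  have "g_pull n (q_pull n \<phi>) = cochain_map n W (orbit g \<circ> g) \<phi>"
    by (rule cochain_map_compose[OF cont_g])
  also have "\<dots> = q_pull n \<phi>"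
    by (rule cochain_map_cong) (simp add: orbit_g)
  finally show ?thesis .
qed

lemma g_pull_g_pull:
  assumes "singular_cochain n W S \<phi>"
  shows "g_pull n (g_pull n \<phi>) = \<phi>"
proof -
  have "g_pull n (g_pull n \<phi>) = cochain_map n W (g \<circ> g) \<phi>"
    by (rule cochain_map_compose[OF cont_g])
  also have "\<dots> = \<phi>"
    by (rule cochain_map_id[OF _ assms]) (simp add: gg)
  finally show ?thesis .
qed

text \<open>The two lifts of a simplex are exchanged by \<open>g\<close>, so an invariant cochain
  has the same value on both. Cochains downstairs are thus the invariant cochains upstairs, also
  relative to an invariant \<open>A\<close>.\<close>

lemma descend_cochain:
  assumes A: "A \<subseteq> topspace W" "g ` A = A" and \<theta>: "singular_cochain n W A \<theta>" "g_pull n \<theta> = \<theta>"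
  obtains \<theta>' where "singular_cochain n Z (orbit g ` A) \<theta>'" "q_pull n \<theta>' = \<theta>"
proof -
  define l where "l f = (SOME f'. singular_simplex n W f' \<and> simplex_map n (orbit g) f' = f)" for f
  have l: "singular_simplex n W (l f) \<and> simplex_map n (orbit g) (l f) = f" if "singular_simplex n Z f" for f
  proof -
    obtain f' where "singular_simplex n W f'" "simplex_map n (orbit g) f' = f"
      using \<open>singular_simplex n Z f\<close> by (rule simplex_lift)
    then show ?thesis
      using someI[of "\<lambda>f'. singular_simplex n W f' \<and> simplex_map n (orbit g) f' = f" f']
      by (simp add: l_def)
  qed
  define \<theta>' where "\<theta>' f = (if singular_simplex n Z f then \<theta> (l f) else 0)" for f
  have "\<theta>' f = 0" if f: "singular_simplex n (subtopology Z (orbit g ` A)) f" for f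
  proof -
    have fZ: "singular_simplex n Z f" and fA: "f ` standard_simplex n \<subseteq> orbit g ` A"
      using f by (auto simp: singular_simplex_subtopology)
    \<comment> \<open>Whichever lift was chosen, it stays in \<open>A\<close>, because
      \<open>A\<close> contains whole orbits.\<close>
    have "l f x \<in> A" if x: "x \<in> standard_simplex n" for x
    proof -
      have "f x = orbit g (l f x)"
        using l[OF fZ] x by (metis comp_apply restrict_apply simplex_map_def)
      then obtain a where "a \<in> A" "orbit g (l f x) = orbit g a"
        using fA x by (metis imageE imageI subsetD)
      then show ?thesis
        using A(2) orbit_eqD[of "l f x" a] by auto
    qed
    then have "singular_simplex n (subtopology W A) (l f)"
      using l[OF fZ] by (auto simp: singular_simplex_subtopology)
    then show ?thesis
      using \<theta>(1) by (simp add: \<theta>'_def singular_cochain_def)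
  qed
  then have c: "singular_cochain n Z (orbit g ` A) \<theta>'"
    by (simp add: singular_cochain_def \<theta>'_def)
  have "q_pull n \<theta>' = \<theta>"
  proof (rule singular_cochain_eqI[where S = "{}"])
    show "singular_cochain n W {} (q_pull n \<theta>')"
      by (rule singular_cochain_cochain_map[OF cont_q _ c]) auto
    show "singular_cochain n W A \<theta>" by (fact \<theta>)
    fix f assume f: "singular_simplex n W f"
    then have fZ: "singular_simplex n Z (simplex_map n (orbit g) f)"
      by (rule singular_simplex_simplex_map[OF _ cont_q])
    have "l (simplex_map n (orbit g) f) = f \<or> l (simplex_map n (orbit g) f) = simplex_map n g f"
      using l[OF fZ] f by (intro simplex_lift_unique) simp_all
    moreover have "\<theta> (simplex_map n g f) = \<theta> f"
      using fun_cong[OF \<theta>(2), of f] f by (simp add: cochain_map_def)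
    ultimately show "q_pull n \<theta>' f = \<theta> f"
      using f fZ by (auto simp: cochain_map_def \<theta>'_def)
  qed
  then show thesis
    using that c by blast
qed

end

section \<open>The Gysin sequence of a double covering\<close>

text \<open>The argument given to \<open>f\<close> is the only point of the standard 0-simplex, so
  this is the function \<open>s\<close> read as a 0-cochain.\<close>

definition vertex_cochain :: "'a topology \<Rightarrow> ('a \<Rightarrow> bit) \<Rightarrow> 'a cochain" where
  "vertex_cochain X s = (\<lambda>f. if singular_simplex 0 X f then s (f (\<lambda>j. if j = 0 then 1 else 0)) else 0)"

lemma singular_cochain_vertex: "singular_cochain 0 X {} (vertex_cochain X s)"
  by (auto simp: singular_cochain_def vertex_cochain_def singular_simplex_empty)

lemma cochain_map_vertex:
  assumes "continuous_map X X' g"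
  shows "cochain_map 0 X g (vertex_cochain X' s) = vertex_cochain X (s \<circ> g)"
proof
  fix f
  have "simplex_map 0 g f (\<lambda>j. if j = 0 then 1 else 0) = g (f (\<lambda>j. if j = 0 then 1 else 0))"
    by (simp add: simplex_map_def)
  then show "cochain_map 0 X g (vertex_cochain X' s) f = vertex_cochain X (s \<circ> g) f"
    using singular_simplex_simplex_map[OF _ assms, of 0 f] by (simp add: cochain_map_def vertex_cochain_def)
qed

lemma singular_simplex_in:
  "\<lbrakk>singular_simplex n X f; x \<in> standard_simplex n\<rbrakk> \<Longrightarrow> f x \<in> topspace X"
  by (auto simp: singular_simplex_def continuous_map_def)

text \<open>
  The function \<open>s\<close> separates the two points of each orbit; it need not be continuous.  The
  coboundary of the 0-cochain \<open>s\<close> descends to a cocycle \<open>w\<close> in the characteristic class of the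
  covering.
\<close>

locale signed_double_cover = double_cover W g for W :: "'w topology" and g :: "'w \<Rightarrow> 'w" +
  fixes s :: "'w \<Rightarrow> bit" and w :: "'w set cochain" and A :: "'w set"
  assumes s_g: "\<And>x. x \<in> topspace W \<Longrightarrow> s (g x) = s x + 1"
    and w: "singular_cochain (Suc 0) Z {} w"
    and q_w: "q_pull (Suc 0) w = coboundary 0 W (vertex_cochain W s)"
    and A: "A \<subseteq> topspace W" "g ` A = A"
begin

abbreviation T :: "'w set set" where "T \<equiv> orbit g ` A"

lemma g_vertex: "g_pull 0 (vertex_cochain W s) = vertex_cochain W s + unit_cochain W"
  unfolding cochain_map_vertex[OF cont_g]
  by (intro ext) (auto simp: vertex_cochain_def unit_cochain_def s_g singular_simplex_in)

lemma q_in: "orbit g \<in> A \<rightarrow> T"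
  by auto

lemma g_in_A: "g \<in> A \<rightarrow> A"
  using A(2) by auto

lemma singular_cochain_q:
  "singular_cochain n Z T \<phi> \<Longrightarrow> singular_cochain n W A (q_pull n \<phi>)"
  by (rule singular_cochain_cochain_map[OF cont_q q_in])

lemma singular_cochain_g:
  "singular_cochain n W A \<phi> \<Longrightarrow> singular_cochain n W A (g_pull n \<phi>)"
  by (rule singular_cochain_cochain_map[OF cont_g g_in_A])

lemma coboundary_q: "coboundary n W (q_pull n \<phi>) = q_pull (Suc n) (coboundary n Z \<phi>)"
  by (rule coboundary_cochain_map[OF cont_q])

lemma coboundary_g: "coboundary n W (g_pull n \<phi>) = g_pull (Suc n) (coboundary n W \<phi>)"
  by (rule coboundary_cochain_map[OF cont_g])

lemma w_cocycle: "singular_cocycle (Suc 0) Z {} w"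
proof -
  have "q_pull (Suc (Suc 0)) (coboundary (Suc 0) Z w) = q_pull (Suc (Suc 0)) 0"
    by (simp add: q_w flip: coboundary_q)
  then have "coboundary (Suc 0) Z w = 0"
    using q_pull_inject[OF singular_cochain_coboundary[OF w] singular_cochain_0[of _ _ "{}"]] by blast
  then show ?thesis
    using w by (simp add: singular_cocycle_iff)
qed

text \<open>The pull-back of \<open>\<xi>\<close> is invariant, and \<open>s\<close> changes by the
  unit cochain. The defect \<open>q_pull n \<xi>\<close> is what compensates a transfer in both
  Gysin theorems.\<close>

lemma g_cup_vertex:
  assumes "singular_cochain n Z T \<xi>"
  shows "g_pull n (cup_cochain n 0 W (q_pull n \<xi>) (vertex_cochain W s)) =
    cup_cochain n 0 W (q_pull n \<xi>) (vertex_cochain W s) + q_pull n \<xi>"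
  using cochain_map_cup_cochain[OF cont_g, of n 0 "q_pull n \<xi>" "vertex_cochain W s"]
    cup_cochain_unit_right[OF singular_cochain_q[OF assms]]
  by (simp add: g_pull_q_pull g_vertex cup_cochain_add_right)

lemma coboundary_cup_vertex:
  assumes "coboundary n Z \<xi> = 0"
  shows "coboundary n W (cup_cochain n 0 W (q_pull n \<xi>) (vertex_cochain W s)) =
    q_pull (Suc n) (cup_cochain n (Suc 0) Z \<xi> w)"
  using coboundary_cup_cochain[of n 0 W "q_pull n \<xi>" "vertex_cochain W s"]
    cochain_map_cup_cochain[OF cont_q, of n "Suc 0" \<xi> w] assms
  by (simp add: coboundary_q q_w)

text \<open>Upstairs \<open>w\<close> is the coboundary of \<open>s\<close>. Although
  \<open>s\<close> is an absolute cochain, its product with a relative one is relative.\<close>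

lemma singular_coboundary_q_cup:
  assumes "singular_cocycle n Z T \<xi>"
  shows "singular_coboundary (Suc n) W A (q_pull (Suc n) (cup_cochain n (Suc 0) Z \<xi> w))"
proof -
  have "singular_cochain n W A (cup_cochain n 0 W (q_pull n \<xi>) (vertex_cochain W s))"
    using singular_cochain_cup[OF singular_cochain_q, of n \<xi> 0] assms by (simp add: singular_cocycle_iff)
  then show ?thesis
    using assms coboundary_cup_vertex[of n \<xi>] unfolding singular_coboundary_Suc singular_cocycle_iff
    by metis
qed

text \<open>
  The cocycle \<open>\<xi>\<close> is the transfer of a cochain \<open>\<psi>\<close> that bounds the pull-back of \<open>\<phi>\<close>.  Since
  \<open>s\<close> changes by 1 under \<open>g\<close>, the cochain \<open>\<psi> + \<xi> \<union> s\<close> is invariant; it descends to a cochain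
  with coboundary \<open>\<phi> + \<xi> \<union> w\<close>.
\<close>

theorem gysin_kernel_q:
  assumes \<phi>: "singular_cocycle (Suc n) Z T \<phi>" and cob: "singular_coboundary (Suc n) W A (q_pull (Suc n) \<phi>)"
  obtains \<xi> where "singular_cocycle n Z T \<xi>" "cohomologous (Suc n) Z T \<phi> (cup_cochain n (Suc 0) Z \<xi> w)"
proof -
  obtain \<psi> where \<psi>: "singular_cochain n W A \<psi>" and \<psi>\<phi>: "q_pull (Suc n) \<phi> = coboundary n W \<psi>"
    using cob by (auto simp: singular_coboundary_Suc)
  have \<phi>c: "singular_cochain (Suc n) Z T \<phi>"
    using \<phi> by (simp add: singular_cocycle_iff)
  have "g_pull n (\<psi> + g_pull n \<psi>) = \<psi> + g_pull n \<psi>"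
    by (simp add: cochain_map_add g_pull_g_pull[OF \<psi>] add.commute)
  then obtain \<xi> where \<xi>: "singular_cochain n Z T \<xi>" and q\<xi>: "q_pull n \<xi> = \<psi> + g_pull n \<psi>"
    using descend_cochain[OF A singular_cochain_add[OF \<psi> singular_cochain_g[OF \<psi>]]] by metis
  \<comment> \<open>Upstairs this is the pull-back of \<open>\<phi>\<close> plus its image under
    \<open>g\<close>, that is, twice an invariant cochain.\<close>
  have "q_pull (Suc n) (coboundary n Z \<xi>) = q_pull (Suc n) 0"
    by (simp add: q\<xi> coboundary_add coboundary_g g_pull_q_pull flip: coboundary_q \<psi>\<phi>)
  then have \<delta>\<xi>: "coboundary n Z \<xi> = 0"
    using q_pull_inject[OF singular_cochain_coboundary[OF \<xi>] singular_cochain_0[of _ _ T]] by blast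
  define \<theta> where "\<theta> = \<psi> + cup_cochain n 0 W (q_pull n \<xi>) (vertex_cochain W s)"
  have \<theta>: "singular_cochain n W A \<theta>"
    using singular_cochain_cup[OF singular_cochain_q[OF \<xi>], of 0] \<psi>
    by (simp add: \<theta>_def singular_cochain_add)
  have "g_pull n \<theta> = \<theta>"
    by (simp add: \<theta>_def cochain_map_add g_cup_vertex[OF \<xi>]) (simp add: q\<xi> add_ac)
  then obtain \<theta>' where \<theta>': "singular_cochain n Z T \<theta>'" and q\<theta>': "q_pull n \<theta>' = \<theta>"
    using descend_cochain[OF A \<theta>] by blast
  have cup: "singular_cochain (Suc n) Z T (cup_cochain n (Suc 0) Z \<xi> w)"
    using singular_cochain_cup[OF \<xi>, of "Suc 0"] by simp
  have "q_pull (Suc n) (\<phi> + cup_cochain n (Suc 0) Z \<xi> w) = q_pull (Suc n) (coboundary n Z \<theta>')"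
    by (simp add: q\<theta>' \<theta>_def cochain_map_add coboundary_add \<psi>\<phi> coboundary_cup_vertex[OF \<delta>\<xi>] flip: coboundary_q)
  then have "\<phi> + cup_cochain n (Suc 0) Z \<xi> w = coboundary n Z \<theta>'"
    by (rule q_pull_inject[OF singular_cochain_add[OF \<phi>c cup] singular_cochain_coboundary[OF \<theta>']])
  then have "cohomologous (Suc n) Z T \<phi> (cup_cochain n (Suc 0) Z \<xi> w)"
    using \<theta>' by (auto simp: cohomologous_def singular_coboundary_Suc)
  then show thesis
    using that \<xi> \<delta>\<xi> by (simp add: singular_cocycle_iff)
qed

text \<open>
  If \<open>\<xi> \<union> w\<close> is the coboundary of \<open>\<theta>\<close>, then \<open>\<theta> + \<xi> \<union> s\<close> is a cocycle upstairs whose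
  transfer is \<open>\<xi>\<close>, and modulo 2 the transfer of a pull-back is 0.
\<close>

theorem gysin_cup_inject:
  assumes \<xi>: "singular_cocycle n Z T \<xi>"
    and cob: "singular_coboundary (Suc n) Z T (cup_cochain n (Suc 0) Z \<xi> w)"
    and onto: "\<And>\<psi>. singular_cocycle n W A \<psi> \<Longrightarrow> \<exists>\<eta>. singular_cocycle n Z T \<eta> \<and> cohomologous n W A \<psi> (q_pull n \<eta>)"
  shows "singular_coboundary n Z T \<xi>"
proof -
  have \<xi>c: "singular_cochain n Z T \<xi>" and \<delta>\<xi>: "coboundary n Z \<xi> = 0"
    using \<xi> by (auto simp: singular_cocycle_iff)
  obtain \<theta> where \<theta>: "singular_cochain n Z T \<theta>" and cup: "cup_cochain n (Suc 0) Z \<xi> w = coboundary n Z \<theta>"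
    using cob by (auto simp: singular_coboundary_Suc)
  define \<psi> where "\<psi> = q_pull n \<theta> + cup_cochain n 0 W (q_pull n \<xi>) (vertex_cochain W s)"
  have "singular_cochain n W A \<psi>"
    using singular_cochain_cup[OF singular_cochain_q[OF \<xi>c], of 0] singular_cochain_q[OF \<theta>]
    by (simp add: \<psi>_def singular_cochain_add)
  moreover have "coboundary n W \<psi> = 0"
    by (simp add: \<psi>_def coboundary_add coboundary_cup_vertex[OF \<delta>\<xi>] coboundary_q cup)
  ultimately have "singular_cocycle n W A \<psi>"
    by (simp add: singular_cocycle_iff)
  then obtain \<eta> where "singular_coboundary n W A (\<psi> + q_pull n \<eta>)"
    using onto by (auto simp: cohomologous_def)
  moreover define \<beta> where "\<beta> = \<psi> + q_pull n \<eta>"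
  ultimately have \<beta>: "singular_coboundary n W A \<beta>"
    by simp
  \<comment> \<open>The pull-backs of \<open>\<theta>\<close> and \<open>\<eta>\<close> are
    invariant and drop out; only the defect of the cup product with \<open>s\<close>
    survives.\<close>
  have q\<xi>: "q_pull n \<xi> = \<beta> + g_pull n \<beta>"
    by (simp add: \<beta>_def \<psi>_def cochain_map_add g_pull_q_pull g_cup_vertex[OF \<xi>c] add_ac)
  \<comment> \<open>In degree 0 only the zero cochain bounds. In positive degree the transfer of a
    primitive of \<open>\<beta>\<close> descends to a primitive of \<open>\<xi>\<close>.\<close>
  show ?thesis
  proof (cases n)
    case 0
    then have "\<beta> = 0"
      using \<beta> by (simp add: singular_coboundary_at_0)
    then have "q_pull n \<xi> = q_pull n 0"
      using q\<xi> by simp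
    then have "\<xi> = 0"
      by (rule q_pull_inject[OF \<xi>c singular_cochain_0[of _ _ T]])
    then show ?thesis by simp
  next
    case (Suc m)
    then obtain \<zeta> where \<zeta>: "singular_cochain m W A \<zeta>" and \<beta>\<zeta>: "\<beta> = coboundary m W \<zeta>"
      using \<beta> by (auto simp: singular_coboundary_Suc)
    have "g_pull m (\<zeta> + g_pull m \<zeta>) = \<zeta> + g_pull m \<zeta>"
      by (simp add: cochain_map_add g_pull_g_pull[OF \<zeta>] add.commute)
    then obtain \<zeta>' where \<zeta>': "singular_cochain m Z T \<zeta>'" and q\<zeta>': "q_pull m \<zeta>' = \<zeta> + g_pull m \<zeta>"
      using descend_cochain[OF A singular_cochain_add[OF \<zeta> singular_cochain_g[OF \<zeta>]]] by metis
    have "q_pull (Suc m) \<xi> = q_pull (Suc m) (coboundary m Z \<zeta>')"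
      using q\<xi> Suc by (simp add: q\<zeta>' \<beta>\<zeta> coboundary_add coboundary_g flip: coboundary_q)
    then have "\<xi> = coboundary m Z \<zeta>'"
      using q_pull_inject[OF _ singular_cochain_coboundary[OF \<zeta>']] \<xi>c Suc by blast
    then show ?thesis
      using \<zeta>' Suc by (auto simp: singular_coboundary_Suc)
  qed
qed

end

text \<open>One point is chosen in each orbit. A continuous choice would trivialise the covering, so
  \<open>s\<close> is a bare function.\<close>

lemma (in double_cover) sign_exists:
  obtains s where "\<And>x. x \<in> topspace W \<Longrightarrow> s (g x) = s x + (1 :: bit)"
proof -
  define r where "r z = (SOME x. x \<in> topspace W \<and> orbit g x = z)" for z
  define s where "s x = (if x = r (orbit g x) then 0 else 1 :: bit)" for x
  have "s (g x) = s x + 1" if x: "x \<in> topspace W" for x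
  proof -
    have "r (orbit g x) \<in> topspace W \<and> orbit g (r (orbit g x)) = orbit g x"
      unfolding r_def by (rule someI[of _ x]) (simp add: x)
    then have "r (orbit g x) = x \<or> r (orbit g x) = g x"
      using orbit_eqD by blast
    then show ?thesis
      using g_neq[OF x] by (auto simp: s_def orbit_g[OF x])
  qed
  then show thesis
    by (rule that)
qed

text \<open>Under \<open>g\<close> the 0-cochain \<open>s\<close> changes by the unit cochain, which
  is a cocycle; the coboundary of \<open>s\<close> is therefore invariant and descends.\<close>

lemma (in double_cover) characteristic_cochain_exists:
  assumes s: "\<And>x. x \<in> topspace W \<Longrightarrow> s (g x) = s x + (1 :: bit)"
  obtains w where "singular_cochain (Suc 0) Z {} w" "q_pull (Suc 0) w = coboundary 0 W (vertex_cochain W s)"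
proof -
  have "g_pull 0 (vertex_cochain W s) = vertex_cochain W s + unit_cochain W"
    unfolding cochain_map_vertex[OF cont_g]
    by (intro ext) (auto simp: vertex_cochain_def unit_cochain_def s singular_simplex_in)
  moreover have "coboundary 0 W (unit_cochain W) = 0"
    using singular_cocycle_unit[of W] by (simp add: singular_cocycle_iff)
  ultimately have "g_pull (Suc 0) (coboundary 0 W (vertex_cochain W s)) = coboundary 0 W (vertex_cochain W s)"
    by (simp add: coboundary_add flip: coboundary_cochain_map[OF cont_g])
  moreover have "singular_cochain (Suc 0) W {} (coboundary 0 W (vertex_cochain W s))"
    by (intro singular_cochain_coboundary singular_cochain_vertex)
  ultimately show thesis
    using descend_cochain[of "{}"] that by auto
qed

section \<open>The Borel construction\<close>

lemma double_cover_universal: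
  "universal_space E \<epsilon> \<Longrightarrow> double_cover E \<epsilon>"
  by (auto simp: universal_space_def double_cover_def)

lemma double_cover_borel:
  assumes E: "universal_space E \<epsilon>" and X: "involution X \<tau>"
  shows "double_cover (prod_topology E X) (map_prod \<epsilon> \<tau>)"
proof
  interpret E: double_cover E \<epsilon>
    by (rule double_cover_universal[OF E])
  have "continuous_map (prod_topology E X) (prod_topology E X) (map_prod \<epsilon> \<tau>)"
    using X E.cont_g by (simp add: involution_def map_prod_def continuous_map_prod_top)
  then show "involution (prod_topology E X) (map_prod \<epsilon> \<tau>)"
    using X E.gg by (auto simp: involution_def)
  fix z assume "z \<in> topspace (prod_topology E X)"
  then have z: "fst z \<in> topspace E" "snd z \<in> topspace X" by auto
  from E.free[OF z(1)] obtain U where U: "openin E U" "fst z \<in> U" "U \<inter> \<epsilon> ` U = {}"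
    by blast
  show "\<exists>V. openin (prod_topology E X) V \<and> z \<in> V \<and> V \<inter> map_prod \<epsilon> \<tau> ` V = {}"
  proof (intro exI conjI)
    show "openin (prod_topology E X) (U \<times> topspace X)"
      using U(1) by (simp add: openin_prod_Times_iff)
    show "z \<in> U \<times> topspace X"
      using U(2) z(2) by (simp add: mem_Times_iff)
    show "(U \<times> topspace X) \<inter> map_prod \<epsilon> \<tau> ` (U \<times> topspace X) = {}"
      using U(3) by auto
  qed
qed

text \<open>The sign and the characteristic cochain live on \<open>E\<close> alone. One choice thus
  serves X and its fixed point set, and restriction between the two Borel constructions respects it
  on the level of cochains.\<close>

locale borel =
  fixes E :: "'e topology" and \<epsilon> :: "'e \<Rightarrow> 'e" and X :: "'a topology" and \<tau> :: "'a \<Rightarrow> 'a"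
    and Y :: "'a set" and s :: "'e \<Rightarrow> bit" and wB :: "'e set cochain"
  assumes E: "universal_space E \<epsilon>" and X: "involution X \<tau>" and Y: "Y \<subseteq> topspace X" "\<tau> ` Y = Y"
    and s: "\<And>e. e \<in> topspace E \<Longrightarrow> s (\<epsilon> e) = s e + 1"
    and wB: "singular_cochain (Suc 0) (orbit_space E \<epsilon>) {} wB"
    and q_wB: "cochain_map (Suc 0) E (orbit \<epsilon>) wB = coboundary 0 E (vertex_cochain E s)"
begin

abbreviation bw :: "('e \<times> 'a) set cochain" where
  "bw \<equiv> cochain_map (Suc 0) (orbit_space (prod_topology E X) (map_prod \<epsilon> \<tau>)) borel_to_base wB"

lemma borel_to_base_orbit: "borel_to_base \<circ> orbit (map_prod \<epsilon> \<tau>) = orbit \<epsilon> \<circ> fst"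
  by (auto simp: borel_to_base_def orbit_def fun_eq_iff)

lemma cont_borel_to_base:
  "continuous_map (orbit_space (prod_topology E X) (map_prod \<epsilon> \<tau>)) (orbit_space E \<epsilon>) borel_to_base"
proof (rule continuous_compose_quotient_map[OF quotient_map_orbit_space])
  interpret E: double_cover E \<epsilon>
    by (rule double_cover_universal[OF E])
  show "continuous_map (prod_topology E X) (orbit_space E \<epsilon>) (borel_to_base \<circ> orbit (map_prod \<epsilon> \<tau>))"
    unfolding borel_to_base_orbit by (intro continuous_map_compose[OF continuous_map_fst E.cont_q])
qed

sublocale signed_double_cover "prod_topology E X" "map_prod \<epsilon> \<tau>" "s \<circ> fst" bw "topspace E \<times> Y"
proof (intro signed_double_cover.intro signed_double_cover_axioms.intro)
  interpret E: double_cover E \<epsilon>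
    by (rule double_cover_universal[OF E])
  interpret W: double_cover "prod_topology E X" "map_prod \<epsilon> \<tau>"
    by (rule double_cover_borel[OF E X])
  show "double_cover (prod_topology E X) (map_prod \<epsilon> \<tau>)"
    by (rule double_cover_borel[OF E X])
  show "(s \<circ> fst) (map_prod \<epsilon> \<tau> x) = (s \<circ> fst) x + 1" if "x \<in> topspace (prod_topology E X)" for x
    using that by (auto simp: s)
  show "singular_cochain (Suc 0) W.Z {} bw"
    by (rule singular_cochain_cochain_map[OF cont_borel_to_base _ wB]) simp
  have "W.q_pull (Suc 0) bw = cochain_map (Suc 0) (prod_topology E X) (orbit \<epsilon> \<circ> fst) wB"
    unfolding cochain_map_compose[OF W.cont_q] borel_to_base_orbit ..
  also have "\<dots> = cochain_map (Suc 0) (prod_topology E X) fst (coboundary 0 E (vertex_cochain E s))"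
    using cochain_map_compose[OF continuous_map_fst, of "Suc 0" E X "orbit \<epsilon>" wB] by (simp add: q_wB)
  also have "\<dots> = coboundary 0 (prod_topology E X) (vertex_cochain (prod_topology E X) (s \<circ> fst))"
    by (simp flip: coboundary_cochain_map[OF continuous_map_fst] cochain_map_vertex[OF continuous_map_fst])
  finally show "W.q_pull (Suc 0) bw = \<dots>" .
  show "topspace E \<times> Y \<subseteq> topspace (prod_topology E X)"
    using Y by auto
  have "\<epsilon> ` topspace E = topspace E"
    using E.g_in E.gg by (metis (no_types, lifting) image_subset_iff subsetI subset_antisym image_eqI)
  then show "map_prod \<epsilon> \<tau> ` (topspace E \<times> Y) = topspace E \<times> Y"
    using Y(2) by (metis map_prod_surj_on)
qed

abbreviation W :: "('e \<times> 'a) topology" where "W \<equiv> prod_topology E X"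

definition e0 :: 'e where "e0 = (SOME e. e \<in> topspace E)"

abbreviation f_pull :: "nat \<Rightarrow> ('e \<times> 'a) set cochain \<Rightarrow> 'a cochain" where
  "f_pull n \<equiv> cochain_map n X (fibre_inclusion E \<epsilon> \<tau>)"

lemma e0: "e0 \<in> topspace E"
  using E unfolding universal_space_def e0_def by (simp add: some_in_eq)

lemma fibre_inclusion_eq: "fibre_inclusion E \<epsilon> \<tau> = orbit (map_prod \<epsilon> \<tau>) \<circ> Pair e0"
  by (auto simp: fibre_inclusion_def e0_def)

lemma cont_sec: "continuous_map X W (Pair e0)"
  using e0 by (simp add: continuous_map_pairwise o_def)

lemma sec_in: "Pair e0 \<in> Y \<rightarrow> topspace E \<times> Y"
  using e0 by auto

lemma cont_fib: "continuous_map X Z (fibre_inclusion E \<epsilon> \<tau>)"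
  unfolding fibre_inclusion_eq by (rule continuous_map_compose[OF cont_sec cont_q])

lemma fib_in: "fibre_inclusion E \<epsilon> \<tau> \<in> Y \<rightarrow> T"
  using e0 by (auto simp: fibre_inclusion_eq)

lemma f_pull_eq: "f_pull n \<phi> = cochain_map n X (Pair e0) (q_pull n \<phi>)"
  unfolding fibre_inclusion_eq cochain_map_compose[OF cont_sec] ..

lemma cocycle_fib: "singular_cocycle n Z T \<phi> \<Longrightarrow> singular_cocycle n X Y (f_pull n \<phi>)"
  by (rule singular_cocycle_cochain_map[OF cont_fib fib_in])

lemma cohomologous_fib: "cohomologous n Z T \<phi> \<psi> \<Longrightarrow> cohomologous n X Y (f_pull n \<phi>) (f_pull n \<psi>)"
  by (rule cohomologous_cochain_map[OF cont_fib fib_in])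

text \<open>The contraction moves only the factor \<open>E\<close>, hence preserves
  \<open>topspace E \<times> Y\<close>. It cannot be equivariant, as \<open>e0\<close> is not fixed
  by \<open>\<epsilon>\<close>, but it is applied only upstairs.\<close>

lemma homotopic_sec_snd:
  "homotopic_with (\<lambda>k. k \<in> topspace E \<times> Y \<rightarrow> topspace E \<times> Y) W W id (Pair e0 \<circ> snd)"
proof -
  have "homotopic_with (\<lambda>x. True) E E id (\<lambda>x. e0)"
    using E e0 by (auto simp: universal_space_def contractible_space_alt)
  then obtain h where h: "continuous_map (prod_topology (top_of_set {0..1::real}) E) E h"
    and h0: "\<And>x. h (0, x) = x" and h1: "\<And>x. h (1, x) = e0"
    by (auto simp: homotopic_with_def)
  let ?P = "prod_topology (top_of_set {0..1::real}) W"
  let ?k = "\<lambda>z. (h (fst z, fst (snd z)), snd (snd z))"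
  have c: "continuous_map ?P E (\<lambda>z. fst (snd z))" "continuous_map ?P X (\<lambda>z. snd (snd z))"
    using continuous_map_compose[OF continuous_map_snd continuous_map_fst]
      continuous_map_compose[OF continuous_map_snd continuous_map_snd] by (simp_all add: o_def)
  have "continuous_map ?P (prod_topology (top_of_set {0..1::real}) E) (\<lambda>z. (fst z, fst (snd z)))"
    using c(1) continuous_map_fst[of "top_of_set {0..1::real}" W]
    by (simp add: continuous_map_pairwise o_def)
  from continuous_map_compose[OF this h] have k: "continuous_map ?P W ?k"
    using c(2) by (simp add: continuous_map_pairwise o_def)
  have hE: "h (t, e) \<in> topspace E" if "t \<in> {0..1}" "e \<in> topspace E" for t e
    using continuous_map_image_subset_topspace[OF h] that by (auto simp: image_subset_iff)
  show ?thesis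
    unfolding homotopic_with_def
  proof (intro exI conjI allI ballI)
    show "continuous_map ?P W ?k" by (fact k)
    show "?k (0, z) = id z" for z
      by (simp add: h0)
    show "?k (1, z) = (Pair e0 \<circ> snd) z" for z
      by (simp add: h1)
    show "(\<lambda>z. ?k (t, z)) \<in> topspace E \<times> Y \<rightarrow> topspace E \<times> Y" if "t \<in> {0..1}" for t
      using hE[OF that] by auto
  qed
qed

lemma deform:
  assumes "singular_cocycle n W (topspace E \<times> Y) \<psi>"
  shows "cohomologous n W (topspace E \<times> Y) \<psi> (cochain_map n W snd (cochain_map n X (Pair e0) \<psi>))"
proof -
  have "cochain_map n W id \<psi> = \<psi>"
    using assms by (intro cochain_map_id) (auto simp: singular_cocycle_iff)
  moreover have "cochain_map n W (Pair e0 \<circ> snd) \<psi> = cochain_map n W snd (cochain_map n X (Pair e0) \<psi>)"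
    by (rule cochain_map_compose[OF continuous_map_snd, symmetric])
  ultimately show ?thesis
    using cohomologous_homotopic[OF homotopic_sec_snd assms] by simp
qed

text \<open>By \<open>deform\<close> a cocycle on \<open>W\<close> is determined up to coboundaries
  by one slice. This trades the kernel of \<rho> for the kernel of \<open>q_pull\<close>, the one
  that the Gysin sequence describes.\<close>

lemma q_pull_coboundary:
  assumes \<phi>: "singular_cocycle n Z T \<phi>" and cob: "singular_coboundary n X Y (f_pull n \<phi>)"
  shows "singular_coboundary n W (topspace E \<times> Y) (q_pull n \<phi>)"
proof -
  have "singular_coboundary n W (topspace E \<times> Y) (cochain_map n W snd (f_pull n \<phi>))"
    by (rule singular_coboundary_cochain_map[OF continuous_map_snd _ cob]) auto
  moreover have "cohomologous n W (topspace E \<times> Y) (q_pull n \<phi>) (cochain_map n W snd (f_pull n \<phi>))"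
    unfolding f_pull_eq by (rule deform[OF singular_cocycle_cochain_map[OF cont_q q_in \<phi>]])
  ultimately show ?thesis
    using cohomologous_coboundary_iff by blast
qed

lemma fibre_kernel:
  assumes "singular_cocycle (Suc n) Z T \<phi>" "singular_coboundary (Suc n) X Y (f_pull (Suc n) \<phi>)"
  obtains \<xi> where "singular_cocycle n Z T \<xi>" "cohomologous (Suc n) Z T \<phi> (cup_cochain n (Suc 0) Z \<xi> bw)"
  using gysin_kernel_q[OF assms(1) q_pull_coboundary[OF assms]] by blast

text \<open>Degree 0 has no lower degree to divide into: the kernel is zero even as a set of
  cochains. This starts the induction on the degree.\<close>

lemma fibre_kernel_0:
  assumes "singular_cocycle 0 Z T \<phi>" "singular_coboundary 0 X Y (f_pull 0 \<phi>)"
  shows "\<phi> = 0"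
proof -
  have "q_pull 0 \<phi> = q_pull 0 0"
    using q_pull_coboundary[OF assms] by (simp add: singular_coboundary_at_0)
  then show ?thesis
    using assms(1) q_pull_inject[OF _ singular_cochain_0[of _ _ T]] by (auto simp: singular_cocycle_iff)
qed

lemma fibre_cup:
  assumes "singular_cocycle n Z T \<xi>"
  shows "singular_coboundary (Suc n) X Y (f_pull (Suc n) (cup_cochain n (Suc 0) Z \<xi> bw))"
  unfolding f_pull_eq
  by (rule singular_coboundary_cochain_map[OF cont_sec sec_in singular_coboundary_q_cup[OF assms]])

lemma coboundary_cup_bw:
  "singular_coboundary n Z T \<xi> \<Longrightarrow> singular_coboundary (Suc n) Z T (cup_cochain n (Suc 0) Z \<xi> bw)"
  using singular_coboundary_cup_left[OF _ w_cocycle, of n T \<xi>] by simp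

end

section \<open>Powers of the universal class and the Kuenneth map for a trivial action\<close>

primrec cup_pow :: "'a topology \<Rightarrow> 'a cochain \<Rightarrow> nat \<Rightarrow> 'a cochain" where
  "cup_pow X w 0 = unit_cochain X"
| "cup_pow X w (Suc i) = cup_cochain i (Suc 0) X (cup_pow X w i) w"

lemma singular_cocycle_cup_pow:
  "singular_cocycle (Suc 0) X {} w \<Longrightarrow> singular_cocycle i X {} (cup_pow X w i)"
proof (induction i)
  case (Suc i)
  then show ?case
    using singular_cocycle_cup[of i X "{}" "cup_pow X w i" "Suc 0" "{}" w] by simp
qed (simp add: singular_cocycle_unit)

lemma cochain_map_cup_pow:
  assumes "continuous_map X X' g"
  shows "cochain_map i X g (cup_pow X' w i) = cup_pow X (cochain_map (Suc 0) X g w) i"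
proof (induction i)
  case (Suc i)
  then show ?case
    using cochain_map_cup_cochain[OF assms, of i "Suc 0"] by simp
qed (simp add: cochain_map_unit[OF assms])

locale borel_trivial = borel +
  assumes triv: "\<And>x. x \<in> topspace X \<Longrightarrow> \<tau> x = x"
begin

lemma borel_to_fixed_orbit: "z \<in> topspace W \<Longrightarrow> borel_to_fixed (orbit (map_prod \<epsilon> \<tau>) z) = snd z"
  by (auto simp: borel_to_fixed_def orbit_def triv)

lemma cont_pr: "continuous_map Z X borel_to_fixed"
proof (rule continuous_compose_quotient_map[OF quotient_map_orbit_space])
  show "continuous_map W X (borel_to_fixed \<circ> orbit (map_prod \<epsilon> \<tau>))"
    by (rule continuous_map_eq[OF continuous_map_snd]) (simp add: borel_to_fixed_orbit)
qed

lemma pr_in: "borel_to_fixed \<in> T \<rightarrow> Y"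
  using Y(1) by (auto simp: borel_to_fixed_orbit)

lemma pr_fib: "x \<in> topspace X \<Longrightarrow> borel_to_fixed (fibre_inclusion E \<epsilon> \<tau> x) = x"
  using e0 by (simp add: fibre_inclusion_eq borel_to_fixed_orbit)

abbreviation p_pull :: "nat \<Rightarrow> 'b cochain \<Rightarrow> ('a \<times> 'b) set cochain" where
  "p_pull n \<equiv> cochain_map n Z borel_to_fixed"

lemma fib_pr:
  assumes "singular_cochain n X Y \<phi>"
  shows "f_pull n (p_pull n \<phi>) = \<phi>"
proof -
  have "f_pull n (p_pull n \<phi>) = cochain_map n X (borel_to_fixed \<circ> fibre_inclusion E \<epsilon> \<tau>) \<phi>"
    by (rule cochain_map_compose[OF cont_fib])
  also have "\<dots> = \<phi>"
    by (rule cochain_map_id[OF _ assms]) (simp add: pr_fib)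
  finally show ?thesis .
qed

lemma cocycle_pr: "singular_cocycle n X Y \<phi> \<Longrightarrow> singular_cocycle n Z T (p_pull n \<phi>)"
  by (rule singular_cocycle_cochain_map[OF cont_pr pr_in])

text \<open>For a trivial action the projection of \<open>W\<close> to \<open>X\<close> factors
  through \<open>Z\<close>, and by \<open>deform\<close> every class upstairs comes from
  \<open>X\<close>. This supplies the premise \<open>onto\<close> of
  \<open>gysin_cup_inject\<close>.\<close>

lemma q_pull_onto:
  assumes "singular_cocycle n W (topspace E \<times> Y) \<psi>"
  shows "\<exists>\<eta>. singular_cocycle n Z T \<eta> \<and> cohomologous n W (topspace E \<times> Y) \<psi> (q_pull n \<eta>)"
proof (intro exI conjI)
  let ?\<phi> = "cochain_map n X (Pair e0) \<psi>"
  show "singular_cocycle n Z T (p_pull n ?\<phi>)"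
    by (intro cocycle_pr singular_cocycle_cochain_map[OF cont_sec sec_in assms])
  have "q_pull n (p_pull n ?\<phi>) = cochain_map n W (borel_to_fixed \<circ> orbit (map_prod \<epsilon> \<tau>)) ?\<phi>"
    by (rule cochain_map_compose[OF cont_q])
  also have "\<dots> = cochain_map n W snd ?\<phi>"
    by (rule cochain_map_cong) (simp add: borel_to_fixed_orbit)
  finally show "cohomologous n W (topspace E \<times> Y) \<psi> (q_pull n (p_pull n ?\<phi>))"
    using deform[OF assms] by simp
qed

lemma cup_bw_inject:
  assumes "singular_cocycle n Z T \<xi>" "singular_coboundary (Suc n) Z T (cup_cochain n (Suc 0) Z \<xi> bw)"
  shows "singular_coboundary n Z T \<xi>"
  using gysin_cup_inject[OF assms q_pull_onto] .

definition kuenneth_cochain :: "nat \<Rightarrow> (nat \<Rightarrow> 'b cochain) \<Rightarrow> ('a \<times> 'b) set cochain" where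
  "kuenneth_cochain n q = (\<Sum>i\<le>n. cup_cochain (n - i) i Z (p_pull (n - i) (q i)) (cup_pow Z bw i))"

lemma kuenneth_cochain_cocycle:
  assumes "\<And>i. i \<le> n \<Longrightarrow> singular_cocycle (n - i) X Y (q i)"
  shows "singular_cocycle n Z T (kuenneth_cochain n q)"
  unfolding kuenneth_cochain_def
proof (rule singular_cocycle_sum)
  fix i assume "i \<in> {..n}"
  then show "singular_cocycle n Z T (cup_cochain (n - i) i Z (p_pull (n - i) (q i)) (cup_pow Z bw i))"
    using singular_cocycle_cup[OF cocycle_pr[OF assms] singular_cocycle_cup_pow[OF w_cocycle], of i i] by simp
qed

lemma kuenneth_cochain_add: "kuenneth_cochain n (\<lambda>i. q i + q' i) = kuenneth_cochain n q + kuenneth_cochain n q'"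
  by (simp add: kuenneth_cochain_def cochain_map_add cup_cochain_add_left sum.distrib)

text \<open>Horner's scheme: the constant term splits off, and one factor u comes out of all the
  others. It is an equality of cochains because the cup product is associative there.\<close>

lemma kuenneth_cochain_Suc:
  assumes "singular_cochain (Suc n) X Y (q 0)"
  shows "kuenneth_cochain (Suc n) q = p_pull (Suc n) (q 0) + cup_cochain n (Suc 0) Z (kuenneth_cochain n (\<lambda>i. q (Suc i))) bw"
proof -
  let ?c = "\<lambda>n i x. cup_cochain (n - i) i Z (p_pull (n - i) x) (cup_pow Z bw i)"
  have "singular_cochain (Suc n) Z T (p_pull (Suc n) (q 0))"
    by (rule singular_cochain_cochain_map[OF cont_pr pr_in assms])
  then have "?c (Suc n) 0 (q 0) = p_pull (Suc n) (q 0)"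
    by (simp add: cup_cochain_unit_right)
  moreover have "?c (Suc n) (Suc i) (q (Suc i)) = cup_cochain n (Suc 0) Z (?c n i (q (Suc i))) bw" if "i \<le> n" for i
    using cup_cochain_assoc[of "n - i" i "Suc 0" Z "p_pull (n - i) (q (Suc i))" "cup_pow Z bw i" bw] that
    by simp
  ultimately show ?thesis
    unfolding kuenneth_cochain_def cup_cochain_sum_left by (subst sum.atMost_Suc_shift) simp
qed

text \<open>Multiples of u die on a fibre, which isolates the constant coefficient
  \<open>q 0\<close>; once it is a coboundary, u can be cancelled from the rest.\<close>

lemma kuenneth_cochain_step:
  assumes q: "\<And>i. i \<le> Suc n \<Longrightarrow> singular_cocycle (Suc n - i) X Y (q i)" and z: "singular_cocycle n Z T z"
    and coh: "cohomologous (Suc n) Z T (cup_cochain n (Suc 0) Z z bw) (kuenneth_cochain (Suc n) q)"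
  shows "singular_coboundary (Suc n) X Y (q 0)" and "cohomologous n Z T z (kuenneth_cochain n (\<lambda>i. q (Suc i)))"
proof -
  have q0: "singular_cochain (Suc n) X Y (q 0)"
    using q[of 0] by (simp add: singular_cocycle_iff)
  have x: "singular_cocycle n Z T (z + kuenneth_cochain n (\<lambda>i. q (Suc i)))"
    using kuenneth_cochain_cocycle[of n "\<lambda>i. q (Suc i)"] q[of "Suc _"] z by (simp add: singular_cocycle_add)
  let ?x = "cup_cochain n (Suc 0) Z (z + kuenneth_cochain n (\<lambda>i. q (Suc i))) bw"
  have cob: "cohomologous (Suc n) Z T (p_pull (Suc n) (q 0)) ?x"
    using coh by (simp add: cohomologous_def kuenneth_cochain_Suc[of n q, OF q0] cup_cochain_add_left add_ac)
  have "cohomologous (Suc n) X Y (q 0) (f_pull (Suc n) ?x)"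
    using cohomologous_fib[OF cob] by (simp add: fib_pr[OF q0])
  then show 1: "singular_coboundary (Suc n) X Y (q 0)"
    using fibre_cup[OF x] cohomologous_coboundary_iff by blast
  have "singular_coboundary (Suc n) Z T ?x"
    using singular_coboundary_cochain_map[OF cont_pr pr_in 1] cohomologous_coboundary_iff[OF cob] by blast
  then show "cohomologous n Z T z (kuenneth_cochain n (\<lambda>i. q (Suc i)))"
    using cup_bw_inject[OF x] by (simp add: cohomologous_def)
qed

lemma kuenneth_cochain_inject:
  assumes "\<And>i. i \<le> n \<Longrightarrow> singular_cocycle (n - i) X Y (q i)" "singular_coboundary n Z T (kuenneth_cochain n q)" "i \<le> n"
  shows "singular_coboundary (n - i) X Y (q i)"
  using assms
proof (induction n arbitrary: q i)
  case 0
  then have q0: "singular_cochain 0 X Y (q 0)"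
    by (simp add: singular_cocycle_iff)
  have "singular_cochain 0 Z T (p_pull 0 (q 0))"
    by (rule singular_cochain_cochain_map[OF cont_pr pr_in q0])
  then have "kuenneth_cochain 0 q = p_pull 0 (q 0)"
    by (simp add: kuenneth_cochain_def cup_cochain_unit_right)
  then show ?case
    using 0(2,3) fib_pr[OF q0] by (metis cochain_map_0 diff_zero le_zero_eq singular_coboundary_at_0)
next
  case (Suc n)
  have "cohomologous (Suc n) Z T (cup_cochain n (Suc 0) Z 0 bw) (kuenneth_cochain (Suc n) q)"
    using Suc.prems(2) by (simp add: cohomologous_def)
  note step = kuenneth_cochain_step[OF Suc.prems(1) singular_cocycle_0 this]
  then have "singular_coboundary n Z T (kuenneth_cochain n (\<lambda>i. q (Suc i)))"
    by (simp add: cohomologous_def)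
  from Suc.IH[OF _ this] show ?case
    using Suc.prems step(1) by (cases i) (force intro: Suc.prems)+
qed

end

section \<open>Descent along the powers of the universal class\<close>

locale borel_fixed = borel
begin

abbreviation "F \<equiv> fixed_space X \<tau>"
abbreviation "S \<equiv> fixed_subspace X \<tau> Y"

lemma fixed_in: "fixed_points X \<tau> \<subseteq> topspace X"
  by (auto simp: fixed_points_def)

lemma borel_trivial_fixed: "borel_trivial E \<epsilon> F \<tau> S s wB"
proof
  show "universal_space E \<epsilon>" by (fact E)
  have "continuous_map F F \<tau>"
    using X by (auto simp: involution_def continuous_map_in_subtopology fixed_points_def
        intro: continuous_map_from_subtopology)
  then show "involution F \<tau>"
    by (simp add: involution_def fixed_points_def)
  show "S \<subseteq> topspace F"
    using fixed_in by auto
  show "\<tau> ` S = S"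
    by (force simp: fixed_points_def)
  show "s (\<epsilon> e) = s e + 1" if "e \<in> topspace E" for e
    by (rule s[OF that])
  show "\<tau> x = x" if "x \<in> topspace F" for x
    using that by (simp add: fixed_points_def)
qed (fact wB, fact q_wB)

sublocale F: borel_trivial E \<epsilon> F \<tau> S s wB
  by (rule borel_trivial_fixed)

abbreviation r_pull :: "nat \<Rightarrow> ('a \<times> 'b) set cochain \<Rightarrow> ('a \<times> 'b) set cochain" where
  "r_pull n \<equiv> cochain_map n F.Z (\<lambda>w. w)"

lemma cont_incl: "continuous_map F.Z Z (\<lambda>w. w)"
proof (rule continuous_compose_quotient_map[OF quotient_map_orbit_space])
  show "continuous_map F.W Z ((\<lambda>w. w) \<circ> orbit (map_prod \<epsilon> \<tau>))"
    using continuous_map_from_subtopology[OF cont_q] by (simp add: prod_topology_subtopology(2) o_def)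
qed

lemma incl_in: "(\<lambda>w. w) \<in> F.T \<rightarrow> T"
  by auto

lemma r_cup: "r_pull (Suc n) (cup_cochain n (Suc 0) Z \<xi> bw) = cup_cochain n (Suc 0) F.Z (r_pull n \<xi>) F.bw"
proof -
  have "r_pull (Suc 0) bw = cochain_map (Suc 0) F.Z (borel_to_base \<circ> (\<lambda>w. w)) wB"
    by (rule cochain_map_compose[OF cont_incl])
  then show ?thesis
    using cochain_map_cup_cochain[OF cont_incl, of n "Suc 0" \<xi> bw] by (simp add: o_def)
qed

lemma cocycle_r: "singular_cocycle n Z T \<phi> \<Longrightarrow> singular_cocycle n F.Z F.T (r_pull n \<phi>)"
  by (rule singular_cocycle_cochain_map[OF cont_incl incl_in])

lemma cohomologous_r: "cohomologous n Z T \<phi> \<psi> \<Longrightarrow> cohomologous n F.Z F.T (r_pull n \<phi>) (r_pull n \<psi>)"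
  by (rule cohomologous_cochain_map[OF cont_incl incl_in])

text \<open>Restriction to the fixed points carries the factor u along, so dividing \<open>y\<close>
  by u shifts the coefficients of its restriction down by one.\<close>

lemma r_step:
  assumes q: "\<And>i. i \<le> Suc n \<Longrightarrow> singular_cocycle (Suc n - i) F S (q i)" and y: "singular_cocycle (Suc n) Z T y"
    and yq: "cohomologous (Suc n) F.Z F.T (r_pull (Suc n) y) (F.kuenneth_cochain (Suc n) q)"
    and cob: "singular_coboundary (Suc n) X Y (f_pull (Suc n) y)"
  obtains z where "singular_cocycle n Z T z" "cohomologous (Suc n) Z T y (cup_cochain n (Suc 0) Z z bw)"
    "cohomologous n F.Z F.T (r_pull n z) (F.kuenneth_cochain n (\<lambda>i. q (Suc i)))"
proof -
  obtain z where z: "singular_cocycle n Z T z" and yz: "cohomologous (Suc n) Z T y (cup_cochain n (Suc 0) Z z bw)"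
    using fibre_kernel[OF y cob] by blast
  have "cohomologous (Suc n) F.Z F.T (cup_cochain n (Suc 0) F.Z (r_pull n z) F.bw) (F.kuenneth_cochain (Suc n) q)"
    using cohomologous_trans[OF cohomologous_sym[OF cohomologous_r[OF yz]] yq] by (simp add: r_cup)
  then have "cohomologous n F.Z F.T (r_pull n z) (F.kuenneth_cochain n (\<lambda>i. q (Suc i)))"
    using F.kuenneth_cochain_step(2)[OF q cocycle_r[OF z]] by blast
  with z yz show thesis
    by (rule that)
qed

text \<open>
  The coefficients of \<open>r y\<close>, as a polynomial in \<open>u\<close>, are the classes of the cocycles \<open>q i\<close>.
\<close>

definition lift_of :: "nat \<Rightarrow> ('a \<times> 'b) set cochain \<Rightarrow> (nat \<Rightarrow> 'b cochain) \<Rightarrow> bool" where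
  "lift_of n y q \<longleftrightarrow> singular_cocycle n Z T y \<and> (\<forall>i\<le>n. singular_cocycle (n - i) F S (q i)) \<and>
    cohomologous n F.Z F.T (r_pull n y) (F.kuenneth_cochain n q)"

lemma lift_of_add: "lift_of n y q \<Longrightarrow> lift_of n y' q' \<Longrightarrow> lift_of n (y + y') (\<lambda>i. q i + q' i)"
  by (auto simp: lift_of_def F.kuenneth_cochain_add cochain_map_add intro: singular_cocycle_add cohomologous_add)

lemma lift_of_step:
  assumes "lift_of (Suc n) y q" "singular_coboundary (Suc n) X Y (f_pull (Suc n) y)"
  obtains z where "lift_of n z (\<lambda>i. q (Suc i))" "cohomologous (Suc n) Z T y (cup_cochain n (Suc 0) Z z bw)"
proof -
  have q: "singular_cocycle (Suc n - i) F S (q i)" if "i \<le> Suc n" for i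
    using assms(1) that by (simp add: lift_of_def)
  obtain z where "singular_cocycle n Z T z" "cohomologous (Suc n) Z T y (cup_cochain n (Suc 0) Z z bw)"
    "cohomologous n F.Z F.T (r_pull n z) (F.kuenneth_cochain n (\<lambda>i. q (Suc i)))"
    using r_step[OF q _ _ assms(2)] assms(1) unfolding lift_of_def by blast
  then show thesis
    using that[of z] q[of "Suc _"] by (simp add: lift_of_def)
qed

lemma lift_of_inject:
  assumes "lift_of n y q" "singular_coboundary n Z T y" "i \<le> n"
  shows "singular_coboundary (n - i) F S (q i)"
proof (rule F.kuenneth_cochain_inject)
  show "singular_coboundary n F.Z F.T (F.kuenneth_cochain n q)"
    using singular_coboundary_cochain_map[OF cont_incl incl_in assms(2)] assms(1)
      cohomologous_coboundary_iff unfolding lift_of_def by blast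
qed (use assms in \<open>auto simp: lift_of_def\<close>)

definition odd_trivial :: bool where
  "odd_trivial \<longleftrightarrow> (\<forall>p a. odd p \<longrightarrow> singular_cocycle p X Y a \<longrightarrow> singular_coboundary p X Y a)"

text \<open>
  All that the induction below uses of a frame; \<open>y\<close> stands for \<open>\<sigma> d\<close> and \<open>q m\<close> for \<open>\<kappa> d\<close>.
\<close>

definition enough_lifts :: bool where
  "enough_lifts \<longleftrightarrow> (\<forall>m d. singular_cocycle (2 * m) X Y d \<longrightarrow>
    (\<exists>y q. lift_of (2 * m) y q \<and> cohomologous (2 * m) X Y (f_pull (2 * m) y) d \<and>
      (\<forall>i\<le>2 * m. m < i \<longrightarrow> singular_coboundary (2 * m - i) F S (q i)) \<and>
      (singular_coboundary m F S (q m) \<longrightarrow> singular_coboundary (2 * m) Z T y)))"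

lemma lift_of_0: "lift_of n 0 (\<lambda>_. 0)"
  by (simp add: lift_of_def F.kuenneth_cochain_def)

text \<open>Here \<open>y'\<close> stands for \<sigma> (\<rho> y), with 0 in its place in odd
  degrees. The last clause holds trivially there; in even degrees it is the trace left by the
  injectivity of \<kappa>.\<close>

lemma companion:
  assumes odd: odd_trivial and lifts: enough_lifts and y: "singular_cocycle n Z T y"
  obtains y' q' where "lift_of n y' q'" "singular_coboundary n X Y (f_pull n (y + y'))"
    "\<And>i. \<lbrakk>i \<le> n; n < 2 * i\<rbrakk> \<Longrightarrow> singular_coboundary (n - i) F S (q' i)"
    "(\<And>i. n = 2 * i \<Longrightarrow> singular_coboundary i F S (q' i)) \<Longrightarrow> singular_coboundary n Z T y'"
proof (cases "even n")
  case True
  then obtain m where n: "n = 2 * m" by (elim evenE)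
  obtain y' q' where l: "lift_of n y' q'" and coh: "cohomologous n X Y (f_pull n y') (f_pull n y)"
    and top: "\<forall>i\<le>n. m < i \<longrightarrow> singular_coboundary (n - i) F S (q' i)"
    and lead: "singular_coboundary m F S (q' m) \<longrightarrow> singular_coboundary n Z T y'"
    using lifts cocycle_fib[OF y] unfolding enough_lifts_def n by blast
  show thesis
  proof (rule that[OF l])
    show "singular_coboundary n X Y (f_pull n (y + y'))"
      using cohomologous_sym[OF coh] by (simp add: cohomologous_def cochain_map_add)
    show "singular_coboundary (n - i) F S (q' i)" if "i \<le> n" "n < 2 * i" for i
      using top that n by simp
    show "singular_coboundary n Z T y'" if "\<And>i. n = 2 * i \<Longrightarrow> singular_coboundary i F S (q' i)"
      using lead that[OF n] by simp
  qed
next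
  case False
  show thesis
  proof (rule that[OF lift_of_0])
    show "singular_coboundary n X Y (f_pull n (y + 0))"
      using odd False cocycle_fib[OF y] by (simp add: odd_trivial_def)
  qed simp_all
qed

text \<open>Smallness is stated through the coefficients that have to vanish, those with
  \<open>n \<le> 2 * i\<close>. Degree 0 stands apart because nothing can be divided by u.\<close>

lemma lift_of_vanish:
  assumes odd: odd_trivial and lifts: enough_lifts
    and "lift_of n y q" "\<And>i. \<lbrakk>i \<le> n; n \<le> 2 * i\<rbrakk> \<Longrightarrow> singular_coboundary (n - i) F S (q i)"
  shows "singular_coboundary n Z T y"
  using assms(3,4)
proof (induction n arbitrary: y q)
  case (0 y q)
  have y: "singular_cocycle 0 Z T y"
    using 0(1) by (simp add: lift_of_def)
  obtain y' q' where l: "lift_of 0 y' q'" and cob: "singular_coboundary 0 X Y (f_pull 0 (y + y'))"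
    and lead: "(\<And>i. 0 = 2 * i \<Longrightarrow> singular_coboundary i F S (q' i)) \<Longrightarrow> singular_coboundary 0 Z T y'"
    by (rule companion[OF odd lifts y]) blast
  have "y + y' = 0"
    using fibre_kernel_0[OF _ cob] lift_of_add[OF 0(1) l] by (simp add: lift_of_def)
  then have "singular_coboundary 0 F S (q 0 + q' 0)"
    using lift_of_inject[OF lift_of_add[OF 0(1) l], of 0] by simp
  moreover have "singular_coboundary 0 F S (q 0)"
    using 0(2)[of 0] by simp
  ultimately have "singular_coboundary 0 Z T y'"
    using lead by (simp add: singular_coboundary_at_0)
  then show ?case
    using \<open>y + y' = 0\<close> by (metis cochain_add_eq_0_iff)
next
  case (Suc n y q)
  have y: "singular_cocycle (Suc n) Z T y"
    using Suc.prems(1) by (simp add: lift_of_def)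
  obtain y' q' where l: "lift_of (Suc n) y' q'" and cob: "singular_coboundary (Suc n) X Y (f_pull (Suc n) (y + y'))"
    and high: "\<And>i. \<lbrakk>i \<le> Suc n; Suc n < 2 * i\<rbrakk> \<Longrightarrow> singular_coboundary (Suc n - i) F S (q' i)"
    and lead: "(\<And>i. Suc n = 2 * i \<Longrightarrow> singular_coboundary i F S (q' i)) \<Longrightarrow> singular_coboundary (Suc n) Z T y'"
    by (rule companion[OF odd lifts y]) blast
  note sum = lift_of_add[OF Suc.prems(1) l]
  obtain z where z: "lift_of n z (\<lambda>i. q (Suc i) + q' (Suc i))"
    and yz: "cohomologous (Suc n) Z T (y + y') (cup_cochain n (Suc 0) Z z bw)"
    by (rule lift_of_step[OF sum cob]) blast
  have "singular_coboundary n Z T z"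
  proof (rule Suc.IH[OF z])
    \<comment> \<open>From \<open>n \<le> 2 * i\<close> follows \<open>Suc n < 2 * Suc i\<close>.
      The inequality is strict, so the coefficient of \<open>y'\<close> vanishes too, whatever its
      leading one is.\<close>
    fix i assume "i \<le> n" "n \<le> 2 * i"
    then show "singular_coboundary (n - i) F S (q (Suc i) + q' (Suc i))"
      using Suc.prems(2)[of "Suc i"] high[of "Suc i"] by (simp add: singular_coboundary_add)
  qed
  then have yy: "singular_coboundary (Suc n) Z T (y + y')"
    using coboundary_cup_bw cohomologous_coboundary_iff[OF yz] by blast
  have "singular_coboundary (Suc n) Z T y'"
  proof (rule lead)
    \<comment> \<open>As \<open>y + y'\<close> bounds, both elements have the same coefficients; the
      middle one of \<open>y\<close> vanishes by smallness, hence so does that of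
      \<open>y'\<close>.\<close>
    fix i assume i: "Suc n = 2 * i"
    then have d: "Suc n - i = i" "i \<le> Suc n" by simp_all
    have "cohomologous i F S (q i) (q' i)"
      using lift_of_inject[OF sum yy d(2)] d(1) by (simp add: cohomologous_def)
    moreover have "singular_coboundary i F S (q i)"
      using Suc.prems(2)[OF d(2)] i d(1) by simp
    ultimately show "singular_coboundary i F S (q' i)"
      using cohomologous_coboundary_iff by blast
  qed
  then show ?case
    using yy cohomologous_coboundary_iff[of "Suc n" Z T y y'] by (simp add: cohomologous_def)
qed

theorem lift_of_unique:
  assumes odd: odd_trivial and lifts: enough_lifts
    and y: "lift_of (2 * m) y q" "lift_of (2 * m) y' q'"
    and fib: "cohomologous (2 * m) X Y (f_pull (2 * m) y) (f_pull (2 * m) y')"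
    and q: "\<And>i. \<lbrakk>i \<le> 2 * m; m < i\<rbrakk> \<Longrightarrow> singular_coboundary (2 * m - i) F S (q i)"
    and q': "\<And>i. \<lbrakk>i \<le> 2 * m; m < i\<rbrakk> \<Longrightarrow> singular_coboundary (2 * m - i) F S (q' i)"
  shows "cohomologous (2 * m) Z T y y'" and "cohomologous m F S (q m) (q' m)"
proof -
  note sum = lift_of_add[OF y]
  have cob: "singular_coboundary (2 * m) X Y (f_pull (2 * m) (y + y'))"
    using fib by (simp add: cohomologous_def cochain_map_add)
  have yy: "singular_coboundary (2 * m) Z T (y + y')"
  proof (cases m)
    case 0
    then show ?thesis
      using fibre_kernel_0[of "y + y'"] cob sum by (simp add: lift_of_def)
  next
    case (Suc k)
    then obtain n where n: "2 * m = Suc n" by simp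
    obtain z where z: "lift_of n z (\<lambda>i. q (Suc i) + q' (Suc i))"
      and yz: "cohomologous (Suc n) Z T (y + y') (cup_cochain n (Suc 0) Z z bw)"
      by (rule lift_of_step[OF sum[unfolded n] cob[unfolded n]]) blast
    have "singular_coboundary n Z T z"
    proof (rule lift_of_vanish[OF odd lifts z])
      \<comment> \<open>The coefficients at \<open>m\<close> may still differ, but division by u
        moves them to \<open>m - 1\<close> in degree \<open>2 * m - 1\<close>, below the
        middle.\<close>
      fix i assume "i \<le> n" "n \<le> 2 * i"
      then have "Suc i \<le> 2 * m" "m < Suc i" "2 * m - Suc i = n - i"
        using n by simp_all
      then show "singular_coboundary (n - i) F S (q (Suc i) + q' (Suc i))"
        using q[of "Suc i"] q'[of "Suc i"] by (simp add: singular_coboundary_add)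
    qed
    then show ?thesis
      using coboundary_cup_bw cohomologous_coboundary_iff[OF yz] unfolding n by blast
  qed
  then show "cohomologous (2 * m) Z T y y'"
    by (simp add: cohomologous_def)
  have "2 * m - m = m" by simp
  then show "cohomologous m F S (q m) (q' m)"
    using lift_of_inject[OF sum yy, of m] by (simp add: cohomologous_def)
qed

end

section \<open>Cohomology classes\<close>

text \<open>The coset makes sense for every cochain. Equality of classes therefore needs no cocycle
  hypotheses in \<open>class_eq_iff\<close>.\<close>

lemma cohomology_class_eq: "cohomology_class p X S \<phi> = {\<psi>. cohomologous p X S \<psi> \<phi>}"
proof -
  have "cohomology_class p X S \<phi> = {h + \<phi> |h. singular_coboundary p X S h}"
    by (auto simp: cohomology_class_def cocycle_group_def r_coset_def plus_fun_def)
  also have "\<dots> = {\<psi>. singular_coboundary p X S (\<psi> + \<phi>)}"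
  proof (intro equalityI subsetI)
    fix \<psi> assume "\<psi> \<in> {h + \<phi> |h. singular_coboundary p X S h}"
    then show "\<psi> \<in> {\<psi>. singular_coboundary p X S (\<psi> + \<phi>)}"
      by (auto simp: add.assoc)
  next
    fix \<psi> assume "\<psi> \<in> {\<psi>. singular_coboundary p X S (\<psi> + \<phi>)}"
    moreover have "\<psi> = (\<psi> + \<phi>) + \<phi>"
      by (simp add: add.assoc)
    ultimately show "\<psi> \<in> {h + \<phi> |h. singular_coboundary p X S h}"
      by blast
  qed
  finally show ?thesis
    by (simp add: cohomologous_def)
qed

lemma class_eq_iff:
  "cohomology_class p X S \<phi> = cohomology_class p X S \<psi> \<longleftrightarrow> cohomologous p X S \<phi> \<psi>"
proof
  assume "cohomology_class p X S \<phi> = cohomology_class p X S \<psi>"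
  moreover have "\<phi> \<in> cohomology_class p X S \<phi>"
    by (simp add: cohomology_class_eq)
  ultimately show "cohomologous p X S \<phi> \<psi>"
    by (simp add: cohomology_class_eq)
next
  assume "cohomologous p X S \<phi> \<psi>"
  then show "cohomology_class p X S \<phi> = cohomology_class p X S \<psi>"
    unfolding cohomology_class_eq using cohomologous_trans cohomologous_sym by blast
qed

lemma carrier_cohomology_group:
  "carrier (cohomology_group p X S) = cohomology_class p X S ` Collect (singular_cocycle p X S)"
  by (auto simp: cohomology_group_def FactGroup_def RCOSETS_def cohomology_class_def cocycle_group_def)

lemma class_in_carrier:
  "singular_cocycle p X S \<phi> \<Longrightarrow> cohomology_class p X S \<phi> \<in> carrier (cohomology_group p X S)"
  by (simp add: carrier_cohomology_group)

lemma carrier_cohomology_groupE: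
  assumes "a \<in> carrier (cohomology_group p X S)"
  obtains \<phi> where "singular_cocycle p X S \<phi>" "a = cohomology_class p X S \<phi>"
  using assms by (auto simp: carrier_cohomology_group)

lemma one_cohomology_group: "\<one>\<^bsub>cohomology_group p X S\<^esub> = cohomology_class p X S 0"
  by (simp add: cohomology_group_def FactGroup_def cohomology_class_eq)

lemma class_eq_one_iff:
  "cohomology_class p X S \<phi> = \<one>\<^bsub>cohomology_group p X S\<^esub> \<longleftrightarrow> singular_coboundary p X S \<phi>"
  by (simp add: one_cohomology_group class_eq_iff)

lemma mult_cohomology_class:
  "cohomology_class p X S \<phi> \<otimes>\<^bsub>cohomology_group p X S\<^esub> cohomology_class p X S \<psi> =
    cohomology_class p X S (\<phi> + \<psi>)"
proof -
  have "cohomology_class p X S \<phi> \<otimes>\<^bsub>cohomology_group p X S\<^esub> cohomology_class p X S \<psi> =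
      {h + k |h k. cohomologous p X S h \<phi> \<and> cohomologous p X S k \<psi>}"
    by (auto simp: cohomology_group_def FactGroup_def cohomology_class_eq set_mult_def cocycle_group_def
        plus_fun_def)
  also have "\<dots> = {\<xi>. cohomologous p X S \<xi> (\<phi> + \<psi>)}"
  proof (intro equalityI subsetI)
    fix \<xi> assume "\<xi> \<in> {\<xi>. cohomologous p X S \<xi> (\<phi> + \<psi>)}"
    then have "cohomologous p X S (\<xi> + \<psi>) \<phi>"
      by (simp add: cohomologous_def add_ac)
    moreover have "\<xi> = (\<xi> + \<psi>) + \<psi>"
      by (simp add: add.assoc)
    ultimately show "\<xi> \<in> {h + k |h k. cohomologous p X S h \<phi> \<and> cohomologous p X S k \<psi>}"
      using cohomologous_refl by blast
  qed (auto intro: cohomologous_add)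
  finally show ?thesis
    by (simp add: cohomology_class_eq)
qed

lemma comm_group_cohomology_group: "comm_group (cohomology_group p X S)"
proof (rule comm_groupI)
  fix a assume "a \<in> carrier (cohomology_group p X S)"
  then obtain \<phi> where "singular_cocycle p X S \<phi>" "a = cohomology_class p X S \<phi>"
    by (rule carrier_cohomology_groupE)
  then show "\<exists>b\<in>carrier (cohomology_group p X S). b \<otimes>\<^bsub>cohomology_group p X S\<^esub> a = \<one>\<^bsub>cohomology_group p X S\<^esub>"
    by (intro bexI[of _ a]) (simp_all add: mult_cohomology_class one_cohomology_group class_in_carrier)
qed (auto simp: mult_cohomology_class one_cohomology_group class_in_carrier singular_cocycle_add add_ac
    elim!: carrier_cohomology_groupE)

lemma finprod_cohomology_class:
  assumes "finite I" "\<And>i. i \<in> I \<Longrightarrow> singular_cocycle n X S (\<phi> i)"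
    and "\<And>i. i \<in> I \<Longrightarrow> f i = cohomology_class n X S (\<phi> i)"
  shows "finprod (cohomology_group n X S) f I = cohomology_class n X S (\<Sum>i\<in>I. \<phi> i)"
proof -
  interpret comm_group "cohomology_group n X S"
    by (rule comm_group_cohomology_group)
  show ?thesis
    using assms
  proof (induction I rule: finite_induct)
    case (insert x I)
    have "f \<in> I \<rightarrow> carrier (cohomology_group n X S)" "f x \<in> carrier (cohomology_group n X S)"
      using insert.prems by (auto simp: class_in_carrier)
    moreover have "(\<Sum>i\<in>insert x I. \<phi> i) = \<phi> x + (\<Sum>i\<in>I. \<phi> i)"
      by (rule sum.insert[OF insert.hyps])
    ultimately show ?case
      using insert by (simp only: finprod_insert mult_cohomology_class insert_iff simp_thms)
  qed (simp add: one_cohomology_group)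
qed

lemma cohomology_map_class:
  assumes "continuous_map X X' g" "g \<in> S \<rightarrow> S'"
  shows "cohomology_map p X S g (cohomology_class p X' S' \<phi>) = cohomology_class p X S (cochain_map p X g \<phi>)"
proof -
  have "cohomology_class p X S (cochain_map p X g \<psi>) = cohomology_class p X S (cochain_map p X g \<phi>)"
    if "\<psi> \<in> cohomology_class p X' S' \<phi>" for \<psi>
  proof -
    have "cohomologous p X' S' \<psi> \<phi>"
      using that by (simp add: cohomology_class_eq)
    then show ?thesis
      unfolding class_eq_iff by (rule cohomologous_cochain_map[OF assms])
  qed
  moreover have "\<phi> \<in> cohomology_class p X' S' \<phi>"
    by (simp add: cohomology_class_eq)
  ultimately show ?thesis
    unfolding cohomology_map_def by blast
qed

lemma cup_class:
  assumes \<phi>: "singular_cocycle p X S \<phi>" and \<psi>: "singular_cocycle q X {} \<psi>"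
  shows "cup p q X S (cohomology_class p X S \<phi>) (cohomology_class q X {} \<psi>) =
    cohomology_class (p + q) X S (cup_cochain p q X \<phi> \<psi>)"
proof -
  have "cohomology_class (p + q) X S (cup_cochain p q X \<phi>' \<psi>') =
      cohomology_class (p + q) X S (cup_cochain p q X \<phi> \<psi>)"
    if "\<phi>' \<in> cohomology_class p X S \<phi>" "\<psi>' \<in> cohomology_class q X {} \<psi>" for \<phi>' \<psi>'
  proof -
    have c: "cohomologous p X S \<phi>' \<phi>" "cohomologous q X {} \<psi>' \<psi>"
      using that by (simp_all add: cohomology_class_eq)
    show ?thesis
      unfolding class_eq_iff by (rule cohomologous_cup[OF c \<phi> cohomologous_cocycle[OF c(2) \<psi>]])
  qed
  moreover have "\<phi> \<in> cohomology_class p X S \<phi>" "\<psi> \<in> cohomology_class q X {} \<psi>"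
    by (simp_all add: cohomology_class_eq)
  ultimately show ?thesis
    unfolding cup_def by blast
qed

lemma cup_power_class:
  assumes w: "singular_cocycle (Suc 0) X {} w"
  shows "cup_power X (cohomology_class (Suc 0) X {} w) i = cohomology_class i X {} (cup_pow X w i)"
proof (induction i)
  case (Suc i)
  then show ?case
    using cup_class[OF singular_cocycle_cup_pow[OF w] w, of i] by simp
qed (simp add: unit_cochain_def)

section \<open>The universal class\<close>

definition const_simplex :: "nat \<Rightarrow> 'a \<Rightarrow> (nat \<Rightarrow> real) \<Rightarrow> 'a" where
  "const_simplex n x = restrict (\<lambda>_. x) (standard_simplex n)"

lemma singular_simplex_const: "x \<in> topspace X \<Longrightarrow> singular_simplex n X (const_simplex n x)"
  by (simp add: singular_simplex_def const_simplex_def)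

lemma simplex_map_const: "simplex_map n (\<lambda>_. x) f = const_simplex n x"
  by (auto simp: simplex_map_def const_simplex_def)

lemma cohomologous_contractible:
  assumes "contractible_space X" "x \<in> topspace X" "singular_cocycle n X {} \<psi>"
  shows "cohomologous n X {} \<psi> (cochain_map n X (\<lambda>_. x) \<psi>)"
proof -
  have "homotopic_with (\<lambda>_. True) X X id (\<lambda>_. x)"
    using assms by (auto simp: contractible_space_alt)
  then have "homotopic_with (\<lambda>k. k \<in> {} \<rightarrow> {}) X X id (\<lambda>_. x)"
    by simp
  then have "cohomologous n X {} (cochain_map n X id \<psi>) (cochain_map n X (\<lambda>_. x) \<psi>)"
    using assms(3) by (rule cohomologous_homotopic)
  moreover have "cochain_map n X id \<psi> = \<psi>"
    using assms(3) by (intro cochain_map_id) (auto simp: singular_cocycle_iff)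
  ultimately show ?thesis by simp
qed

text \<open>In degree 0 cohomologous cochains are equal, so the cocycle is the constant given by its
  value at \<open>x\<close>.\<close>

lemma contractible_cocycle_0:
  assumes "contractible_space X" "x \<in> topspace X" "singular_cocycle 0 X {} \<psi>"
  shows "\<psi> = 0 \<or> \<psi> = unit_cochain X"
proof -
  have \<psi>: "\<psi> = cochain_map 0 X (\<lambda>_. x) \<psi>"
    using cohomologous_contractible[OF assms]
    by (simp add: cohomologous_def singular_coboundary_at_0 cochain_add_eq_0_iff)
  have v: "cochain_map 0 X (\<lambda>_. x) \<psi> f = (if singular_simplex 0 X f then \<psi> (const_simplex 0 x) else 0)" for f
    by (simp add: cochain_map_def simplex_map_const)
  show ?thesis
  proof (cases "\<psi> (const_simplex 0 x) = 0")
    case True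
    have "cochain_map 0 X (\<lambda>_. x) \<psi> = 0"
      by (rule ext) (simp add: v True)
    then show ?thesis using \<psi> by simp
  next
    case False
    then have "\<psi> (const_simplex 0 x) = 1" by simp
    then have "cochain_map 0 X (\<lambda>_. x) \<psi> = unit_cochain X"
      by (intro ext) (simp only: v unit_cochain_def)
    then show ?thesis using \<psi> by simp
  qed
qed

lemma contractible_cocycle_1:
  assumes "contractible_space X" "x \<in> topspace X" "singular_cocycle (Suc 0) X {} \<psi>"
  shows "singular_coboundary (Suc 0) X {} \<psi>"
proof -
  have face: "singular_face (Suc (Suc 0)) k (const_simplex (Suc (Suc 0)) x) = const_simplex (Suc 0) x"
    if "k \<le> Suc (Suc 0)" for k
    using that simplical_face_in_standard_simplex[of "Suc (Suc 0)" k]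
    by (intro ext) (auto simp: singular_face_def const_simplex_def)
  have "coboundary (Suc 0) X \<psi> (const_simplex (Suc (Suc 0)) x) =
      (\<Sum>k\<le>Suc (Suc 0). \<psi> (const_simplex (Suc 0) x))"
    using singular_simplex_const[OF assms(2)] by (simp add: coboundary_def face)
  \<comment> \<open>The constant 2-simplex has three equal faces, and 3 is 1 modulo 2.\<close>
  also have "\<dots> = \<psi> (const_simplex (Suc 0) x)"
    by simp
  finally have "\<psi> (const_simplex (Suc 0) x) = 0"
    using assms(3) by (simp add: singular_cocycle_iff)
  then have "cochain_map (Suc 0) X (\<lambda>_. x) \<psi> = 0"
    by (intro ext) (simp add: cochain_map_def simplex_map_const)
  then show ?thesis
    using cohomologous_contractible[OF assms] by simp
qed

text \<open>Both Gysin theorems are applied to the contractible \<open>E\<close>. If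
  \<open>w\<close> were a coboundary, so would be the unit cochain; and every class of degree 1 is a
  product of \<open>w\<close> with a 0-cocycle, which can only be 0 or the unit. This makes the
  definite description meaningful and independent of \<open>s\<close>.\<close>

lemma universal_class_eq:
  assumes E: "universal_space E \<epsilon>" and s: "\<And>e. e \<in> topspace E \<Longrightarrow> s (\<epsilon> e) = s e + (1 :: bit)"
    and w: "singular_cochain (Suc 0) (orbit_space E \<epsilon>) {} w"
    and q_w: "cochain_map (Suc 0) E (orbit \<epsilon>) w = coboundary 0 E (vertex_cochain E s)"
  shows "universal_class E \<epsilon> = cohomology_class (Suc 0) (orbit_space E \<epsilon>) {} w"
proof -
  interpret double_cover E \<epsilon>
    by (rule double_cover_universal[OF E])
  interpret signed_double_cover E \<epsilon> s w "{}"
    by unfold_locales (use s w q_w in auto)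
  have contr: "contractible_space E"
    using E by (simp add: universal_space_def)
  obtain e where e: "e \<in> topspace E"
    using E unfolding universal_space_def by blast
  have unit: "q_pull 0 (unit_cochain Z) = unit_cochain E"
    by (rule cochain_map_unit[OF cont_q])
  have cocycle_unit: "singular_cocycle 0 Z {} (unit_cochain Z)"
    by (rule singular_cocycle_unit)
  have cup_unit: "cup_cochain 0 (Suc 0) Z (unit_cochain Z) w = w"
    by (rule cup_cochain_unit_left[OF w])
  let ?H = "cohomology_group (Suc 0) Z {}"
  have nz: "\<not> singular_coboundary (Suc 0) Z {} w"
  proof
    assume cob: "singular_coboundary (Suc 0) Z {} w"
    have "singular_coboundary 0 Z {} (unit_cochain Z)"
    proof (rule gysin_cup_inject[simplified])
      show "singular_cocycle 0 Z {} (unit_cochain Z)" by (fact cocycle_unit)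
      show "singular_coboundary (Suc 0) Z {} (cup_cochain 0 (Suc 0) Z (unit_cochain Z) w)"
        by (simp add: cup_unit cob)
      fix \<psi> assume "singular_cocycle 0 E {} \<psi>"
      then consider "\<psi> = q_pull 0 0" | "\<psi> = q_pull 0 (unit_cochain Z)"
        using contractible_cocycle_0[OF contr e] unit by auto
      then show "\<exists>\<eta>. singular_cocycle 0 Z {} \<eta> \<and> cohomologous 0 E {} \<psi> (q_pull 0 \<eta>)"
        using cocycle_unit singular_cocycle_0 cohomologous_refl by metis
    qed
    then have "unit_cochain E = 0"
      using unit by (simp add: singular_coboundary_at_0)
    then have "unit_cochain E (const_simplex 0 e) = 0"
      by simp
    then show False
      using singular_simplex_const[OF e] by (simp add: unit_cochain_def)
  qed
  have uniq: "u = cohomology_class (Suc 0) Z {} w" if "u \<in> carrier ?H" "u \<noteq> \<one>\<^bsub>?H\<^esub>" for u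
  proof -
    obtain \<phi> where \<phi>: "singular_cocycle (Suc 0) Z {} \<phi>" "u = cohomology_class (Suc 0) Z {} \<phi>"
      using \<open>u \<in> carrier ?H\<close> by (rule carrier_cohomology_groupE)
    have "singular_coboundary (Suc 0) E {} (q_pull (Suc 0) \<phi>)"
      by (intro contractible_cocycle_1[OF contr e] singular_cocycle_cochain_map[OF cont_q _ \<phi>(1)]) simp
    then obtain \<xi> where \<xi>: "singular_cocycle 0 Z {} \<xi>"
      and coh: "cohomologous (Suc 0) Z {} \<phi> (cup_cochain 0 (Suc 0) Z \<xi> w)"
      using gysin_kernel_q[of 0 \<phi>] \<phi>(1) by auto
    have "singular_cocycle 0 E {} (q_pull 0 \<xi>)"
      by (rule singular_cocycle_cochain_map[OF cont_q _ \<xi>]) simp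
    then have "q_pull 0 \<xi> = q_pull 0 0 \<or> q_pull 0 \<xi> = q_pull 0 (unit_cochain Z)"
      using contractible_cocycle_0[OF contr e] unit by simp
    moreover have "\<xi> = \<psi>" if "q_pull 0 \<xi> = q_pull 0 \<psi>" "singular_cocycle 0 Z {} \<psi>" for \<psi>
      using q_pull_inject[OF _ _ that(1), of "{}" "{}"] \<xi> that(2) by (simp add: singular_cocycle_iff)
    ultimately have "\<xi> = 0 \<or> \<xi> = unit_cochain Z"
      using cocycle_unit singular_cocycle_0 by blast
    then show ?thesis
    proof
      assume "\<xi> = 0"
      then have "u = \<one>\<^bsub>?H\<^esub>"
        using coh \<phi>(2) by (simp add: class_eq_one_iff)
      then show ?thesis using that(2) by simp
    next
      assume "\<xi> = unit_cochain Z"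
      then show ?thesis
        using coh \<phi>(2) by (simp add: class_eq_iff cup_unit)
    qed
  qed
  have "universal_class E \<epsilon> = (THE u. u \<in> carrier ?H \<and> u \<noteq> \<one>\<^bsub>?H\<^esub>)"
    by (simp add: universal_class_def)
  also have "\<dots> = cohomology_class (Suc 0) Z {} w"
    by (rule the_equality) (use w_cocycle nz uniq in \<open>auto simp: class_in_carrier class_eq_one_iff\<close>)
  finally show ?thesis .
qed

lemma (in borel) universal_class: "universal_class E \<epsilon> = cohomology_class (Suc 0) (orbit_space E \<epsilon>) {} wB"
  by (rule universal_class_eq[OF E s wB q_wB])

lemma (in borel) wB_cocycle: "singular_cocycle (Suc 0) (orbit_space E \<epsilon>) {} wB"
proof -
  interpret E: double_cover E \<epsilon>
    by (rule double_cover_universal[OF E])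
  interpret E: signed_double_cover E \<epsilon> s wB "{}"
    by unfold_locales (use s wB q_wB in auto)
  show ?thesis
    by (rule E.w_cocycle)
qed

lemma (in borel_trivial) kuenneth_class:
  assumes q: "\<And>i. i \<le> n \<Longrightarrow> singular_cocycle (n - i) X Y (q i)"
    and c: "\<And>i. i \<le> n \<Longrightarrow> c i = cohomology_class (n - i) X Y (q i)"
  shows "kuenneth E \<epsilon> n X \<tau> Y c = cohomology_class n Z T (kuenneth_cochain n q)"
proof -
  let ?B = "orbit_space E \<epsilon>"
  have pow: "cohomology_map i Z {} borel_to_base (cup_power ?B (universal_class E \<epsilon>) i) =
      cohomology_class i Z {} (cup_pow Z bw i)" for i
    by (simp add: universal_class cup_power_class[OF wB_cocycle]
        cohomology_map_class[OF cont_borel_to_base, of "{}" "{}"] cochain_map_cup_pow[OF cont_borel_to_base])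
  have cup_term: "cup (n - i) i Z T (cohomology_map (n - i) Z T borel_to_fixed (c i))
      (cohomology_map i Z {} borel_to_base (cup_power ?B (universal_class E \<epsilon>) i)) =
      cohomology_class n Z T (cup_cochain (n - i) i Z (p_pull (n - i) (q i)) (cup_pow Z bw i))"
    if "i \<le> n" for i
    using cup_class[OF cocycle_pr[OF q[OF that]] singular_cocycle_cup_pow[OF w_cocycle, of i]] that
    by (simp add: c[OF that] cohomology_map_class[OF cont_pr pr_in] pow)
  have "kuenneth E \<epsilon> n X \<tau> Y c = finprod (cohomology_group n Z T)
      (\<lambda>i. cup (n - i) i Z T (cohomology_map (n - i) Z T borel_to_fixed (c i))
        (cohomology_map i Z {} borel_to_base (cup_power ?B (universal_class E \<epsilon>) i))) {..n}"
    by (simp add: kuenneth_def equivariant_cohomology_def borel_construction_def borel_subspace_def Let_def)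
  also have "\<dots> = cohomology_class n Z T (kuenneth_cochain n q)"
    unfolding kuenneth_cochain_def
  proof (rule finprod_cohomology_class)
    fix i assume "i \<in> {..n}"
    then show "singular_cocycle n Z T (cup_cochain (n - i) i Z (p_pull (n - i) (q i)) (cup_pow Z bw i))"
      using singular_cocycle_cup[OF cocycle_pr[OF q] singular_cocycle_cup_pow[OF w_cocycle], of i i] by simp
  qed (simp_all add: cup_term)
  finally show ?thesis .
qed

section \<open>Frames\<close>

context borel_fixed
begin

lemma equivariant_cohomology_eq: "equivariant_cohomology E \<epsilon> n X \<tau> Y = cohomology_group n Z T"
  by (simp add: equivariant_cohomology_def borel_construction_def borel_subspace_def)

lemma restrict_fixed_class:
  "restrict_fixed E \<epsilon> n X \<tau> Y (cohomology_class n Z T y) = cohomology_class n F.Z F.T (r_pull n y)"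
  unfolding restrict_fixed_def borel_construction_def borel_subspace_def
  by (rule cohomology_map_class[OF cont_incl incl_in])

lemma restrict_fibre_class:
  "restrict_fibre E \<epsilon> n X \<tau> Y (cohomology_class n Z T y) = cohomology_class n X Y (f_pull n y)"
  unfolding restrict_fibre_def by (rule cohomology_map_class[OF cont_fib fib_in])

lemma conjugation_equation_lift:
  assumes conj: "conjugation_equation E \<epsilon> X \<tau> Y \<kappa> \<sigma> m a"
    and y: "singular_cocycle (2 * m) Z T y" "\<sigma> m a = cohomology_class (2 * m) Z T y"
    and k: "singular_cocycle m F S k" "\<kappa> m a = cohomology_class m F S k"
  obtains q where "lift_of (2 * m) y q" "\<kappa> m a = cohomology_class m F S (q m)"
    "\<And>i. \<lbrakk>i \<le> 2 * m; m < i\<rbrakk> \<Longrightarrow> singular_coboundary (2 * m - i) F S (q i)"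
proof -
  let ?n = "2 * m"
  obtain lt where lt: "lt \<in> carrier (poly_group ?n F S)" "poly_degree_less ?n F S m lt"
    and eq: "restrict_fixed E \<epsilon> ?n X \<tau> Y (\<sigma> m a) =
      kuenneth E \<epsilon> ?n F \<tau> S (poly_monom ?n F S (\<kappa> m a) m \<otimes>\<^bsub>poly_group ?n F S\<^esub> lt)"
    using conj by (auto simp: conjugation_equation_def Let_def)
  have "\<exists>l. singular_cocycle (?n - i) F S l \<and> lt i = cohomology_class (?n - i) F S l" if "i \<le> ?n" for i
  proof -
    have "lt i \<in> carrier (cohomology_group (?n - i) F S)"
      using lt(1) that by (auto simp: poly_group_def)
    then show ?thesis
      by (rule carrier_cohomology_groupE) blast
  qed
  then obtain l where l: "\<And>i. i \<le> ?n \<Longrightarrow> singular_cocycle (?n - i) F S (l i)"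
    "\<And>i. i \<le> ?n \<Longrightarrow> lt i = cohomology_class (?n - i) F S (l i)"
    by metis
  have high: "singular_coboundary (?n - i) F S (l i)" if "i \<le> ?n" "m \<le> i" for i
    using lt(2) l(2)[OF that(1)] that by (metis poly_degree_less_def class_eq_one_iff)
  \<comment> \<open>The family \<open>lt\<close> may carry a nonzero cochain at \<open>m\<close> as
    well, but \<open>poly_degree_less\<close> includes \<open>i = m\<close>, so that it is a
    coboundary and \<open>q m\<close> still represents \<kappa> a.\<close>
  define q where "q i = (if i = m then k else 0) + l i" for i
  have mm: "?n - m = m" by simp
  have q: "singular_cocycle (?n - i) F S (q i)" if "i \<le> ?n" for i
    using l(1)[OF that] k(1) mm by (auto simp: q_def intro: singular_cocycle_add)
  have c: "(poly_monom ?n F S (\<kappa> m a) m \<otimes>\<^bsub>poly_group ?n F S\<^esub> lt) i = cohomology_class (?n - i) F S (q i)"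
    if "i \<le> ?n" for i
    using that mm
    by (simp add: poly_group_def poly_monom_def q_def k(2) l(2) mult_cohomology_class one_cohomology_group)
  have "cohomology_class ?n F.Z F.T (r_pull ?n y) = cohomology_class ?n F.Z F.T (F.kuenneth_cochain ?n q)"
    using eq F.kuenneth_class[OF q c] by (simp add: y(2) restrict_fixed_class)
  then have "lift_of ?n y q"
    using y(1) q by (simp add: lift_of_def class_eq_iff)
  moreover have "\<kappa> m a = cohomology_class m F S (q m)"
    using high[of m] mm by (simp add: q_def k(2) class_eq_iff cohomologous_def)
  moreover have "singular_coboundary (?n - i) F S (q i)" if "i \<le> ?n" "m < i" for i
    using high[of i] that by (simp add: q_def)
  ultimately show thesis
    by (rule that)
qed

lemma frame_lift:
  assumes frame: "cohomology_frame E \<epsilon> X \<tau> Y \<kappa> \<sigma>" and d: "singular_cocycle (2 * m) X Y d"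
  obtains y q where "lift_of (2 * m) y q" "cohomologous (2 * m) X Y (f_pull (2 * m) y) d"
    "\<And>i. \<lbrakk>i \<le> 2 * m; m < i\<rbrakk> \<Longrightarrow> singular_coboundary (2 * m - i) F S (q i)"
    "\<sigma> m (cohomology_class (2 * m) X Y d) = cohomology_class (2 * m) Z T y"
    "\<kappa> m (cohomology_class (2 * m) X Y d) = cohomology_class m F S (q m)"
proof -
  let ?a = "cohomology_class (2 * m) X Y d"
  have a: "?a \<in> carrier (cohomology_group (2 * m) X Y)"
    by (rule class_in_carrier[OF d])
  have "\<sigma> m ?a \<in> carrier (cohomology_group (2 * m) Z T)"
    using frame a by (auto simp: cohomology_frame_def equivariant_cohomology_eq hom_def)
  then obtain y where y: "singular_cocycle (2 * m) Z T y" "\<sigma> m ?a = cohomology_class (2 * m) Z T y"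
    by (rule carrier_cohomology_groupE)
  have "\<kappa> m \<in> iso (cohomology_group (2 * m) X Y) (cohomology_group m F S)"
    using frame by (simp add: cohomology_frame_def)
  then have "\<kappa> m ?a \<in> carrier (cohomology_group m F S)"
    using a by (auto simp: iso_def hom_def)
  then obtain k where k: "singular_cocycle m F S k" "\<kappa> m ?a = cohomology_class m F S k"
    by (rule carrier_cohomology_groupE)
  have conj: "conjugation_equation E \<epsilon> X \<tau> Y \<kappa> \<sigma> m ?a"
    using frame a by (simp add: cohomology_frame_def)
  obtain q where q: "lift_of (2 * m) y q" "\<kappa> m ?a = cohomology_class m F S (q m)"
    "\<And>i. \<lbrakk>i \<le> 2 * m; m < i\<rbrakk> \<Longrightarrow> singular_coboundary (2 * m - i) F S (q i)"
    by (rule conjugation_equation_lift[where \<kappa> = \<kappa> and \<sigma> = \<sigma> and m = m and a = ?a, OF conj y k]) blast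
  have "restrict_fibre E \<epsilon> (2 * m) X \<tau> Y (\<sigma> m ?a) = ?a"
    using frame a by (simp add: cohomology_frame_def)
  then have "cohomologous (2 * m) X Y (f_pull (2 * m) y) d"
    by (simp add: y(2) restrict_fibre_class class_eq_iff)
  then show thesis
    by (rule that[OF q(1) _ q(3) y(2) q(2)])
qed

text \<open>Only the last clause goes beyond \<open>frame_lift\<close>: if the leading coefficient
  bounds, injectivity of \<kappa> makes the class of \<open>d\<close> trivial, and the homomorphism
  \<sigma> sends it to the trivial class of \<open>y\<close>.\<close>

lemma enough_lifts_frame:
  assumes frame: "cohomology_frame E \<epsilon> X \<tau> Y \<kappa> \<sigma>"
  shows enough_lifts
  unfolding enough_lifts_def
proof (intro allI impI)
  fix m d assume d: "singular_cocycle (2 * m) X Y d"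
  let ?H = "cohomology_group (2 * m) X Y" and ?K = "cohomology_group m F S"
  interpret H: comm_group ?H by (rule comm_group_cohomology_group)
  interpret K: comm_group ?K by (rule comm_group_cohomology_group)
  interpret Q: comm_group "cohomology_group (2 * m) Z T" by (rule comm_group_cohomology_group)
  obtain y q where l: "lift_of (2 * m) y q" "cohomologous (2 * m) X Y (f_pull (2 * m) y) d"
    "\<And>i. \<lbrakk>i \<le> 2 * m; m < i\<rbrakk> \<Longrightarrow> singular_coboundary (2 * m - i) F S (q i)"
    and \<sigma>: "\<sigma> m (cohomology_class (2 * m) X Y d) = cohomology_class (2 * m) Z T y"
    and \<kappa>: "\<kappa> m (cohomology_class (2 * m) X Y d) = cohomology_class m F S (q m)"
    by (rule frame_lift[OF frame d]) blast
  have "singular_coboundary (2 * m) Z T y" if "singular_coboundary m F S (q m)"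
  proof -
    have iso: "\<kappa> m \<in> iso ?H ?K"
      using frame by (simp add: cohomology_frame_def)
    have "\<kappa> m (cohomology_class (2 * m) X Y d) = \<kappa> m \<one>\<^bsub>?H\<^esub>"
      using that \<kappa> hom_one[of "\<kappa> m" ?H ?K] iso H.is_group K.is_group
      by (simp add: iso_def class_eq_one_iff)
    then have "cohomology_class (2 * m) X Y d = \<one>\<^bsub>?H\<^esub>"
      using iso class_in_carrier[OF d] H.one_closed by (auto simp: iso_def bij_betw_def inj_on_def)
    moreover have "\<sigma> m \<one>\<^bsub>?H\<^esub> = \<one>\<^bsub>cohomology_group (2 * m) Z T\<^esub>"
      using frame H.is_group Q.is_group
      by (intro hom_one) (simp_all add: cohomology_frame_def equivariant_cohomology_eq)
    ultimately show ?thesis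
      using \<sigma> class_eq_one_iff by metis
  qed
  then show "\<exists>y q. lift_of (2 * m) y q \<and> cohomologous (2 * m) X Y (f_pull (2 * m) y) d \<and>
      (\<forall>i\<le>2 * m. m < i \<longrightarrow> singular_coboundary (2 * m - i) F S (q i)) \<and>
      (singular_coboundary m F S (q m) \<longrightarrow> singular_coboundary (2 * m) Z T y)"
    using l by blast
qed

theorem frame_unique:
  assumes odd: odd_trivial and frame: "cohomology_frame E \<epsilon> X \<tau> Y \<kappa> \<sigma>"
    and frame': "cohomology_frame E \<epsilon> X \<tau> Y \<kappa>' \<sigma>'"
    and a: "a \<in> carrier (cohomology_group (2 * m) X Y)"
  shows "\<kappa> m a = \<kappa>' m a \<and> \<sigma> m a = \<sigma>' m a"
proof -
  obtain d where d: "singular_cocycle (2 * m) X Y d" and ad: "a = cohomology_class (2 * m) X Y d"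
    using a by (rule carrier_cohomology_groupE)
  obtain y q where l: "lift_of (2 * m) y q" "cohomologous (2 * m) X Y (f_pull (2 * m) y) d"
    "\<And>i. \<lbrakk>i \<le> 2 * m; m < i\<rbrakk> \<Longrightarrow> singular_coboundary (2 * m - i) F S (q i)"
    and v: "\<sigma> m a = cohomology_class (2 * m) Z T y" "\<kappa> m a = cohomology_class m F S (q m)"
    unfolding ad by (rule frame_lift[OF frame d]) blast
  obtain y' q' where l': "lift_of (2 * m) y' q'" "cohomologous (2 * m) X Y (f_pull (2 * m) y') d"
    "\<And>i. \<lbrakk>i \<le> 2 * m; m < i\<rbrakk> \<Longrightarrow> singular_coboundary (2 * m - i) F S (q' i)"
    and v': "\<sigma>' m a = cohomology_class (2 * m) Z T y'" "\<kappa>' m a = cohomology_class m F S (q' m)"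
    unfolding ad by (rule frame_lift[OF frame' d]) blast
  have "cohomologous (2 * m) X Y (f_pull (2 * m) y) (f_pull (2 * m) y')"
    using l(2) cohomologous_sym[OF l'(2)] by (rule cohomologous_trans)
  from lift_of_unique[OF odd enough_lifts_frame[OF frame] l(1) l'(1) this l(3) l'(3)]
  show ?thesis
    by (simp add: v v' class_eq_iff)
qed

end

theorem corollary3p12:
  fixes E :: "'e topology" and \<epsilon> :: "'e \<Rightarrow> 'e"
    and X :: "'a topology" and \<tau> :: "'a \<Rightarrow> 'a" and X\<^sub>0 :: "'a set"
    and \<kappa> \<kappa>' :: "nat \<Rightarrow> 'a cochain set \<Rightarrow> 'a cochain set"
    and \<sigma> \<sigma>' :: "nat \<Rightarrow> 'a cochain set \<Rightarrow> ('e \<times> 'a) set cochain set"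
  assumes "universal_space E \<epsilon>"
    and "involution X \<tau>"
    and "invariant_subspace X \<tau> X\<^sub>0"
    and "\<And>p. odd p \<Longrightarrow> trivial_group (cohomology_group p X X\<^sub>0)"
    and "cohomology_frame E \<epsilon> X \<tau> X\<^sub>0 \<kappa> \<sigma>"
    and "cohomology_frame E \<epsilon> X \<tau> X\<^sub>0 \<kappa>' \<sigma>'"
  shows "\<forall>m. \<forall>a \<in> carrier (cohomology_group (2 * m) X X\<^sub>0). \<kappa> m a = \<kappa>' m a \<and> \<sigma> m a = \<sigma>' m a"
proof (intro allI ballI)
  fix m a assume a: "a \<in> carrier (cohomology_group (2 * m) X X\<^sub>0)"
  interpret E: double_cover E \<epsilon>
    by (rule double_cover_universal[OF assms(1)])
  \<comment> \<open>The sign and its characteristic cochain are auxiliary choices, made once for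
    both frames.\<close>
  obtain s where s: "\<And>e. e \<in> topspace E \<Longrightarrow> s (\<epsilon> e) = s e + (1 :: bit)"
    by (rule E.sign_exists) blast
  obtain w where w: "singular_cochain (Suc 0) (orbit_space E \<epsilon>) {} w"
    "cochain_map (Suc 0) E (orbit \<epsilon>) w = coboundary 0 E (vertex_cochain E s)"
    by (rule E.characteristic_cochain_exists[where s = s, OF s]) blast
  interpret B: borel_fixed E \<epsilon> X \<tau> X\<^sub>0 s w
    by unfold_locales (use assms s w in \<open>auto simp: invariant_subspace_def\<close>)
  have "singular_coboundary p X X\<^sub>0 d" if "odd p" "singular_cocycle p X X\<^sub>0 d" for p d
    using assms(4)[OF that(1)] class_in_carrier[OF that(2)] class_eq_one_iff[of p X X\<^sub>0 d]
    by (simp add: trivial_group_def)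
  then have "B.odd_trivial"
    by (simp add: B.odd_trivial_def)
  then show "\<kappa> m a = \<kappa>' m a \<and> \<sigma> m a = \<sigma>' m a"
    using B.frame_unique assms(5,6) a by blast
qed

end
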